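(* For every $d\ge 2$, the set $\mathcal{P}_{2d}(\mathbb{C})$ of Pellian polynomials is dense in $\mathcal{B}_{2d}(\mathbb{C})$ with respect to the complex topology.
   Context: $\mathcal{B}_{2d}\subset\mathbb{A}^{2d}_{\mathbb{C}}$ is the Zariski-open set of $\overline{s}=(s_1,\dots,s_{2d})$ such that $D_{\overline{s}}(t)=t^{2d}+s_1t^{2d-1}+\dots+s_{2d}$ has non-zero discriminant. A polynomial $D\in\mathbb{C}[t]$ is Pellian if the Pell–Abel equation $A^2-DB^2=1$ has a solution with $A,B\in\mathbb{C}[t]$, $B\neq0$. The Pellian locus is $\mathcal{P}_{2d}=\{\overline{s}\in\mathcal{B}_{2d}: D_{\overline{s}}\text{ is Pellian}\}$. *)

theory Defs
  imports "HOL-Analysis.Analysis" "Subresultants.Resultant_Prelim"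
begin

definition discriminant :: "'a::field poly \<Rightarrow> 'a" where
  "discriminant f = (-1) ^ (degree f * (degree f - 1) div 2)
      * resultant f (pderiv f) / lead_coeff f"

(* D_s(t) = t^(2d) + s_1 t^(2d-1) + ... + s_(2d); s is the list [s_1,...,s_(2d)] *)
definition D_poly :: "complex list \<Rightarrow> complex poly" where
  "D_poly s = monom 1 (length s) + (\<Sum>i<length s. monom (s ! i) (length s - 1 - i))"

definition pellian :: "complex poly \<Rightarrow> bool" where
  "pellian D \<longleftrightarrow> (\<exists>A B :: complex poly. A\<^sup>2 - D * B\<^sup>2 = 1 \<and> B \<noteq> 0)"

definition B_set :: "nat \<Rightarrow> complex list set" where
  "B_set d = {s. length s = 2 * d \<and> discriminant (D_poly s) \<noteq> 0}"

definition P_set :: "nat \<Rightarrow> complex list set" where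
  "P_set d = {s \<in> B_set d. pellian (D_poly s)}"

end

theory Submission
  imports Defs
    "HOL-Complex_Analysis.Complex_Analysis"
    "Subresultants.Subresultant_Gcd"
    "HOL-Computational_Algebra.Field_as_Ring"
    "HOL-Computational_Algebra.Fundamental_Theorem_Algebra"
begin

text \<open>
  A squarefree monic \<open>D\<close> of degree \<open>2d\<close> is Pellian as soon as some differential \<open>p dt/\<surd>D\<close>, with \<open>p\<close>
  monic of degree \<open>d - 1\<close>, has all its periods in \<open>(2\<pi>i/n)\<int>\<close>: if \<open>G\<close> is a primitive, then
  \<open>A = cosh (n G)\<close> and \<open>B = sinh (n G)/\<surd>D\<close> are single valued, hence polynomials, and
  \<open>A\<^sup>2 - D B\<^sup>2 = 1\<close>.

  For every \<open>D\<close> there is a \<open>p\<close> with purely imaginary periods. The real parts of the \<open>2d - 2\<close> periods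
  depend real-affinely on the \<open>d - 1\<close> free complex coefficients of \<open>p\<close>, and the homogeneous system is
  injective: a holomorphic differential with imaginary periods has a single valued \<open>|Re G|\<close>, which
  vanishes at the branch points, and the maximum principle on the sphere forces it to be constant.

  Finally the period map is locally surjective in \<open>(D, p)\<close>, so that the imaginary periods can be moved to
  rational multiples of \<open>2\<pi>i\<close> by an arbitrarily small change of \<open>D\<close>. One varies \<open>p\<close> and \<open>d - 1\<close> roots
  of \<open>D\<close> at which \<open>p\<close> does not vanish. If the derivative of the periods in such a direction is zero, the
  varied differential is exact, \<open>d(Q/\<surd>D)\<close> with \<open>Q\<close> a polynomial of degree at most \<open>d\<close>, and \<open>Q\<close>
  vanishes at the \<open>d + 1\<close> unvaried roots, so it is zero.

  The curve \<open>y\<^sup>2 = D(t)\<close> is never constructed. After a perturbation the roots have distinct arguments, and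
  \<open>\<surd>D\<close> has one branch on the plane cut outwards along the rays from the roots and another one on the
  plane cut inwards along the segments to the origin. Both domains are star-shaped (the second one with
  respect to infinity), they overlap in the \<open>2d\<close> sectors between the rays, and there the two branches
  agree up to a sign that alternates from sector to sector.
\<close>

text \<open>The counts fit because \<open>y^2 = D(t)\<close> has genus \<open>d - 1\<close>. There
  are \<open>2d\<close> sectors, and in each of them a primitive on the inner domain equals plus or
  minus the outer one up to a constant. The two free constants of integration absorb one such
  constant for each sign; the remaining \<open>2d - 2\<close> are governed by differences between
  sectors \<open>k\<close> and \<open>k + 2\<close>, where the signs agree, and these are the
  periods. The deformations have the same dimension: \<open>d - 1\<close> moving roots and
  \<open>d - 1\<close> lower coefficients of \<open>p\<close>. Since \<open>p\<close> is monic, the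
  residue at infinity is 1 up to sign. This period is fixed; it lies in \<open>2 pi i\<close> times
  the integers, and it makes \<open>exp (n G)\<close> grow like a power of \<open>t\<close>. The
  obstacle is that periods are differentiated with respect to \<open>D\<close> while the sectors
  depend on \<open>D\<close>. So the integration paths are given by angles \<open>\<theta>\<close>
  and a radius \<open>\<rho>\<close> that are kept apart from the roots, and all conditions on the
  roots are open. As \<open>d\<close> is a variable, parameter tuples are functions on
  \<open>nat\<close>, and the local surjectivity is derived from partial derivatives.\<close>

lemma resultant_nonzero_of_no_common_root:
  fixes f g :: "complex poly"
  assumes "f \<noteq> 0" "\<And>x. poly f x = 0 \<Longrightarrow> poly g x \<noteq> 0"
  shows "resultant f g \<noteq> 0"
proof
  assume "resultant f g = 0"
  then have "degree (gcd f g) \<noteq> 0"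
    by (simp add: resultant_0_gcd)
  then obtain x where "poly (gcd f g) x = 0"
    using alg_closed_imp_poly_has_root[of "gcd f g"] by auto
  then have "poly f x = 0" "poly g x = 0"
    by (meson dvd_trans gcd_dvd1 gcd_dvd2 poly_eq_0_iff_dvd)+
  with assms show False by blast
qed

text \<open>Injectivity is what the period arguments deliver, and for a square matrix it gives an
  inverse on both sides. The Newton iteration uses \<open>N M = 1\<close> to contract and
  \<open>M N = 1\<close> to turn a fixed point into a solution. The field is arbitrary because the
  system for imaginary periods is real while the Jacobian is complex.\<close>

lemma square_system_inverse:
  fixes M :: "nat \<Rightarrow> nat \<Rightarrow> 'a::field"
  assumes inj: "\<And>x. \<forall>k<n. (\<Sum>j<n. M k j * x j) = 0 \<Longrightarrow> \<forall>j<n. x j = 0"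
  obtains N where "\<And>j l. j < n \<Longrightarrow> l < n \<Longrightarrow> (\<Sum>k<n. N j k * M k l) = (if j = l then 1 else 0)"
    and "\<And>k l. k < n \<Longrightarrow> l < n \<Longrightarrow> (\<Sum>j<n. M k j * N j l) = (if k = l then 1 else 0)"
proof -
  define A where "A = mat n n (\<lambda>(k, j). M k j)"
  have A: "A \<in> carrier_mat n n" by (simp add: A_def)
  have "det A \<noteq> 0"
  proof
    assume "det A = 0"
    then obtain v where v: "v \<in> carrier_vec n" "v \<noteq> 0\<^sub>v n" "A *\<^sub>v v = 0\<^sub>v n"
      using det_0_iff_vec_prod_zero_field[OF A] by blast
    have "(\<Sum>j<n. M k j * v $ j) = 0" if "k < n" for k
    proof -
      have "(A *\<^sub>v v) $ k = 0" using v(3) that by simp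
      then show ?thesis
        using that v(1) by (simp add: A_def scalar_prod_def lessThan_atLeast0)
    qed
    then have "\<forall>j<n. v $ j = 0" using inj[of "\<lambda>j. v $ j"] by simp
    then have "v = 0\<^sub>v n" using v(1) by (intro eq_vecI) auto
    with v(2) show False by simp
  qed
  from det_non_zero_imp_unit[OF A this, of "()"]
  obtain B where B: "B \<in> carrier_mat n n" "B * A = 1\<^sub>m n" "A * B = 1\<^sub>m n"
    unfolding Units_def ring_mat_def by auto
  show ?thesis
  proof (rule that[of "\<lambda>j k. B $$ (j, k)"])
    fix j l assume jl: "j < n" "l < n"
    have "(B * A) $$ (j, l) = (if j = l then 1 else 0)" using B(2) jl by simp
    then show "(\<Sum>k<n. B $$ (j, k) * M k l) = (if j = l then 1 else 0)"
      using jl B(1) by (simp add: A_def scalar_prod_def lessThan_atLeast0)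
  next
    fix j l assume jl: "j < n" "l < n"
    have "(A * B) $$ (j, l) = (if j = l then 1 else 0)" using B(3) jl by simp
    then show "(\<Sum>k<n. M j k * B $$ (k, l)) = (if j = l then 1 else 0)"
      using jl B(1) by (simp add: A_def scalar_prod_def lessThan_atLeast0)
  qed
qed

section \<open>Local surjectivity of maps with invertible Jacobian\<close>

text \<open>The mean value inequality for \<open>f z - c * z\<close>, whose derivative has modulus
  at most \<open>\<epsilon>\<close>.\<close>

lemma one_variable_linearization:
  fixes f :: "complex \<Rightarrow> complex"
  assumes "convex S" and "\<And>z. z \<in> S \<Longrightarrow> (f has_field_derivative f' z) (at z)"
    and "\<And>z. z \<in> S \<Longrightarrow> cmod (f' z - c) \<le> \<epsilon>" and "a \<in> S" "b \<in> S"
  shows "cmod (f b - f a - c * (b - a)) \<le> \<epsilon> * cmod (b - a)"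
proof -
  have "cmod ((f b - c * b) - (f a - c * a)) \<le> \<epsilon> * cmod (b - a)"
  proof (rule field_differentiable_bound[where S = S and f' = "\<lambda>z. f' z - c"])
    fix z assume "z \<in> S"
    then show "((\<lambda>z. f z - c * z) has_field_derivative f' z - c) (at z within S)"
      by (auto intro!: derivative_eq_intros DERIV_subset[OF assms(2)])
  qed (use assms in auto)
  then show ?thesis by (simp add: algebra_simps)
qed

text \<open>Coordinates are changed one at a time, so partial derivatives suffice. Each coordinate
  is bounded separately, hence the mixed points \<open>h l\<close> stay in the same
  polydisc.\<close>

lemma multi_variable_linearization:
  fixes \<Phi> :: "(nat \<Rightarrow> complex) \<Rightarrow> complex"
  assumes deriv: "\<And>x j. \<lbrakk>j < n; \<And>i. cmod (x i) < \<delta>\<rbrakk> \<Longrightarrow>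
      ((\<lambda>z. \<Phi> (x(j := z))) has_field_derivative \<Psi> j x) (at (x j))"
    and near: "\<And>x j. \<lbrakk>j < n; \<And>i. cmod (x i) < \<delta>\<rbrakk> \<Longrightarrow> cmod (\<Psi> j x - c j) \<le> \<epsilon>"
    and x: "\<And>i. cmod (x i) < \<delta>" and y: "\<And>i. cmod (y i) < \<delta>"
    and eq: "\<And>i. i \<ge> n \<Longrightarrow> x i = y i"
  shows "cmod (\<Phi> y - \<Phi> x - (\<Sum>j<n. c j * (y j - x j))) \<le> \<epsilon> * (\<Sum>j<n. cmod (y j - x j))"
proof -
  define h where "h l = (\<lambda>i. if i < l then y i else x i)" for l
  have h: "cmod (h l i) < \<delta>" for l i using x y by (simp add: h_def)
  have upd: "(h l)(l := y l) = h (Suc l)" "(h l)(l := x l) = h l" for l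
    by (auto simp: h_def fun_eq_iff less_Suc_eq)
  have step: "cmod (\<Phi> (h (Suc l)) - \<Phi> (h l) - c l * (y l - x l)) \<le> \<epsilon> * cmod (y l - x l)"
    if l: "l < n" for l
  proof -
    have hb: "cmod (((h l)(l := z)) i) < \<delta>" if "z \<in> ball 0 \<delta>" for z :: complex and i
      using that h by auto
    have "cmod (\<Phi> ((h l)(l := y l)) - \<Phi> ((h l)(l := x l)) - c l * (y l - x l)) \<le> \<epsilon> * cmod (y l - x l)"
    proof (rule one_variable_linearization[where S = "ball 0 \<delta>" and f' = "\<lambda>z. \<Psi> l ((h l)(l := z))"])
      fix z :: complex assume z: "z \<in> ball 0 \<delta>"
      show "((\<lambda>z. \<Phi> ((h l)(l := z))) has_field_derivative \<Psi> l ((h l)(l := z))) (at z)"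
        using deriv[OF l, of "(h l)(l := z)"] hb[OF z] by simp
      show "cmod (\<Psi> l ((h l)(l := z)) - c l) \<le> \<epsilon>"
        using near[OF l, of "(h l)(l := z)"] hb[OF z] by simp
    qed (use x y in auto)
    then show ?thesis by (simp only: upd)
  qed
  have "h 0 = x" "h n = y" using eq by (auto simp: h_def fun_eq_iff)
  then have "\<Phi> y - \<Phi> x = (\<Sum>l<n. \<Phi> (h (Suc l)) - \<Phi> (h l))"
    using sum_lessThan_telescope[of "\<lambda>l. \<Phi> (h l)" n] by simp
  then have "\<Phi> y - \<Phi> x - (\<Sum>j<n. c j * (y j - x j))
      = (\<Sum>l<n. \<Phi> (h (Suc l)) - \<Phi> (h l) - c l * (y l - x l))"
    by (simp add: sum_subtractf)
  also have "cmod \<dots> \<le> (\<Sum>l<n. \<epsilon> * cmod (y l - x l))"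
    by (intro sum_norm_le step) simp
  finally show ?thesis by (simp add: sum_distrib_left)
qed

text \<open>Newton's iteration with the Jacobian frozen at the origin. Continuity of the partial
  derivatives at 0 makes it a contraction with factor 1/2 on a small polydisc, and the solution is
  the limit of the iterates.\<close>

lemma local_surjectivity:
  fixes \<Phi> :: "nat \<Rightarrow> (nat \<Rightarrow> complex) \<Rightarrow> complex"
  assumes r: "r > 0"
    and deriv: "\<And>k j x. \<lbrakk>k < n; j < n; \<And>i. cmod (x i) < r\<rbrakk> \<Longrightarrow>
      ((\<lambda>z. \<Phi> k (x(j := z))) has_field_derivative \<Psi> k j x) (at (x j))"
    and cont: "\<And>k j \<epsilon>. \<lbrakk>k < n; j < n; \<epsilon> > 0\<rbrakk> \<Longrightarrow>
      \<exists>\<delta>>0. \<forall>x. (\<forall>i. cmod (x i) < \<delta>) \<longrightarrow> cmod (\<Psi> k j x - \<Psi> k j (\<lambda>_. 0)) \<le> \<epsilon>"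
    and inj: "\<And>v. \<forall>k<n. (\<Sum>j<n. \<Psi> k j (\<lambda>_. 0) * v j) = 0 \<Longrightarrow> \<forall>j<n. v j = 0"
    and \<epsilon>: "\<epsilon> > 0"
  shows "\<exists>\<eta>>0. \<forall>y. (\<forall>k<n. cmod (y k - \<Phi> k (\<lambda>_. 0)) < \<eta>) \<longrightarrow>
           (\<exists>x. (\<forall>i. cmod (x i) < \<epsilon>) \<and> (\<forall>k<n. \<Phi> k x = y k))"
proof -
  define M where "M k j = \<Psi> k j (\<lambda>_. 0)" for k j
  obtain N where NM: "\<And>j l. j < n \<Longrightarrow> l < n \<Longrightarrow> (\<Sum>k<n. N j k * M k l) = (if j = l then 1 else 0)"
    and MN: "\<And>k l. k < n \<Longrightarrow> l < n \<Longrightarrow> (\<Sum>j<n. M k j * N j l) = (if k = l then 1 else 0)"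
    using square_system_inverse[of n M] inj unfolding M_def by blast
  define C where "C = 1 + (\<Sum>j<n. \<Sum>k<n. cmod (N j k))"
  have C1: "C \<ge> 1" unfolding C_def by (simp add: sum_nonneg)
  have NC: "(\<Sum>k<n. cmod (N j k)) \<le> C" if "j < n" for j
  proof -
    have "(\<Sum>k<n. cmod (N j k)) \<le> (\<Sum>j<n. \<Sum>k<n. cmod (N j k))"
      using that by (intro member_le_sum) (auto intro: sum_nonneg)
    then show ?thesis by (simp add: C_def)
  qed
  \<comment> \<open>The row sums of \<open>N\<close> are at most \<open>C\<close>, so a
    linearization error of relative size \<open>\<epsilon>'\<close> in \<open>n\<close> coordinates
    costs at most \<open>C * \<epsilon>' * n * s \<le> s / 2\<close>. The summand 1 in
    \<open>n + 1\<close> keeps the denominator positive.\<close>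
  define \<epsilon>' where "\<epsilon>' = 1 / (2 * C * (real n + 1))"
  have \<epsilon>': "\<epsilon>' > 0" using C1 by (simp add: \<epsilon>'_def)
  have "\<exists>\<delta>>0. \<forall>k<n. \<forall>j<n. \<forall>x. (\<forall>i. cmod (x i) < \<delta>) \<longrightarrow> cmod (\<Psi> k j x - M k j) \<le> \<epsilon>'"
  proof -
    have "\<forall>kj \<in> {..<n} \<times> {..<n}. \<exists>\<delta>>0. \<forall>x. (\<forall>i. cmod (x i) < \<delta>) \<longrightarrow>
        cmod (\<Psi> (fst kj) (snd kj) x - M (fst kj) (snd kj)) \<le> \<epsilon>'"
      using cont \<epsilon>' unfolding M_def by auto
    then obtain D where D: "\<And>kj. kj \<in> {..<n} \<times> {..<n} \<Longrightarrow> D kj > 0 \<and> (\<forall>x. (\<forall>i. cmod (x i) < D kj) \<longrightarrow>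
        cmod (\<Psi> (fst kj) (snd kj) x - M (fst kj) (snd kj)) \<le> \<epsilon>')"
      by metis
    define \<delta> where "\<delta> = Min (insert 1 (D ` ({..<n} \<times> {..<n})))"
    have "\<delta> > 0" unfolding \<delta>_def using D by (subst Min_gr_iff) auto
    moreover have "\<delta> \<le> D (k, j)" if "k < n" "j < n" for k j
      unfolding \<delta>_def using that by (intro Min_le) auto
    ultimately show ?thesis
    proof (intro exI[of _ \<delta>] conjI allI impI)
      fix k j and x :: "nat \<Rightarrow> complex" assume kj: "k < n" "j < n" and "\<forall>i. cmod (x i) < \<delta>"
        and "\<And>k j. k < n \<Longrightarrow> j < n \<Longrightarrow> \<delta> \<le> D (k, j)"
      then have "\<forall>i. cmod (x i) < D (k, j)" by (meson less_le_trans)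
      then show "cmod (\<Psi> k j x - M k j) \<le> \<epsilon>'" using D[of "(k, j)"] kj by simp
    qed
  qed
  then obtain \<delta>0 where \<delta>0: "\<delta>0 > 0" and near0: "\<And>k j x. k < n \<Longrightarrow> j < n \<Longrightarrow> (\<And>i. cmod (x i) < \<delta>0) \<Longrightarrow>
      cmod (\<Psi> k j x - M k j) \<le> \<epsilon>'"
    by blast
  define \<delta> where "\<delta> = min \<epsilon> (min r \<delta>0)"
  have \<delta>: "\<delta> > 0" "\<delta> \<le> r" "\<delta> \<le> \<delta>0" "\<delta> \<le> \<epsilon>" using \<epsilon> r \<delta>0 by (auto simp: \<delta>_def)
  have lin: "cmod (\<Phi> k y - \<Phi> k x - (\<Sum>j<n. M k j * (y j - x j))) \<le> \<epsilon>' * (\<Sum>j<n. cmod (y j - x j))"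
    if "k < n" "\<And>i. cmod (x i) < \<delta>" "\<And>i. cmod (y i) < \<delta>" "\<And>i. i \<ge> n \<Longrightarrow> x i = y i" for k x y
  proof (rule multi_variable_linearization[where \<Psi> = "\<Psi> k" and \<delta> = \<delta>])
    show "((\<lambda>z. \<Phi> k (x(j := z))) has_field_derivative \<Psi> k j x) (at (x j))"
      if "j < n" "\<And>i. cmod (x i) < \<delta>" for x j
      using deriv[OF \<open>k < n\<close> that(1)] that(2) \<delta>(2) less_le_trans by blast
    show "cmod (\<Psi> k j x - M k j) \<le> \<epsilon>'" if "j < n" "\<And>i. cmod (x i) < \<delta>" for x j
      using near0[OF \<open>k < n\<close> that(1)] that(2) \<delta>(3) less_le_trans by blast
  qed (use that in auto)
  \<comment> \<open>The first Newton step is then at most \<open>C * \<eta> = \<delta> / 8\<close>,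
    and steps that halve each time add up to \<open>\<delta> / 4\<close>, so the iterates never
    leave the polydisc.\<close>
  define \<eta> where "\<eta> = \<delta> / (8 * C)"
  have \<eta>: "\<eta> > 0" using \<delta> C1 by (simp add: \<eta>_def)
  show ?thesis
  proof (intro exI[of _ \<eta>] conjI allI impI \<eta>)
    fix y assume y: "\<forall>k<n. cmod (y k - \<Phi> k (\<lambda>_. 0)) < \<eta>"
    \<comment> \<open>Coordinates from \<open>n\<close> on are set to 0, because the linearization
      compares only points that agree there.\<close>
    define T where "T x = (\<lambda>j. if j < n then x j - (\<Sum>k<n. N j k * (\<Phi> k x - y k)) else 0)"
      for x :: "nat \<Rightarrow> complex"
    have contr: "cmod (T x' j - T x j) \<le> s / 2"
      if "\<And>i. cmod (x i) < \<delta>" "\<And>i. cmod (x' i) < \<delta>" "\<And>i. i \<ge> n \<Longrightarrow> x i = 0" "\<And>i. i \<ge> n \<Longrightarrow> x' i = 0"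
        and s: "\<And>i. cmod (x' i - x i) \<le> s" for x x' s j
    proof (cases "j < n")
      case True
      have s0: "s \<ge> 0" using s[of 0] norm_ge_zero order_trans by blast
      have "(\<Sum>k<n. N j k * (\<Sum>l<n. M k l * (x' l - x l))) = (\<Sum>l<n. (\<Sum>k<n. N j k * M k l) * (x' l - x l))"
        by (simp add: sum_distrib_left sum_distrib_right mult.assoc) (rule sum.swap)
      also have "\<dots> = (\<Sum>l<n. if l = j then x' l - x l else 0)"
        using NM True by (intro sum.cong) auto
      also have "\<dots> = x' j - x j" using True by simp
      finally have "T x' j - T x j =
          - (\<Sum>k<n. N j k * (\<Phi> k x' - \<Phi> k x - (\<Sum>l<n. M k l * (x' l - x l))))"
        using True by (simp add: T_def algebra_simps sum.distrib sum_subtractf)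
      also have "cmod \<dots> \<le> (\<Sum>k<n. cmod (N j k) * (\<epsilon>' * (real n * s)))"
        unfolding norm_minus_cancel
      proof (rule sum_norm_le)
        fix k assume "k \<in> {..<n}"
        then have "cmod (\<Phi> k x' - \<Phi> k x - (\<Sum>l<n. M k l * (x' l - x l))) \<le> \<epsilon>' * (\<Sum>j<n. cmod (x' j - x j))"
          using that by (intro lin) auto
        also have "\<dots> \<le> \<epsilon>' * (real n * s)"
          using \<epsilon>' sum_bounded_above[of "{..<n}" "\<lambda>j. cmod (x' j - x j)" s] s by simp
        finally show "cmod (N j k * (\<Phi> k x' - \<Phi> k x - (\<Sum>l<n. M k l * (x' l - x l))))
            \<le> cmod (N j k) * (\<epsilon>' * (real n * s))"
          by (simp add: norm_mult mult_left_mono)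
      qed
      also have "\<dots> = (\<Sum>k<n. cmod (N j k)) * (\<epsilon>' * (real n * s))"
        by (simp add: sum_distrib_right)
      also have "\<dots> \<le> C * (\<epsilon>' * (real n * s))"
        using NC[OF True] \<epsilon>' s0 by (intro mult_right_mono) auto
      also have "\<dots> = (real n / (real n + 1)) * (s / 2)"
        using C1 by (simp add: \<epsilon>'_def)
      also have "\<dots> \<le> 1 * (s / 2)"
        using s0 by (intro mult_right_mono) auto
      also have "\<dots> = s / 2" by simp
      finally show ?thesis .
    next
      case False
      have "s \<ge> 0" using s[of 0] norm_ge_zero order_trans by blast
      with False show ?thesis by (simp add: T_def)
    qed
    define X where "X m = (T ^^ m) (\<lambda>_. 0)" for m
    have X0: "X 0 = (\<lambda>_. 0)" and XS: "X (Suc m) = T (X m)" for m by (auto simp: X_def)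
    have Xn: "X m i = 0" if "i \<ge> n" for m i
      using that by (cases m) (auto simp: X0 XS T_def)
    have X1: "cmod (X 1 j - X 0 j) \<le> \<delta> / 8" for j
    proof (cases "j < n")
      case True
      have "X 1 j - X 0 j = (\<Sum>k<n. N j k * (y k - \<Phi> k (\<lambda>_. 0)))"
        using True by (simp add: X_def T_def algebra_simps sum_subtractf)
      also have "cmod \<dots> \<le> (\<Sum>k<n. cmod (N j k) * \<eta>)"
        using y by (intro sum_norm_le) (simp add: norm_mult mult_left_mono less_imp_le)
      also have "\<dots> \<le> C * \<eta>"
        using NC[OF True] \<eta> by (simp add: sum_distrib_right[symmetric] mult_right_mono)
      also have "\<dots> = \<delta> / 8" using C1 by (simp add: \<eta>_def)
      finally show ?thesis .
    next
      case False
      then show ?thesis using \<delta> Xn[of j] by simp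
    qed
    have XX: "(\<forall>j. cmod (X m j) \<le> \<delta> / 4 * (1 - (1/2)^m)) \<and> (\<forall>j. cmod (X (Suc m) j - X m j) \<le> \<delta> / 8 * (1/2)^m)" for m
    proof (induction m)
      case 0
      then show ?case using X1 by (simp add: X0)
    next
      case (Suc m)
      have lt: "cmod (X (Suc m) j) \<le> \<delta> / 4 * (1 - (1/2)^Suc m)" for j
      proof -
        have "cmod (X (Suc m) j) \<le> cmod (X m j) + cmod (X (Suc m) j - X m j)"
          by (metis add.commute diff_add_cancel norm_triangle_ineq)
        also have "\<dots> \<le> \<delta> / 4 * (1 - (1/2)^m) + \<delta> / 8 * (1/2)^m"
          using Suc by (intro add_mono) auto
        also have "\<dots> = \<delta> / 4 * (1 - (1/2)^Suc m)" by (simp add: field_simps)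
        finally show ?thesis .
      qed
      have small: "\<delta> / 4 * (1 - (1/2)^m) < \<delta>" for m
      proof -
        have "\<delta> / 4 * (1 - (1/2)^m) \<le> \<delta> / 4 * 1" using \<delta> by (intro mult_left_mono) auto
        then show ?thesis using \<delta> by linarith
      qed
      have "cmod (T (X (Suc m)) j - T (X m) j) \<le> (\<delta> / 8 * (1/2)^m) / 2" for j
      proof (rule contr)
        show "cmod (X m i) < \<delta>" for i using Suc small[of m] by (meson le_less_trans)
        show "cmod (X (Suc m) i) < \<delta>" for i using lt[of i] small[of "Suc m"] by (rule le_less_trans)
      qed (use Suc Xn in auto)
      with lt show ?case by (auto simp: XS)
    qed
    have Xd: "cmod (X m j) \<le> \<delta> / 4" for m j
    proof -
      have "\<delta> / 4 * (1 - (1/2)^m) \<le> \<delta> / 4 * 1" using \<delta> by (intro mult_left_mono) auto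
      then show ?thesis using XX[of m] by (metis mult.right_neutral order_trans)
    qed
    have "convergent (\<lambda>m. X m j)" for j
    proof -
      have "summable (\<lambda>m. X (Suc m) j - X m j)"
      proof (rule summable_comparison_test'[where N = 0])
        show "summable (\<lambda>m. \<delta> / 8 * (1/2::real)^m)" by (intro summable_mult summable_geometric) simp
      qed (use XX in auto)
      then have "convergent (\<lambda>m. \<Sum>l<m. X (Suc l) j - X l j)" by (simp add: summable_iff_convergent)
      then show ?thesis using sum_lessThan_telescope[of "\<lambda>l. X l j"] by (simp add: X0)
    qed
    then obtain x where x: "\<And>j. (\<lambda>m. X m j) \<longlonglongrightarrow> x j"
      unfolding convergent_def by metis
    have xd: "cmod (x j) \<le> \<delta> / 4" for j
      using Xd by (intro LIMSEQ_le_const2[OF tendsto_norm[OF x]]) auto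
    then have xd': "cmod (x j) < \<delta>" for j using xd[of j] \<delta>(1) by linarith
    have Xd': "cmod (X m j) < \<delta>" for m j using Xd[of m j] \<delta>(1) by linarith
    have xn: "x i = 0" if "i \<ge> n" for i
      using x[of i] Xn[OF that] by (simp add: LIMSEQ_const_iff)
    have lim: "(\<lambda>m. \<Phi> k (X m)) \<longlonglongrightarrow> \<Phi> k x" if k: "k < n" for k
    proof -
      have "(\<lambda>m. (\<Phi> k (X m) - \<Phi> k x - (\<Sum>j<n. M k j * (X m j - x j)))) \<longlonglongrightarrow> 0"
      proof (rule Lim_null_comparison)
        show "\<forall>\<^sub>F m in sequentially. cmod (\<Phi> k (X m) - \<Phi> k x - (\<Sum>j<n. M k j * (X m j - x j)))
            \<le> \<epsilon>' * (\<Sum>j<n. cmod (X m j - x j))"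
          using xd' Xd' xn Xn k by (intro always_eventually allI lin) auto
        have "(\<lambda>m. \<epsilon>' * (\<Sum>j<n. cmod (X m j - x j))) \<longlonglongrightarrow> \<epsilon>' * (\<Sum>j<n. cmod (x j - x j))"
          by (intro tendsto_intros x)
        then show "(\<lambda>m. \<epsilon>' * (\<Sum>j<n. cmod (X m j - x j))) \<longlonglongrightarrow> 0" by simp
      qed
      moreover have "(\<lambda>m. (\<Sum>j<n. M k j * (X m j - x j)) + \<Phi> k x) \<longlonglongrightarrow> (\<Sum>j<n. M k j * (x j - x j)) + \<Phi> k x"
        by (intro tendsto_intros x)
      ultimately show ?thesis by (auto dest: tendsto_add)
    qed
    have fixed_point: "(\<Sum>k<n. N j k * (\<Phi> k x - y k)) = 0" if j: "j < n" for j
    proof -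
      have "(\<lambda>m. X m j - (\<Sum>k<n. N j k * (\<Phi> k (X m) - y k))) \<longlonglongrightarrow> x j - (\<Sum>k<n. N j k * (\<Phi> k x - y k))"
        by (intro tendsto_intros x lim) auto
      moreover have "(\<lambda>m. X m j - (\<Sum>k<n. N j k * (\<Phi> k (X m) - y k))) = (\<lambda>m. X (Suc m) j)"
        using j by (simp add: XS T_def)
      ultimately have "(\<lambda>m. X (Suc m) j) \<longlonglongrightarrow> x j - (\<Sum>k<n. N j k * (\<Phi> k x - y k))" by simp
      moreover have "(\<lambda>m. X (Suc m) j) \<longlonglongrightarrow> x j" using x LIMSEQ_Suc by blast
      ultimately show ?thesis using LIMSEQ_unique by fastforce
    qed
    \<comment> \<open>Applying \<open>M\<close> to the vanishing vector
      \<open>N (\<Phi> x - y)\<close> recovers the residual itself.\<close>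
    have "\<Phi> k x = y k" if k: "k < n" for k
    proof -
      have "0 = (\<Sum>j<n. M k j * (\<Sum>l<n. N j l * (\<Phi> l x - y l)))" using fixed_point by simp
      also have "\<dots> = (\<Sum>l<n. (\<Sum>j<n. M k j * N j l) * (\<Phi> l x - y l))"
        by (simp add: sum_distrib_left sum_distrib_right mult.assoc) (rule sum.swap)
      also have "\<dots> = (\<Sum>l<n. if l = k then \<Phi> l x - y l else 0)"
        using MN k by (intro sum.cong) auto
      also have "\<dots> = \<Phi> k x - y k" using k by simp
      finally show ?thesis by simp
    qed
    then show "\<exists>x. (\<forall>i. cmod (x i) < \<epsilon>) \<and> (\<forall>k<n. \<Phi> k x = y k)"
      using xd' \<delta>(4) by (intro exI[of _ x]) (auto intro: less_le_trans)
  qed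
qed

section \<open>The plane cut outwards from given points\<close>

text \<open>The excluded points are those of the rays \<open>s * a i\<close> with
  \<open>s \<ge> 1\<close>, written through the branch cut of \<open>csqrt\<close>. For the inverse
  points the same set describes, in the coordinate \<open>1 / t\<close>, the sphere cut along the
  segments from 0 to the \<open>a i\<close>; infinity becomes the star centre 0.\<close>

definition cut_plane :: "nat \<Rightarrow> (nat \<Rightarrow> complex) \<Rightarrow> complex set" where
  "cut_plane n a = {t. \<forall>i<n. 1 - t / a i \<notin> \<real>\<^sub>\<le>\<^sub>0}"

definition cut_sqrt :: "nat \<Rightarrow> (nat \<Rightarrow> complex) \<Rightarrow> complex \<Rightarrow> complex" where
  "cut_sqrt n a t = (\<Prod>i<n. csqrt (1 - t / a i))"

lemma open_cut_condition: "open {t. 1 - t / c \<notin> \<real>\<^sub>\<le>\<^sub>0}" for c :: complex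
proof -
  have "open ((\<lambda>t. 1 - t * inverse c) -` (- \<real>\<^sub>\<le>\<^sub>0))"
    by (intro open_vimage continuous_intros) (simp add: closed_nonpos_Reals_complex open_Compl)
  then show ?thesis by (simp add: vimage_def divide_inverse)
qed

lemma open_cut_plane: "open (cut_plane n a)"
proof -
  have "cut_plane n a = (\<Inter>i\<in>{..<n}. {t. 1 - t / a i \<notin> \<real>\<^sub>\<le>\<^sub>0})"
    by (auto simp: cut_plane_def)
  then show ?thesis using open_cut_condition by auto
qed

lemma zero_in_cut_plane: "0 \<in> cut_plane n a"
  by (simp add: cut_plane_def)

lemma cut_plane_scale:
  assumes "t \<in> cut_plane n a" "0 \<le> s" "s \<le> 1"
  shows "of_real s * t \<in> cut_plane n a"
  unfolding cut_plane_def
proof (intro CollectI allI impI notI)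
  fix i assume i: "i < n" and np: "1 - of_real s * t / a i \<in> \<real>\<^sub>\<le>\<^sub>0"
  define w where "w = t / a i"
  have w: "\<not> (Im w = 0 \<and> Re w \<ge> 1)"
    using assms(1) i by (auto simp: cut_plane_def complex_nonpos_Reals_iff w_def)
  have "1 - of_real s * w \<in> \<real>\<^sub>\<le>\<^sub>0" using np by (simp add: w_def)
  then have "s * Im w = 0" "s * Re w \<ge> 1" by (auto simp: complex_nonpos_Reals_iff)
  moreover from this have "s \<noteq> 0" by auto
  ultimately have "Im w = 0" "Re w \<ge> 1"
    using assms(2,3) by (auto, smt (verit) mult_left_le_one_le mult_nonneg_nonpos)
  with w show False by simp
qed

lemma starlike_cut_plane: "starlike (cut_plane n a)"
  unfolding starlike_def
proof (intro bexI[of _ 0] ballI subsetI)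
  fix x y assume "x \<in> cut_plane n a" "y \<in> closed_segment 0 x"
  then show "y \<in> cut_plane n a"
    by (auto simp: closed_segment_def scaleR_conv_of_real intro: cut_plane_scale)
qed (rule zero_in_cut_plane)

lemma connected_cut_plane: "connected (cut_plane n a)"
  by (rule starlike_imp_connected[OF starlike_cut_plane])

lemma cut_plane_primitive:
  assumes "f holomorphic_on cut_plane n a"
  obtains G where "\<And>t. t \<in> cut_plane n a \<Longrightarrow> (G has_field_derivative f t) (at t)"
  using holomorphic_starlike_primitive[OF holomorphic_on_imp_continuous_on[OF assms] starlike_cut_plane open_cut_plane finite.emptyI]
    holomorphic_on_imp_differentiable_at[OF assms open_cut_plane] by auto

lemma holomorphic_cut_sqrt: "cut_sqrt n a holomorphic_on cut_plane n a"
  unfolding cut_sqrt_def divide_inverse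
  by (intro holomorphic_intros) (auto simp: cut_plane_def divide_inverse)

lemma cut_sqrt_nonzero: "t \<in> cut_plane n a \<Longrightarrow> cut_sqrt n a t \<noteq> 0"
  by (auto simp: cut_sqrt_def cut_plane_def)

lemma cut_sqrt_power2: "(cut_sqrt n a t)\<^sup>2 = (\<Prod>i<n. 1 - t / a i)"
  by (simp add: cut_sqrt_def prod_power_distrib)

lemma square_notin_nonpos_Reals:
  assumes "Re w > 0"
  shows "w\<^sup>2 \<notin> \<real>\<^sub>\<le>\<^sub>0"
proof
  assume "w\<^sup>2 \<in> \<real>\<^sub>\<le>\<^sub>0"
  then have "(Re w)\<^sup>2 - (Im w)\<^sup>2 \<le> 0" "2 * Re w * Im w = 0"
    by (auto simp: complex_nonpos_Reals_iff Re_power2 Im_power2)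
  with assms have "Im w = 0" "(Re w)\<^sup>2 \<le> 0" by auto
  with assms show False by simp
qed

lemma Re_csqrt_pos:
  assumes "z \<notin> \<real>\<^sub>\<le>\<^sub>0"
  shows "Re (csqrt z) > 0"
proof (rule ccontr)
  assume "\<not> ?thesis"
  then have "Re (csqrt z) = 0" using csqrt_principal[of z] by auto
  moreover have "u\<^sup>2 \<in> \<real>\<^sub>\<le>\<^sub>0" if "Re u = 0" for u
    using that by (simp add: complex_nonpos_Reals_iff Re_power2 Im_power2)
  ultimately have "(csqrt z)\<^sup>2 \<in> \<real>\<^sub>\<le>\<^sub>0" by blast
  then show False using assms by simp
qed

text \<open>The condition is invariant under inversion, so every statement about the outward cuts
  can be reused in the coordinate at infinity.\<close>

locale distinct_directions =
  fixes n :: nat and a :: "nat \<Rightarrow> complex"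
  assumes nonzero: "i < n \<Longrightarrow> a i \<noteq> 0"
    and distinct: "\<lbrakk>i < n; j < n; i \<noteq> j\<rbrakk> \<Longrightarrow> a i / a j \<notin> \<real>\<^sub>\<ge>\<^sub>0"
begin

lemma inverse_directions: "distinct_directions n (\<lambda>i. inverse (a i))"
proof
  fix i j assume "i < n" "j < n" "i \<noteq> j"
  then show "inverse (a i) / inverse (a j) \<notin> \<real>\<^sub>\<ge>\<^sub>0"
    using distinct[of j i] by (simp add: field_simps)
qed (use nonzero in auto)

text \<open>Substituting \<open>t = a i * (1 - w\<^sup>2)\<close> removes the square root singularity at \<open>a i\<close>.\<close>

lemma primitive_tendsto_branch_point:
  assumes i: "i < n" and r: "r > 0"
    and F: "F holomorphic_on ball (a i) r" and F1: "F1 holomorphic_on ball (a i) r"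
    and G: "\<And>t. t \<in> cut_plane n a \<inter> ball (a i) r \<Longrightarrow>
      (G has_field_derivative F t / cut_sqrt n a t + F1 t) (at t)"
  shows "\<exists>L. (G \<longlongrightarrow> L) (at (a i) within cut_plane n a)"
proof -
  \<comment> \<open>No other ray passes through \<open>a i\<close>, so the remaining factors are
    holomorphic and nonzero on a full disc around it; only the \<open>i\<close>-th factor
    branches.\<close>
  define Z where "Z t = (\<Prod>j\<in>{..<n}-{i}. csqrt (1 - t / a j))" for t
  define T where "T = (\<Inter>j\<in>{..<n}-{i}. {t. 1 - t / a j \<notin> \<real>\<^sub>\<le>\<^sub>0})"
  have oT: "open T" unfolding T_def using open_cut_condition by auto
  have aT: "a i \<in> T"
  proof -
    have "1 - a i / a j \<notin> \<real>\<^sub>\<le>\<^sub>0" if "j < n" "j \<noteq> i" for j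
      using distinct[of i j] that i by (auto simp: complex_nonpos_Reals_iff complex_nonneg_Reals_iff)
    then show ?thesis by (auto simp: T_def)
  qed
  obtain r1 where r1: "r1 > 0" "ball (a i) r1 \<subseteq> T"
    using oT aT open_contains_ball by blast
  define r2 where "r2 = min r r1"
  have r2: "r2 > 0" "ball (a i) r2 \<subseteq> T" "ball (a i) r2 \<subseteq> ball (a i) r" using r r1 by (auto simp: r2_def)
  have ai: "a i \<noteq> 0" using nonzero i by blast
  have Zhol: "Z holomorphic_on T" unfolding Z_def divide_inverse
    by (intro holomorphic_intros) (auto simp: T_def divide_inverse)
  have Znz: "Z t \<noteq> 0" if "t \<in> T" for t
  proof -
    have "1 - t / a j \<noteq> 0" if "j \<in> {..<n} - {i}" for j
      using \<open>t \<in> T\<close> that unfolding T_def by force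
    then show ?thesis by (simp add: Z_def)
  qed
  have cutZ: "cut_sqrt n a t = csqrt (1 - t / a i) * Z t" for t
    unfolding cut_sqrt_def Z_def using i by (subst prod.remove[of _ i]) auto
  define s where "s = sqrt (r2 / cmod (a i))"
  have s: "s > 0" using r2 ai by (simp add: s_def)
  define \<tau> where "\<tau> w = a i * (1 - w\<^sup>2)" for w
  have \<tau>: "\<tau> w \<in> ball (a i) r2" if "w \<in> ball 0 s" for w
  proof -
    have "(cmod w)\<^sup>2 < s\<^sup>2" using that by (simp add: power_strict_mono)
    also have "s\<^sup>2 = r2 / cmod (a i)" using r2 by (simp add: s_def)
    finally have "cmod (a i) * (cmod w)\<^sup>2 < r2" using ai by (simp add: field_simps)
    then show ?thesis by (simp add: \<tau>_def dist_norm algebra_simps norm_mult norm_power)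
  qed
  \<comment> \<open>The derivative in the variable \<open>w\<close>:
    \<open>dt = - 2 * a i * w dw\<close>, and the factor \<open>w\<close> cancels against
    \<open>csqrt (1 - t / a i) = w\<close>. Hence it is holomorphic across
    \<open>w = 0\<close>.\<close>
  define g' where "g' w = - 2 * a i * (F (\<tau> w) / Z (\<tau> w) + w * F1 (\<tau> w))" for w
  have \<tau>hol: "\<tau> holomorphic_on A" for A unfolding \<tau>_def by (intro holomorphic_intros)
  have "g' holomorphic_on ball 0 s" unfolding g'_def
  proof (intro holomorphic_intros)
    show "(\<lambda>w. F (\<tau> w)) holomorphic_on ball 0 s"
      using holomorphic_on_compose_gen[OF \<tau>hol F, of "ball 0 s"] \<tau> r2(3) by (force simp: o_def)
    show "(\<lambda>w. F1 (\<tau> w)) holomorphic_on ball 0 s"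
      using holomorphic_on_compose_gen[OF \<tau>hol F1, of "ball 0 s"] \<tau> r2(3) by (force simp: o_def)
    show "(\<lambda>w. Z (\<tau> w)) holomorphic_on ball 0 s"
      using holomorphic_on_compose_gen[OF \<tau>hol Zhol, of "ball 0 s"] \<tau> r2(2) by (force simp: o_def)
    show "Z (\<tau> w) \<noteq> 0" if "w \<in> ball 0 s" for w using Znz \<tau>[OF that] r2(2) by blast
  qed
  then obtain g where "\<And>w. w \<in> ball 0 s \<Longrightarrow> (g has_field_derivative g' w) (at w within ball 0 s)"
    using holomorphic_convex_primitive'[of "ball 0 s"] by blast
  then have g: "(g has_field_derivative g' w) (at w)" if "w \<in> ball 0 s" for w
    using that at_within_open[OF that open_ball] by metis
  \<comment> \<open>On the half disc \<open>Re w > 0\<close> one has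
    \<open>csqrt (w\<^sup>2) = w\<close>. There \<open>\<tau>\<close> maps into the cut plane, and
    \<open>G (\<tau> w)\<close> and \<open>g w\<close> have the same derivative.\<close>
  define H where "H = ball 0 s \<inter> {w. Re w > 0}"
  have sq: "csqrt (1 - \<tau> w / a i) = w" if "w \<in> H" for w
    using that ai by (auto simp: \<tau>_def H_def intro!: csqrt_square)
  have \<tau>U: "\<tau> w \<in> cut_plane n a" if w: "w \<in> H" for w
    unfolding cut_plane_def
  proof (intro CollectI allI impI)
    fix j assume j: "j < n"
    show "1 - \<tau> w / a j \<notin> \<real>\<^sub>\<le>\<^sub>0"
    proof (cases "j = i")
      case True
      have "Re w > 0" using w by (simp add: H_def)
      then have "w\<^sup>2 \<notin> \<real>\<^sub>\<le>\<^sub>0" by (rule square_notin_nonpos_Reals)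
      then show ?thesis using True ai by (simp add: \<tau>_def)
    next
      case False
      then show ?thesis using \<tau>[of w] w r2(2) j by (auto simp: H_def T_def)
    qed
  qed
  have "\<exists>c. \<forall>w\<in>H. G (\<tau> w) - g w = c"
  proof (rule has_field_derivative_zero_constant)
    show "convex H" unfolding H_def by (intro convex_Int convex_ball convex_halfspace_Re_gt)
    fix w assume w: "w \<in> H"
    have d\<tau>: "(\<tau> has_field_derivative - 2 * a i * w) (at w)"
      unfolding \<tau>_def by (auto intro!: derivative_eq_intros)
    have "\<tau> w \<in> cut_plane n a \<inter> ball (a i) r" using \<tau>U[OF w] \<tau>[of w] w r2(3) by (auto simp: H_def)
    from DERIV_chain2[OF G[OF this] d\<tau>]
    have "((\<lambda>w. G (\<tau> w)) has_field_derivative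
        (F (\<tau> w) / cut_sqrt n a (\<tau> w) + F1 (\<tau> w)) * (- 2 * a i * w)) (at w)" .
    moreover have "(F (\<tau> w) / cut_sqrt n a (\<tau> w) + F1 (\<tau> w)) * (- 2 * a i * w) = g' w"
    proof -
      have "w \<noteq> 0" "Z (\<tau> w) \<noteq> 0" using w Znz \<tau>[of w] r2(2) by (auto simp: H_def)
      then show ?thesis by (simp add: cutZ sq[OF w] g'_def field_simps)
    qed
    ultimately have "((\<lambda>w. G (\<tau> w) - g w) has_field_derivative g' w - g' w) (at w)"
      using g[of w] w by (intro derivative_intros) (auto simp: H_def)
    then show "((\<lambda>w. G (\<tau> w) - g w) has_field_derivative 0) (at w within H)"
      by (simp add: has_field_derivative_at_within)
  qed
  then obtain c where c: "\<And>w. w \<in> H \<Longrightarrow> G (\<tau> w) = g w + c"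
    by (metis diff_eq_eq add.commute)
  have "((\<lambda>t. g (csqrt (1 - t / a i)) + c) \<longlongrightarrow> g 0 + c) (at (a i) within cut_plane n a)"
  proof (intro tendsto_intros isCont_tendsto_compose[of 0 g])
    show "isCont g 0" using g[of 0] s DERIV_isCont by simp
    have "((\<lambda>t. sqrt (cmod (1 - t / a i))) \<longlongrightarrow> sqrt (cmod (1 - a i / a i))) (at (a i) within cut_plane n a)"
      using ai by (intro tendsto_intros) auto
    then show "((\<lambda>t. csqrt (1 - t / a i)) \<longlongrightarrow> 0) (at (a i) within cut_plane n a)"
      unfolding tendsto_norm_zero_iff[of "\<lambda>t. csqrt (1 - t / a i)", symmetric] norm_csqrt
      using ai by (simp only: divide_self_if if_False diff_self norm_zero real_sqrt_zero)
  qed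
  moreover have "\<forall>\<^sub>F t in at (a i) within cut_plane n a. g (csqrt (1 - t / a i)) + c = G t"
    unfolding eventually_at
  proof (intro exI[of _ r2] conjI ballI impI r2(1))
    fix t assume t: "t \<in> cut_plane n a" "t \<noteq> a i \<and> dist t (a i) < r2"
    define w where "w = csqrt (1 - t / a i)"
    have tw: "\<tau> w = t" using ai by (simp add: \<tau>_def w_def)
    have np: "1 - t / a i \<notin> \<real>\<^sub>\<le>\<^sub>0" using t(1) i by (auto simp: cut_plane_def)
    have "Re w > 0" unfolding w_def using np by (rule Re_csqrt_pos)
    moreover have "cmod w < s"
    proof -
      have "1 - t / a i = (a i - t) / a i" using ai by (simp add: field_simps)
      then have "cmod (1 - t / a i) = cmod (a i - t) / cmod (a i)" by (simp add: norm_divide)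
      also have "\<dots> < r2 / cmod (a i)" using t(2) ai by (intro divide_strict_right_mono) (auto simp: dist_norm norm_minus_commute)
      finally show ?thesis unfolding w_def norm_csqrt s_def by (rule real_sqrt_less_mono)
    qed
    ultimately show "g (csqrt (1 - t / a i)) + c = G t" using c[of w] tw by (simp add: H_def w_def)
  qed
  ultimately show ?thesis by (intro exI[of _ "g 0 + c"]) (rule Lim_transform_eventually)
qed

end

section \<open>Gluing functions on the two cut domains\<close>

context distinct_directions
begin

text \<open>A point on outward ray \<open>i\<close> and inward segment \<open>j\<close> would make
  \<open>a j / a i\<close> positive, so \<open>i = j\<close>; and the outward ray of a point meets
  its segment to the origin only in that point. The two domains therefore miss only the points
  \<open>a i\<close> in the finite plane.\<close>

lemma cut_plane_cover:
  assumes "t \<notin> cut_plane n a" "t \<notin> a ` {..<n}"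
  shows "t \<noteq> 0 \<and> inverse t \<in> cut_plane n (\<lambda>i. inverse (a i))"
proof -
  from assms(1) obtain i where i: "i < n" "1 - t / a i \<in> \<real>\<^sub>\<le>\<^sub>0" by (auto simp: cut_plane_def)
  define s where "s = Re (t / a i)"
  have s: "t / a i = of_real s" "s \<ge> 1"
    using i(2) by (auto simp: complex_nonpos_Reals_iff s_def complex_eq_iff)
  have ai: "a i \<noteq> 0" using nonzero i by blast
  have t: "t = of_real s * a i" using s ai by (simp add: field_simps)
  have "s \<noteq> 1" using t assms(2) i by auto
  with s have s1: "s > 1" by simp
  have t0: "t \<noteq> 0" using t s1 ai by auto
  have "1 - inverse t / inverse (a j) \<notin> \<real>\<^sub>\<le>\<^sub>0" if j: "j < n" for j
  proof
    assume "1 - inverse t / inverse (a j) \<in> \<real>\<^sub>\<le>\<^sub>0"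
    then have np: "1 - a j / t \<in> \<real>\<^sub>\<le>\<^sub>0" by (simp add: field_simps)
    define s' where "s' = Re (a j / t)"
    have s': "a j / t = of_real s'" "s' \<ge> 1"
      using np by (auto simp: complex_nonpos_Reals_iff s'_def complex_eq_iff)
    have "a j / a i = of_real (s' * s)"
      using s' t ai t0 by (simp add: field_simps)
    then have nn: "a j / a i \<in> \<real>\<^sub>\<ge>\<^sub>0" using s'(2) s1 by simp
    then have "j = i" using distinct[of j i] i j by blast
    then have "complex_of_real (s' * s) = 1" using \<open>a j / a i = of_real (s' * s)\<close> ai by simp
    then have "s' * s = 1" using of_real_eq_1_iff by blast
    moreover have "1 * s \<le> s' * s" using s'(2) s1 by (intro mult_right_mono) auto
    ultimately show False using s1 by simp
  qed
  then show ?thesis using t0 by (auto simp: cut_plane_def)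
qed

text \<open>The glued function has removable singularities at the \<open>a i\<close> and a pole of
  order at most \<open>m\<close> at infinity, so Liouville's theorem applies. The limits at the
  \<open>a i\<close> are part of the result because zeros of the polynomial are later read off from
  them.\<close>

lemma polynomial_of_glued_function:
  fixes A\<^sub>i A\<^sub>o :: "complex \<Rightarrow> complex"
  defines "V \<equiv> cut_plane n (\<lambda>i. inverse (a i))"
  assumes inner: "A\<^sub>i holomorphic_on cut_plane n a" and outer: "A\<^sub>o holomorphic_on V - {0}"
    and agree: "\<And>t. \<lbrakk>t \<in> cut_plane n a; t \<noteq> 0; inverse t \<in> V\<rbrakk> \<Longrightarrow> A\<^sub>i t = A\<^sub>o (inverse t)"
    and lim_i: "\<And>i. i < n \<Longrightarrow> ((\<lambda>t. (t - a i) * A\<^sub>i t) \<longlongrightarrow> 0) (at (a i) within cut_plane n a)"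
    and lim_o: "\<And>i. i < n \<Longrightarrow> ((\<lambda>z. (z - inverse (a i)) * A\<^sub>o z) \<longlongrightarrow> 0) (at (inverse (a i)) within V)"
    and growth: "r > 0" "\<And>z. \<lbrakk>z \<noteq> 0; cmod z < r\<rbrakk> \<Longrightarrow> cmod (A\<^sub>o z) \<le> C / cmod z ^ m"
  obtains P where "degree P \<le> m" "\<And>t. t \<in> cut_plane n a \<Longrightarrow> poly P t = A\<^sub>i t"
    "\<And>i. i < n \<Longrightarrow> (A\<^sub>i \<longlongrightarrow> poly P (a i)) (at (a i) within cut_plane n a)"
proof -
  define U where "U = cut_plane n a"
  define E where "E = a ` {..<n}"
  define W where "W = {t. t \<noteq> 0 \<and> inverse t \<in> V}"
  have oU: "open U" and oV: "open V" by (auto simp: U_def V_def open_cut_plane)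
  have oW: "open W"
  proof -
    have "open ((-{0}) \<inter> inverse -` V)"
      by (rule continuous_open_preimage[OF _ _ oV]) (auto intro!: continuous_intros)
    moreover have "W = (-{0}) \<inter> inverse -` V" by (auto simp: W_def)
    ultimately show ?thesis by simp
  qed
  have cov: "t \<in> U \<or> t \<in> W" if "t \<notin> E" for t
    using cut_plane_cover[of t] that by (auto simp: U_def W_def V_def E_def)
  have EU: "t \<notin> U" if t: "t \<in> E" for t
  proof -
    obtain i where "i < n" "t = a i" using t by (auto simp: E_def)
    then show ?thesis using nonzero by (auto simp: U_def cut_plane_def)
  qed
  have EW: "t \<notin> W" if t: "t \<in> E" for t
  proof -
    obtain i where "i < n" "t = a i" using t by (auto simp: E_def)
    then show ?thesis using nonzero by (auto simp: W_def V_def cut_plane_def)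
  qed
  define A where "A t = (if t \<in> U then A\<^sub>i t else A\<^sub>o (inverse t))" for t
  have AU: "A t = A\<^sub>i t" if "t \<in> U" for t using that by (simp add: A_def)
  have AW: "A t = A\<^sub>o (inverse t)" if "t \<in> W" for t using that agree by (auto simp: A_def U_def W_def)
  have "A holomorphic_on U \<union> W"
  proof (rule holomorphic_on_Un)
    show "A holomorphic_on U" using holomorphic_transform[OF inner[folded U_def]] AU by metis
    have "(\<lambda>t. A\<^sub>o (inverse t)) holomorphic_on W"
      by (rule holomorphic_on_compose_gen[OF _ outer, unfolded o_def]) (auto intro!: holomorphic_intros simp: W_def)
    then show "A holomorphic_on W" using AW by (metis holomorphic_transform)
  qed (use oU oW in auto)
  moreover have "U \<union> W = - E" using cov EU EW by auto
  ultimately have Ahol: "A holomorphic_on - E" by simp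
  have Alim: "((\<lambda>t. (t - c) * A t) \<longlongrightarrow> 0) (at c)" if c: "c \<in> E" for c
  proof -
    obtain i where i: "i < n" "c = a i" using c by (auto simp: E_def)
    have c0: "c \<noteq> 0" using i nonzero by auto
    have 1: "((\<lambda>t. (t - c) * A t) \<longlongrightarrow> 0) (at c within U)"
      unfolding i(2)
      by (rule Lim_transform_within[OF lim_i[OF i(1), folded U_def], where d = 1]) (auto simp: AU)
    have 2: "((\<lambda>t. (t - c) * A t) \<longlongrightarrow> 0) (at c within W)"
    proof -
      have inv: "filterlim inverse (at (inverse c) within V) (at c within W)"
        unfolding filterlim_at using c0
        by (auto simp: eventually_at_filter W_def intro!: always_eventually tendsto_intros)
      have "((\<lambda>t. (inverse t - inverse c) * A\<^sub>o (inverse t)) \<longlongrightarrow> 0) (at c within W)"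
        using filterlim_compose[OF lim_o[OF i(1)], folded i(2), OF inv] .
      \<comment> \<open>The factor \<open>- t * c\<close> converts \<open>1 / t - 1 / c\<close> into
        \<open>t - c\<close> and has a finite limit at \<open>c\<close>.\<close>
      then have "((\<lambda>t. (- t * c) * ((inverse t - inverse c) * A\<^sub>o (inverse t))) \<longlongrightarrow> (- c * c) * 0) (at c within W)"
        by (rule tendsto_mult[rotated]) (intro tendsto_intros)
      then have "((\<lambda>t. (- t * c) * ((inverse t - inverse c) * A\<^sub>o (inverse t))) \<longlongrightarrow> 0) (at c within W)" by simp
      then show ?thesis
      proof (rule Lim_transform_within[where d = 1])
        fix t assume "t \<in> W"
        then have "t \<noteq> 0" "A t = A\<^sub>o (inverse t)" using AW by (auto simp: W_def)
        moreover have "(- t * c) * (inverse t - inverse c) = t - c"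
          using \<open>t \<noteq> 0\<close> c0 by (simp add: field_simps)
        ultimately show "(- t * c) * ((inverse t - inverse c) * A\<^sub>o (inverse t)) = (t - c) * A t"
          by (metis mult.assoc)
      qed simp
    qed
    have "((\<lambda>t. (t - c) * A t) \<longlongrightarrow> 0) (at c within - E)"
      using filterlim_sup[OF 1 2] \<open>U \<union> W = - E\<close> by (simp add: at_within_union[symmetric])
    moreover have "at c within - E = at c"
    proof -
      have "open (- (E - {c}))" by (intro open_Compl finite_imp_closed) (simp add: E_def)
      then show ?thesis by (intro at_within_nhd[of c "- (E - {c})"]) auto
    qed
    ultimately show ?thesis by simp
  qed
  \<comment> \<open>Riemann's theorem removes one singularity at a time, so the finite set
    \<open>E\<close> is filled in by induction.\<close>
  have "\<exists>g. g holomorphic_on - (E - F) \<and> (\<forall>t\<in>- E. g t = A t)" if "finite F" "F \<subseteq> E" for F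
    using that
  proof (induction F)
    case empty
    then show ?case using Ahol by auto
  next
    case (insert c F)
    then obtain g where g: "g holomorphic_on - (E - F)" "\<forall>t\<in>- E. g t = A t" by auto
    define S where "S = - (E - insert c F)"
    have oS: "open S" unfolding S_def by (intro open_Compl finite_imp_closed) (simp add: E_def)
    have SE: "S - {c} = - (E - F)" using insert by (auto simp: S_def)
    have "((\<lambda>t. (t - c) * g t) \<longlongrightarrow> 0) (at c)"
    proof (rule Lim_transform_eventually)
      show "((\<lambda>t. (t - c) * A t) \<longlongrightarrow> 0) (at c)" using Alim insert by auto
      have "open (- (E - {c}))" by (intro open_Compl finite_imp_closed) (simp add: E_def)
      then have "\<forall>\<^sub>F t in at c. t \<in> - (E - {c}) - {c}" by (intro eventually_at_in_open) auto
      then have "\<forall>\<^sub>F t in at c. t \<notin> E" by eventually_elim auto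
      then show "\<forall>\<^sub>F t in at c. (t - c) * A t = (t - c) * g t"
        by eventually_elim (use g in auto)
    qed
    then obtain h where h: "h holomorphic_on S" "\<forall>t\<in>S - {c}. h t = g t"
      using holomorphic_on_extend_lim[of g S c] g(1) oS SE
      by (auto simp: interior_open S_def)
    show ?case
    proof (intro exI[of _ h] conjI ballI)
      show "h holomorphic_on - (E - insert c F)" using h by (simp add: S_def)
      fix t assume "t \<in> - E"
      then show "h t = A t" using h g SE by auto
    qed
  qed
  from this[of E] obtain g where g: "g holomorphic_on UNIV" "\<And>t. t \<notin> E \<Longrightarrow> g t = A t"
    by (auto simp: E_def)
  have "0 \<in> V" by (simp add: V_def zero_in_cut_plane)
  then obtain r0 where r0: "r0 > 0" "ball 0 r0 \<subseteq> V" using oV open_contains_ball by blast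
  define r' where "r' = min r r0 / 2"
  have r': "r' > 0" "r' < r" "r' < r0" using r0 growth(1) by (auto simp: r'_def min_def)
  have bound: "cmod (g t) \<le> C * cmod t ^ m" if t: "1 / r' \<le> cmod t" for t
  proof -
    have "cmod t > 0" using t r' by (smt (verit) divide_pos_pos)
    then have t0: "t \<noteq> 0" by auto
    have it: "cmod (inverse t) \<le> r'" using t r' t0 by (simp add: norm_inverse norm_divide field_simps)
    then have tW: "t \<in> W" using r' r0 t0 by (force simp: W_def)
    then have "g t = A\<^sub>o (inverse t)" using g(2) EW AW by metis
    moreover have "cmod (A\<^sub>o (inverse t)) \<le> C / cmod (inverse t) ^ m"
      using it r' t0 by (intro growth(2)) auto
    ultimately show ?thesis using t0 by (simp add: norm_inverse norm_divide field_simps)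
  qed
  \<comment> \<open>The Taylor polynomial at 0, which is the whole function by Liouville's theorem
    for polynomial growth.\<close>
  define P where "P = (\<Sum>k\<le>m. monom ((deriv ^^ k) g 0 / fact k) k)"
  have P: "poly P t = g t" for t
    using Liouville_polynomial[OF g(1) bound] by (simp add: P_def poly_sum poly_monom)
  show ?thesis
  proof (rule that[of P])
    show "degree P \<le> m" unfolding P_def
      by (intro degree_sum_le) (auto intro: order_trans[OF degree_monom_le])
    show eq: "poly P t = A\<^sub>i t" if "t \<in> cut_plane n a" for t
      using that P g(2) EU AU by (metis U_def)
    fix i assume "i < n"
    have "((\<lambda>t. poly P t) \<longlongrightarrow> poly P (a i)) (at (a i) within cut_plane n a)"
      by (intro tendsto_intros)
    then show "(A\<^sub>i \<longlongrightarrow> poly P (a i)) (at (a i) within cut_plane n a)"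
      by (rule Lim_transform_within[where d = 1]) (use eq in auto)
  qed
qed

end

section \<open>Principal square roots on the two sides of a ray\<close>

lemma csqrt_one_minus:
  assumes "w \<notin> \<real>\<^sub>\<ge>\<^sub>0"
  shows "csqrt (1 - w) = csqrt (- w) * csqrt (1 - 1 / w)"
proof -
  have w0: "w \<noteq> 0" using assms by auto
  have "1 - w = (- w) * (1 - 1 / w)" using w0 by (simp add: field_simps)
  \<comment> \<open>Off the real axis the imaginary parts of \<open>- w\<close> and
    \<open>1 - 1 / w\<close> have opposite signs, so the sum of the arguments stays in the principal
    range. This is what makes \<open>csqrt\<close> multiplicative here.\<close>
  moreover have "Arg (- w) + Arg (1 - 1 / w) \<in> {-pi<..pi}"
  proof -
    have Im: "Im (1 - 1 / w) = Im w / (cmod w)\<^sup>2" by (simp add: Im_divide cmod_power2)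
    consider "Im w > 0" | "Im w < 0" | "Im w = 0" "Re w < 0"
      using assms by (force simp: complex_nonneg_Reals_iff)
    then show ?thesis
    proof cases
      case 1
      have "Im (1 - 1 / w) > 0" unfolding Im using 1 w0 by simp
      then have "Arg (- w) < 0" "Arg (1 - 1 / w) > 0"
        using Arg_less_0[of "- w"] 1 by (auto simp: Arg_pos_iff)
      then show ?thesis using Arg_bounded[of "- w"] Arg_bounded[of "1 - 1 / w"] by simp
    next
      case 2
      have "Im (1 - 1 / w) < 0" unfolding Im using 2 w0 by (simp add: divide_neg_pos)
      then have "Arg (- w) > 0" "Arg (1 - 1 / w) < 0"
        using Arg_less_0[of "1 - 1 / w"] 2 by (auto simp: Arg_pos_iff)
      then show ?thesis using Arg_bounded[of "- w"] Arg_bounded[of "1 - 1 / w"] by simp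
    next
      case 3
      then have w: "w = of_real (Re w)" by (simp add: complex_eq_iff)
      have "Arg (- w) = 0" using 3 w by (metis Arg_of_real neg_less_0_iff_less of_real_minus less_imp_le neg_0_le_iff_le not_less)
      moreover have "Arg (1 - 1 / w) = 0"
      proof -
        have "1 / Re w < 0" using 3 by simp
        then have "Arg (complex_of_real (1 - 1 / Re w)) = 0" by (subst Arg_of_real) simp
        moreover have "1 - 1 / w = of_real (1 - 1 / Re w)" by (subst w) simp
        ultimately show ?thesis by simp
      qed
      ultimately show ?thesis using pi_gt_zero by simp
    qed
  qed
  ultimately show ?thesis by (metis csqrt_mult)
qed

text \<open>The argument of the quotient is \<open>Im w - Arg e\<close> up to full turns, and the
  two open intervals contain no multiple of \<open>2 pi\<close>.\<close>

lemma exp_divide_notin_nonneg_Reals: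
  assumes "e \<noteq> 0" "Im w - Arg e \<in> {-2*pi<..<0} \<union> {0<..<2*pi}"
  shows "exp w / e \<notin> \<real>\<^sub>\<ge>\<^sub>0"
proof
  assume "exp w / e \<in> \<real>\<^sub>\<ge>\<^sub>0"
  moreover have "exp w / e = exp (w - Ln e)" using assms(1) by (simp add: exp_diff)
  ultimately have 1: "exp (w - Ln e) \<in> \<real>\<^sub>\<ge>\<^sub>0" by simp
  define \<delta> where "\<delta> = Im w - Arg e"
  have \<delta>: "Im w - Im (Ln e) = \<delta>" using assms(1) by (simp add: \<delta>_def Arg_eq_Im_Ln)
  from 1 have "sin \<delta> = 0" "cos \<delta> \<ge> 0"
    by (auto simp: complex_nonneg_Reals_iff Re_exp Im_exp \<delta> zero_le_mult_iff)
  moreover have "cos \<delta> \<noteq> 0" using \<open>sin \<delta> = 0\<close> sin_cos_squared_add[of \<delta>] by auto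
  moreover have "\<bar>cos \<delta>\<bar> = 1" using \<open>sin \<delta> = 0\<close> sin_zero_abs_cos_one by blast
  ultimately have "cos \<delta> = 1" by auto
  then obtain k :: int where "\<delta> = of_int k * 2 * pi" using cos_one_2pi_int[of \<delta>] by auto
  then have k: "of_int k * 2 * pi \<in> {-2*pi<..<0} \<union> {0<..<2*pi}" using assms(2) by (simp add: \<delta>_def)
  have "(-1) * (2 * pi) < real_of_int k * (2 * pi)" "real_of_int k * (2 * pi) < 1 * (2 * pi)"
    using k pi_gt_zero unfolding mult.assoc Un_iff greaterThanLessThan_iff by linarith+
  then have "-1 < real_of_int k" "real_of_int k < 1"
    using mult_less_cancel_right_pos[of "2 * pi"] pi_gt_zero by (metis zero_less_mult_iff zero_less_numeral)+
  then have "k = 0" by linarith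
  with k show False by simp
qed

text \<open>Above the ray of \<open>e\<close>, by less than a full turn, \<open>- exp w / e\<close>
  has the principal logarithm \<open>w - Ln e - i pi\<close>, and halving it produces the factor
  \<open>- i\<close>. Below the ray the shift is \<open>+ i pi\<close> and the factor is
  \<open>i\<close>. This is the source of the sign change from sector to sector.\<close>

lemma csqrt_crossing_above:
  assumes "e \<noteq> 0" "Im w - Arg e \<in> {0<..<2*pi}"
  shows "csqrt e * csqrt (1 - exp w / e) = - \<i> * exp (w / 2) * csqrt (1 - e / exp w)"
proof -
  have "Ln (- (exp w / e)) = w - Ln e - \<i> * pi"
    by (rule Ln_unique) (use assms in \<open>auto simp: exp_diff Arg_eq_Im_Ln exp_pi_i'\<close>)
  then have "csqrt (- (exp w / e)) = exp ((w - Ln e - \<i> * pi) / 2)"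
    using assms(1) by (simp add: csqrt_exp_Ln)
  moreover have "csqrt e = exp (Ln e / 2)" using assms(1) by (simp add: csqrt_exp_Ln)
  ultimately have "csqrt e * csqrt (- (exp w / e)) = exp (w / 2 - \<i> * pi / 2)"
    by (simp add: exp_add[symmetric] field_simps)
  also have "\<dots> = - \<i> * exp (w / 2)"
  proof -
    have "exp (\<i> * complex_of_real pi / 2) = \<i>"
      using cis_pi_half by (simp add: cis_conv_exp)
    then show ?thesis by (simp add: exp_diff)
  qed
  finally have "csqrt e * csqrt (- (exp w / e)) = - \<i> * exp (w / 2)" .
  moreover have "csqrt (1 - exp w / e) = csqrt (- (exp w / e)) * csqrt (1 - 1 / (exp w / e))"
    by (rule csqrt_one_minus, rule exp_divide_notin_nonneg_Reals) (use assms in auto)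
  ultimately show ?thesis by (simp add: mult.assoc[symmetric])
qed

lemma csqrt_crossing_below:
  assumes "e \<noteq> 0" "Im w - Arg e \<in> {-2*pi<..<0}"
  shows "csqrt e * csqrt (1 - exp w / e) = \<i> * exp (w / 2) * csqrt (1 - e / exp w)"
proof -
  have "Ln (- (exp w / e)) = w - Ln e + \<i> * pi"
    by (rule Ln_unique) (use assms in \<open>auto simp: exp_diff exp_add Arg_eq_Im_Ln exp_pi_i'\<close>)
  then have "csqrt (- (exp w / e)) = exp ((w - Ln e + \<i> * pi) / 2)"
    using assms(1) by (simp add: csqrt_exp_Ln)
  moreover have "csqrt e = exp (Ln e / 2)" using assms(1) by (simp add: csqrt_exp_Ln)
  ultimately have "csqrt e * csqrt (- (exp w / e)) = exp (w / 2 + \<i> * pi / 2)"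
    by (simp add: exp_add[symmetric] field_simps)
  also have "\<dots> = \<i> * exp (w / 2)"
  proof -
    have "exp (\<i> * complex_of_real pi / 2) = \<i>"
      using cis_pi_half by (simp add: cis_conv_exp)
    then show ?thesis by (simp add: exp_add)
  qed
  finally have "csqrt e * csqrt (- (exp w / e)) = \<i> * exp (w / 2)" .
  moreover have "csqrt (1 - exp w / e) = csqrt (- (exp w / e)) * csqrt (1 - 1 / (exp w / e))"
    by (rule csqrt_one_minus, rule exp_divide_notin_nonneg_Reals) (use assms in auto)
  ultimately show ?thesis by (simp add: mult.assoc[symmetric])
qed

section \<open>Branches of the square root and periods\<close>

text \<open>The constants \<open>csqrt (e i)\<close> are included so that each factor squares to
  \<open>e i - t\<close>; then the dependence on a root is confined to one factor whose logarithmic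
  derivative is that of a square root of \<open>e i - t\<close>.\<close>

definition inner_sqrt :: "nat \<Rightarrow> (nat \<Rightarrow> complex) \<Rightarrow> complex \<Rightarrow> complex" where
  "inner_sqrt d e t = (\<Prod>i<2*d. csqrt (e i) * csqrt (1 - t / e i))"

text \<open>The branch that behaves like \<open>t ^ d\<close> at infinity.\<close>

definition outer_sqrt :: "nat \<Rightarrow> (nat \<Rightarrow> complex) \<Rightarrow> complex \<Rightarrow> complex" where
  "outer_sqrt d e t = t ^ d * (\<Prod>i<2*d. csqrt (1 - e i / t))"

definition sheet_sign :: "nat \<Rightarrow> nat \<Rightarrow> complex" where
  "sheet_sign d k = (-1) ^ (d + k)"

text \<open>The logarithm of the \<open>k\<close>-th sector between consecutive root directions.\<close>

definition strip :: "nat \<Rightarrow> (nat \<Rightarrow> complex) \<Rightarrow> nat \<Rightarrow> complex set" where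
  "strip d e k = {w. (if k = 0 then Arg (e (2*d-1)) - 2*pi else Arg (e (k-1))) < Im w \<and> Im w < Arg (e k)}"

text \<open>Kept as a logarithm rather than a point: sector 0 has the angle \<open>- pi\<close>,
  outside the principal range of \<open>Ln\<close>, and sectors can be joined by straight
  segments.\<close>

definition base_log :: "(nat \<Rightarrow> real) \<Rightarrow> real \<Rightarrow> nat \<Rightarrow> complex" where
  "base_log \<theta> \<rho> k = Complex (ln \<rho>) (\<theta> k)"

definition sector_arc :: "(nat \<Rightarrow> real) \<Rightarrow> real \<Rightarrow> nat \<Rightarrow> real \<Rightarrow> complex" where
  "sector_arc \<theta> \<rho> k s = exp (base_log \<theta> \<rho> k + of_real s * (base_log \<theta> \<rho> (k+2) - base_log \<theta> \<rho> k))"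

definition radial_integral :: "(nat \<Rightarrow> real) \<Rightarrow> real \<Rightarrow> nat \<Rightarrow> (complex \<Rightarrow> complex) \<Rightarrow> complex" where
  "radial_integral \<theta> \<rho> k f =
     integral {0..1} (\<lambda>s. f (of_real s * exp (base_log \<theta> \<rho> k)) * exp (base_log \<theta> \<rho> k))"

definition arc_integral :: "(nat \<Rightarrow> real) \<Rightarrow> real \<Rightarrow> nat \<Rightarrow> (complex \<Rightarrow> complex) \<Rightarrow> complex" where
  "arc_integral \<theta> \<rho> k f =
     integral {0..1} (\<lambda>s. f (sector_arc \<theta> \<rho> k s) * (sector_arc \<theta> \<rho> k s * (base_log \<theta> \<rho> (k+2) - base_log \<theta> \<rho> k)))"

text \<open>The period of the differential \<open>\<omega>\<close> on the curve \<open>y\<^sup>2 = D(t)\<close>, where \<open>\<omega>\<close> is \<open>f\<^sub>i dt\<close> on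
  the plane cut outwards from the roots and \<open>f\<^sub>o dt\<close> on the plane cut inwards, along the cycle that
  runs from the origin to sector \<open>k\<close>, along the large circle to sector \<open>k + 2\<close> and back to the origin.\<close>

definition period :: "nat \<Rightarrow> (nat \<Rightarrow> real) \<Rightarrow> real \<Rightarrow> nat \<Rightarrow> (complex \<Rightarrow> complex) \<Rightarrow> (complex \<Rightarrow> complex) \<Rightarrow> complex" where
  "period d \<theta> \<rho> k f\<^sub>i f\<^sub>o = radial_integral \<theta> \<rho> (k+2) f\<^sub>i - radial_integral \<theta> \<rho> k f\<^sub>i
     - sheet_sign d k * arc_integral \<theta> \<rho> k f\<^sub>o"

text \<open>The angles and the radius carry the integration paths and remain fixed while the roots
  move. With \<open>\<theta> 0 = - pi\<close> and \<open>Arg (e i) < pi\<close> the negative real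
  axis runs inside sector 0, so \<open>Arg\<close> is continuous at every root and all conditions on
  the roots are open.\<close>

locale root_configuration =
  fixes d :: nat and e :: "nat \<Rightarrow> complex" and \<theta> :: "nat \<Rightarrow> real" and \<rho> :: real
  assumes d_ge: "d \<ge> 2"
    and root_nonzero: "i < 2*d \<Longrightarrow> e i \<noteq> 0"
    and theta_0: "\<theta> 0 = - pi"
    and theta_less: "i < 2*d \<Longrightarrow> \<theta> i < Arg (e i)"
    and less_theta: "Suc i < 2*d \<Longrightarrow> Arg (e i) < \<theta> (Suc i)"
    and Arg_less_pi: "i < 2*d \<Longrightarrow> Arg (e i) < pi"
    and norm_root: "i < 2*d \<Longrightarrow> cmod (e i) < \<rho>"
begin

abbreviation "U \<equiv> cut_plane (2*d) e"
abbreviation "V \<equiv> cut_plane (2*d) (\<lambda>i. inverse (e i))"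
abbreviation "b \<equiv> base_log \<theta> \<rho>"

lemma rho_pos: "\<rho> > 0"
  using norm_root[of 0] d_ge norm_ge_zero[of "e 0"] by linarith

lemma Arg_strict_mono: "i < j \<Longrightarrow> j < 2*d \<Longrightarrow> Arg (e i) < Arg (e j)"
proof (induction j)
  case (Suc j)
  have "Arg (e j) < Arg (e (Suc j))"
    using less_theta[of j] theta_less[of "Suc j"] Suc.prems by simp
  with Suc show ?case by (cases "i = j") auto
qed simp

lemma Arg_mono: "i \<le> j \<Longrightarrow> j < 2*d \<Longrightarrow> Arg (e i) \<le> Arg (e j)"
  using Arg_strict_mono[of i j] by (cases "i = j") auto

sublocale distinct_directions "2*d" e
proof
  fix i j assume ij: "i < 2*d" "j < 2*d" "i \<noteq> j"
  show "e i / e j \<notin> \<real>\<^sub>\<ge>\<^sub>0"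
  proof
    assume "e i / e j \<in> \<real>\<^sub>\<ge>\<^sub>0"
    then obtain r where r: "e i / e j = of_real r" "r \<ge> 0" by (auto elim: nonneg_Reals_cases)
    then have "e i = of_real r * e j" using root_nonzero ij by (simp add: field_simps)
    moreover from this have "r > 0" using root_nonzero[OF ij(1)] r(2) by (cases "r = 0") auto
    ultimately have "Arg (e i) = Arg (e j)" by (simp only: Arg_times_of_real)
    then show False using Arg_strict_mono[of i j] Arg_strict_mono[of j i] ij by (cases "i < j") auto
  qed
qed (rule root_nonzero)

lemma inner_sqrt_eq: "inner_sqrt d e t = (\<Prod>i<2*d. csqrt (e i)) * cut_sqrt (2*d) e t"
  by (simp add: inner_sqrt_def cut_sqrt_def prod.distrib)

lemma prod_csqrt_nonzero: "(\<Prod>i<2*d. csqrt (e i)) \<noteq> 0"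
  using root_nonzero by auto

lemma outer_sqrt_eq: "outer_sqrt d e t = t ^ d * cut_sqrt (2*d) (\<lambda>i. inverse (e i)) (inverse t)"
  by (simp add: outer_sqrt_def cut_sqrt_def field_simps)

lemma inner_sqrt_power2: "(inner_sqrt d e t)\<^sup>2 = (\<Prod>i<2*d. t - e i)"
proof -
  have "(inner_sqrt d e t)\<^sup>2 = (\<Prod>i<2*d. e i - t)"
    unfolding inner_sqrt_def prod_power_distrib
    using root_nonzero by (intro prod.cong) (auto simp: power_mult_distrib field_simps)
  \<comment> \<open>The number of factors is even, so the signs cancel.\<close>
  also have "\<dots> = (\<Prod>i<2*d. (-1) * (t - e i))" by simp
  also have "\<dots> = (\<Prod>i<2*d. t - e i)" by (subst prod.distrib) (simp add: power_mult)
  finally show ?thesis .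
qed

text \<open>Roots before \<open>k\<close> lie below the strip and the others above it. All
  differences stay within one turn because the arguments span less than \<open>2 pi\<close>; sector
  0 reaches down to the last root shifted by \<open>- 2 pi\<close>.\<close>

lemma strip_bounds:
  assumes "w \<in> strip d e k" "k < 2*d" "i < 2*d"
  shows "i < k \<Longrightarrow> Im w - Arg (e i) \<in> {0<..<2*pi}" "k \<le> i \<Longrightarrow> Im w - Arg (e i) \<in> {-2*pi<..<0}"
proof -
  have last: "Arg (e i) \<le> Arg (e (2*d-1))" using Arg_mono[of i "2*d-1"] assms(3) by simp
  have bd: "-pi < Arg (e i)" "Arg (e i) < pi" "-pi < Arg (e k)" "Arg (e k) < pi"
    using Arg_bounded Arg_less_pi assms by blast+
  { assume "i < k"
    then have "Arg (e i) \<le> Arg (e (k-1))" "k \<noteq> 0" using Arg_mono[of i "k-1"] assms(2) by auto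
    then show "Im w - Arg (e i) \<in> {0<..<2*pi}" using assms(1) bd by (simp add: strip_def) }
  { assume "k \<le> i"
    then have "Arg (e k) \<le> Arg (e i)" using Arg_mono[of k i] assms(3) by auto
    moreover have "Im w > Arg (e i) - 2*pi"
    proof (cases "k = 0")
      case True
      then show ?thesis using assms(1) last by (simp add: strip_def)
    next
      case False
      have "-pi < Arg (e (k-1))" using Arg_bounded by blast
      then show ?thesis using assms(1) False bd by (simp add: strip_def)
    qed
    ultimately show "Im w - Arg (e i) \<in> {-2*pi<..<0}" using assms(1) by (simp add: strip_def) }
qed

lemma strip_ratio: "\<lbrakk>w \<in> strip d e k; k < 2*d; i < 2*d\<rbrakk> \<Longrightarrow> exp w / e i \<notin> \<real>\<^sub>\<ge>\<^sub>0"
  using exp_divide_notin_nonneg_Reals[of "e i" w] strip_bounds[of w k i] root_nonzero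
  by (cases "i < k") auto

lemma strip_subset:
  assumes "w \<in> strip d e k" "k < 2*d"
  shows "exp w \<in> U" "exp (- w) \<in> V"
proof -
  have *: "1 - r \<notin> \<real>\<^sub>\<le>\<^sub>0 \<and> 1 - inverse r \<notin> \<real>\<^sub>\<le>\<^sub>0" if "r \<notin> \<real>\<^sub>\<ge>\<^sub>0" for r :: complex
  proof -
    have "inverse r \<notin> \<real>\<^sub>\<ge>\<^sub>0" using that nonneg_Reals_inverse_I[of "inverse r"] by auto
    moreover have "1 - x \<notin> \<real>\<^sub>\<le>\<^sub>0" if "x \<notin> \<real>\<^sub>\<ge>\<^sub>0" for x :: complex
      using that by (auto simp: complex_nonpos_Reals_iff complex_nonneg_Reals_iff)
    ultimately show ?thesis using that by blast
  qed
  show "exp w \<in> U" using * strip_ratio[OF assms] by (auto simp: cut_plane_def)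
  have "exp (- w) / inverse (e i) = inverse (exp w / e i)" for i
    by (simp add: exp_minus field_simps)
  then show "exp (- w) \<in> V"
    using * strip_ratio[OF assms] by (simp del: inverse_divide add: cut_plane_def)
qed

text \<open>The \<open>k\<close> roots below the strip contribute \<open>- i\<close> each and the
  other \<open>2d - k\<close> contribute \<open>i\<close>, which gives
  \<open>i^(2d) (-1)^k = (-1)^(d+k)\<close>. The common factors \<open>exp (w / 2)\<close> multiply
  to \<open>t ^ d\<close>.\<close>

lemma inner_sqrt_strip:
  assumes "w \<in> strip d e k" "k < 2*d"
  shows "inner_sqrt d e (exp w) = sheet_sign d k * outer_sqrt d e (exp w)"
proof -
  have "inner_sqrt d e (exp w) =
      (\<Prod>i<2*d. (if i < k then - \<i> else \<i>) * (exp (w / 2) * csqrt (1 - e i / exp w)))"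
    unfolding inner_sqrt_def
  proof (rule prod.cong)
    fix i assume "i \<in> {..<2*d}"
    then have i: "i < 2*d" by simp
    show "csqrt (e i) * csqrt (1 - exp w / e i) = (if i < k then - \<i> else \<i>) * (exp (w / 2) * csqrt (1 - e i / exp w))"
      using csqrt_crossing_above[of "e i" w] csqrt_crossing_below[of "e i" w] strip_bounds[OF assms i] root_nonzero[OF i]
      by (cases "i < k") (auto simp: mult.assoc)
  qed simp
  also have "\<dots> = (\<Prod>i<2*d. if i < k then - \<i> else \<i>) * (exp (w / 2) ^ (2*d) * (\<Prod>i<2*d. csqrt (1 - e i / exp w)))"
    by (simp add: prod.distrib)
  also have "exp (w / 2) ^ (2*d) = exp w ^ d"
    by (simp add: power_mult exp_double[symmetric])
  also have "(\<Prod>i<2*d. if i < k then - \<i> else \<i>) = sheet_sign d k"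
  proof -
    have "(\<Prod>i<2*d. if i < k then - \<i> else \<i>) = (\<Prod>i<2*d. \<i> * (if i < k then - 1 else 1))"
      by (intro prod.cong) auto
    also have "\<dots> = (\<i>\<^sup>2) ^ d * (\<Prod>i<2*d. if i < k then - 1 else 1)"
      by (simp add: prod.distrib power_mult)
    also have "(\<Prod>i<2*d. if i < k then - 1 else (1::complex)) = (\<Prod>i<k. - 1)"
      using assms(2) by (intro prod.mono_neutral_cong_right) auto
    finally show ?thesis by (simp add: sheet_sign_def power_add)
  qed
  finally show ?thesis by (simp add: outer_sqrt_def)
qed

lemma strip_cover:
  assumes "t \<in> U" "t \<noteq> 0" "inverse t \<in> V"
  obtains k w where "k < 2*d" "w \<in> strip d e k" "t = exp w"
proof -
  \<comment> \<open>On the ray through \<open>e i\<close> the outward cut forces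
    \<open>cmod t < cmod (e i)\<close> and the inward cut forces the opposite, so a common point
    avoids all root arguments.\<close>
  have ne: "Arg t \<noteq> Arg (e i)" if i: "i < 2*d" for i
  proof
    assume eq: "Arg t = Arg (e i)"
    define r where "r = cmod t / cmod (e i)"
    have "t = of_real r * e i"
      using root_nonzero[OF i] eq rcis_cmod_Arg[of t] rcis_cmod_Arg[of "e i"]
      by (metis r_def of_real_mult mult.assoc nonzero_eq_divide_eq norm_eq_zero rcis_def)
    then have r: "t / e i = of_real r" using root_nonzero[OF i] by simp
    have r0: "r > 0" using assms(2) root_nonzero[OF i] by (simp add: r_def)
    have "1 - complex_of_real r \<notin> \<real>\<^sub>\<le>\<^sub>0" using assms(1) i r by (auto simp: cut_plane_def)
    then have "r < 1" by (auto simp: complex_nonpos_Reals_iff)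
    have "inverse t / inverse (e i) = inverse (t / e i)" by (simp add: field_simps)
    then have "1 - complex_of_real (inverse r) \<notin> \<real>\<^sub>\<le>\<^sub>0" using assms(3) i r by (auto simp: cut_plane_def)
    then have "complex_of_real (1 - inverse r) \<notin> \<real>\<^sub>\<le>\<^sub>0" by simp
    then have "inverse r < 1" unfolding nonpos_Reals_of_real_iff by simp
    then have "r > 1" using r0 by (simp add: inverse_less_1_iff)
    with \<open>r < 1\<close> show False by simp
  qed
  have t: "exp (Ln t) = t" "Im (Ln t) = Arg t" using assms(2) by (auto simp: Arg_eq_Im_Ln)
  show ?thesis
  proof (cases "\<exists>i<2*d. Arg t < Arg (e i)")
    case True
    define k where "k = (LEAST i. i < 2*d \<and> Arg t < Arg (e i))"
    have k: "k < 2*d" "Arg t < Arg (e k)" using LeastI_ex[OF True] by (auto simp: k_def)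
    have "(if k = 0 then Arg (e (2*d-1)) - 2*pi else Arg (e (k-1))) < Arg t"
    proof (cases "k = 0")
      case True
      have "Arg (e (2*d-1)) < pi" "-pi < Arg t" using Arg_less_pi[of "2*d-1"] d_ge Arg_bounded[of t] by auto
      then show ?thesis using True by simp
    next
      case False
      then have "\<not> (k - 1 < 2*d \<and> Arg t < Arg (e (k-1)))" unfolding k_def by (intro not_less_Least) auto
      moreover have "k - 1 < 2*d" using k by simp
      ultimately show ?thesis using False ne[of "k-1"] by auto
    qed
    then have "Ln t \<in> strip d e k" using k t by (simp add: strip_def)
    then show ?thesis using that[of k "Ln t"] k t by simp
  next
    case False
    \<comment> \<open>Beyond the last root a point belongs to sector 0, whose logarithms lie one
      turn lower.\<close>
    define w where "w = Ln t - 2 * of_real pi * \<i>"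
    have w: "exp w = t" using t by (simp add: w_def exp_diff)
    have "2*d-1 < 2*d" using d_ge by simp
    then have "\<not> Arg t < Arg (e (2*d-1))" "Arg t \<noteq> Arg (e (2*d-1))" using False ne by blast+
    then have "Arg t > Arg (e (2*d-1))" by simp
    moreover have "-pi < Arg (e 0)" "Arg t \<le> pi" using Arg_bounded by auto
    ultimately have "w \<in> strip d e 0" using t by (simp add: strip_def w_def)
    then show ?thesis using that[of 0 w] w d_ge by simp
  qed
qed

lemma convex_strip: "convex (strip d e k)"
proof -
  have "strip d e k = {w. (if k = 0 then Arg (e (2*d-1)) - 2*pi else Arg (e (k-1))) < Im w} \<inter> {w. Im w < Arg (e k)}"
    by (auto simp: strip_def)
  then show ?thesis by (simp add: convex_halfspace_Im_gt convex_halfspace_Im_lt convex_Int)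
qed

lemma base_in_strip: "k < 2*d \<Longrightarrow> b k \<in> strip d e k"
  using theta_less[of k] less_theta[of "k-1"] theta_0 Arg_less_pi[of "2*d-1"] d_ge
  by (cases k) (auto simp: strip_def base_log_def)

lemma arc_norm: "cmod (sector_arc \<theta> \<rho> k s) = \<rho>"
  using rho_pos by (simp add: sector_arc_def base_log_def norm_exp)

lemma arc_in_outer: "sector_arc \<theta> \<rho> k s \<noteq> 0" "inverse (sector_arc \<theta> \<rho> k s) \<in> V"
proof -
  show nz: "sector_arc \<theta> \<rho> k s \<noteq> 0" by (simp add: sector_arc_def)
  have "1 - inverse (sector_arc \<theta> \<rho> k s) / inverse (e i) \<notin> \<real>\<^sub>\<le>\<^sub>0" if i: "i < 2*d" for i
  proof -
    have "cmod (inverse (sector_arc \<theta> \<rho> k s) / inverse (e i)) < 1"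
      using norm_root[OF i] rho_pos by (simp add: norm_divide norm_inverse norm_mult arc_norm field_simps)
    then have "Re (inverse (sector_arc \<theta> \<rho> k s) / inverse (e i)) < 1"
      using complex_Re_le_cmod le_less_trans by blast
    then show ?thesis by (auto simp: complex_nonpos_Reals_iff)
  qed
  then show "inverse (sector_arc \<theta> \<rho> k s) \<in> V" by (simp add: cut_plane_def)
qed

text \<open>Here \<open>res\<close> is the coefficient of \<open>dt / t\<close> at infinity and
  \<open>K\<close> a primitive in the coordinate \<open>1 / t\<close>, so
  \<open>res * w + K (exp (- w))\<close> is the outer primitive in terms of the logarithm
  \<open>w\<close>. On each convex strip the two primitives are related by one constant
  \<open>c k\<close>. Around the cycle their values cancel, as the signs of sectors \<open>k\<close>
  and \<open>k + 2\<close> agree, and only \<open>c (k + 2) - c k\<close> is left.\<close>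

lemma period_constants:
  assumes G: "\<And>t. t \<in> U \<Longrightarrow> (G has_field_derivative f\<^sub>i t) (at t)"
    and K: "\<And>z. z \<in> V \<Longrightarrow> (K has_field_derivative g z) (at z)"
    and out: "\<And>t. \<lbrakk>t \<noteq> 0; inverse t \<in> V\<rbrakk> \<Longrightarrow> f\<^sub>o t = res / t - g (inverse t) / t\<^sup>2"
    and cross: "\<And>k w. \<lbrakk>k < 2*d; w \<in> strip d e k\<rbrakk> \<Longrightarrow> f\<^sub>i (exp w) = sheet_sign d k * f\<^sub>o (exp w)"
  obtains c where "\<And>k w. \<lbrakk>k < 2*d; w \<in> strip d e k\<rbrakk> \<Longrightarrow> G (exp w) = sheet_sign d k * (res * w + K (exp (- w))) + c k"
    and "\<And>k. k + 2 < 2*d \<Longrightarrow> period d \<theta> \<rho> k f\<^sub>i f\<^sub>o = c (k+2) - c k"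
proof -
  have dK: "((\<lambda>w. res * w + K (exp (- w))) has_field_derivative f\<^sub>o (exp w) * exp w) (at w)"
    if "exp (- w) \<in> V" for w
  proof -
    have "((\<lambda>w. res * w + K (exp (- w))) has_field_derivative res + g (exp (- w)) * (- exp (- w))) (at w)"
    proof -
      have "((\<lambda>w. exp (- w)) has_field_derivative - exp (- w)) (at w)"
        by (auto intro!: derivative_eq_intros)
      from DERIV_chain2[where g = "\<lambda>w. exp (- w)", OF K[OF that] this] show ?thesis
        by (auto intro!: derivative_eq_intros)
    qed
    moreover have "res + g (exp (- w)) * (- exp (- w)) = f\<^sub>o (exp w) * exp w"
      using out[of "exp w"] that by (simp add: exp_minus field_simps power2_eq_square)
    ultimately show ?thesis by simp
  qed
  have "\<exists>c. \<forall>w\<in>strip d e k. G (exp w) - sheet_sign d k * (res * w + K (exp (- w))) = c" if k: "k < 2*d" for k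
  proof (rule has_field_derivative_zero_constant[OF convex_strip])
    fix w assume w: "w \<in> strip d e k"
    have "((\<lambda>w. G (exp w) - sheet_sign d k * (res * w + K (exp (- w)))) has_field_derivative
        f\<^sub>i (exp w) * exp w - sheet_sign d k * (f\<^sub>o (exp w) * exp w)) (at w)"
      by (intro DERIV_diff DERIV_cmult dK strip_subset[OF w k]
          DERIV_chain2[where g = exp, OF G DERIV_exp])
    then show "((\<lambda>w. G (exp w) - sheet_sign d k * (res * w + K (exp (- w)))) has_field_derivative 0) (at w within strip d e k)"
      using cross[OF k w] by (simp add: has_field_derivative_at_within)
  qed
  then obtain c where "\<And>k w. k < 2*d \<Longrightarrow> w \<in> strip d e k \<Longrightarrow> G (exp w) - sheet_sign d k * (res * w + K (exp (- w))) = c k"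
    by metis
  then have c: "G (exp w) = sheet_sign d k * (res * w + K (exp (- w))) + c k" if "k < 2*d" "w \<in> strip d e k" for k w
    using that by (metis diff_eq_eq add.commute)
  have rad: "radial_integral \<theta> \<rho> k f\<^sub>i = G (exp (b k)) - G 0" if k: "k < 2*d" for k
  proof -
    have "((\<lambda>s. f\<^sub>i (of_real s * exp (b k)) * exp (b k)) has_integral
        G (of_real 1 * exp (b k)) - G (of_real 0 * exp (b k))) {0..1}"
    proof (rule fundamental_theorem_of_calculus)
      fix s :: real assume "s \<in> {0..1}"
      then have "of_real s * exp (b k) \<in> U"
        using cut_plane_scale[OF strip_subset(1)[OF base_in_strip[OF k] k]] by auto
      note dG = has_field_derivative_at_within[OF G[OF this]]
      have "((\<lambda>s. of_real s * exp (b k)) has_vector_derivative exp (b k)) (at s within {0..1})"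
        by (auto intro!: derivative_eq_intros)
      from field_vector_diff_chain_within[OF this dG] show "((\<lambda>s. G (of_real s * exp (b k))) has_vector_derivative
          f\<^sub>i (of_real s * exp (b k)) * exp (b k)) (at s within {0..1})"
        by (simp add: o_def mult.commute)
    qed simp
    from integral_unique[OF this] show ?thesis unfolding radial_integral_def by simp
  qed
  have arc_eq: "arc_integral \<theta> \<rho> k f\<^sub>o = (res * b (k+2) + K (exp (- b (k+2)))) - (res * b k + K (exp (- b k)))" for k
  proof -
    define L where "L s = b k + of_real s * (b (k+2) - b k)" for s :: real
    define H where "H w = res * w + K (exp (- w))" for w
    have "((\<lambda>s. f\<^sub>o (sector_arc \<theta> \<rho> k s) * (sector_arc \<theta> \<rho> k s * (b (k+2) - b k))) has_integral H (L 1) - H (L 0)) {0..1}"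
    proof (rule fundamental_theorem_of_calculus)
      fix s :: real
      have "exp (L s) = sector_arc \<theta> \<rho> k s" by (simp add: L_def sector_arc_def)
      then have "exp (- L s) \<in> V" using arc_in_outer(2)[of k s] by (simp add: exp_minus)
      note dH = has_field_derivative_at_within[OF dK[OF this, folded H_def]]
      have "(L has_vector_derivative (b (k+2) - b k)) (at s within {0..1})"
        unfolding L_def by (auto intro!: derivative_eq_intros)
      from field_vector_diff_chain_within[OF this dH] show "((\<lambda>s. H (L s)) has_vector_derivative
          f\<^sub>o (sector_arc \<theta> \<rho> k s) * (sector_arc \<theta> \<rho> k s * (b (k+2) - b k))) (at s within {0..1})"
        by (simp add: o_def \<open>exp (L s) = sector_arc \<theta> \<rho> k s\<close> mult_ac)
    qed simp
    from integral_unique[OF this] show ?thesis unfolding arc_integral_def by (simp add: H_def L_def)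
  qed
  show ?thesis
  proof (rule that[of c])
    fix k assume k: "k + 2 < 2*d"
    have sg: "sheet_sign d (k+2) = sheet_sign d k" by (simp add: sheet_sign_def)
    define X Y where "X = res * b k + K (exp (- b k))" and "Y = res * b (k+2) + K (exp (- b (k+2)))"
    have "period d \<theta> \<rho> k f\<^sub>i f\<^sub>o = (G (exp (b (k+2))) - G 0) - (G (exp (b k)) - G 0) - sheet_sign d k * (Y - X)"
      unfolding period_def X_def Y_def using rad[of k] rad[of "k+2"] arc_eq[of k] k by simp
    also have "G (exp (b (k+2))) = sheet_sign d k * Y + c (k+2)"
      unfolding Y_def using c[OF k base_in_strip[OF k]] sg by simp
    also have "G (exp (b k)) = sheet_sign d k * X + c k"
      unfolding X_def using c[of k, OF _ base_in_strip] k by simp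
    finally show "period d \<theta> \<rho> k f\<^sub>i f\<^sub>o = c (k+2) - c k" by (simp add: algebra_simps)
  qed (rule c)
qed

lemma sheet_sign_cases: "sheet_sign d k = 1 \<or> sheet_sign d k = -1"
  unfolding sheet_sign_def by (cases "even (d + k)") auto

lemma quotient_crosses_strip:
  assumes "k < 2*d" "w \<in> strip d e k"
  shows "N (exp w) / inner_sqrt d e (exp w) = sheet_sign d k * (N (exp w) / outer_sqrt d e (exp w))"
  using inner_sqrt_strip[OF assms(2,1)] sheet_sign_cases[of k] by auto

text \<open>The constants of integration of \<open>G\<close> and \<open>K\<close> absorb two of the
  \<open>2d\<close> jump constants, one for each sign. All others are then sums of periods, which is
  why \<open>2d - 2\<close> periods control everything.\<close>

lemma normalized_primitives:
  assumes fi: "f\<^sub>i holomorphic_on U" and g: "g holomorphic_on V"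
    and out: "\<And>t. \<lbrakk>t \<noteq> 0; inverse t \<in> V\<rbrakk> \<Longrightarrow> f\<^sub>o t = res / t - g (inverse t) / t\<^sup>2"
    and cross: "\<And>k w. \<lbrakk>k < 2*d; w \<in> strip d e k\<rbrakk> \<Longrightarrow> f\<^sub>i (exp w) = sheet_sign d k * f\<^sub>o (exp w)"
  obtains G K \<delta> where "\<And>t. t \<in> U \<Longrightarrow> (G has_field_derivative f\<^sub>i t) (at t)"
    and "\<And>z. z \<in> V \<Longrightarrow> (K has_field_derivative g z) (at z)"
    and "\<And>k w. \<lbrakk>k < 2*d; w \<in> strip d e k\<rbrakk> \<Longrightarrow> G (exp w) = sheet_sign d k * (res * w + K (exp (- w))) + \<delta> k"
    and "\<delta> 0 = 0" "\<delta> (Suc 0) = 0"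
    and "\<And>k. k + 2 < 2*d \<Longrightarrow> \<delta> (k + 2) = \<delta> k + period d \<theta> \<rho> k f\<^sub>i f\<^sub>o"
proof -
  obtain G where G: "\<And>t. t \<in> U \<Longrightarrow> (G has_field_derivative f\<^sub>i t) (at t)"
    using cut_plane_primitive[OF fi] by blast
  obtain K where K: "\<And>z. z \<in> V \<Longrightarrow> (K has_field_derivative g z) (at z)"
    using cut_plane_primitive[OF g] by blast
  obtain c where c: "\<And>k w. \<lbrakk>k < 2*d; w \<in> strip d e k\<rbrakk> \<Longrightarrow> G (exp w) = sheet_sign d k * (res * w + K (exp (- w))) + c k"
    and per: "\<And>k. k + 2 < 2*d \<Longrightarrow> period d \<theta> \<rho> k f\<^sub>i f\<^sub>o = c (k+2) - c k"
    using period_constants[OF G K out cross] by blast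
  define \<sigma> where "\<sigma> = sheet_sign d 0"
  have \<sigma>: "\<sigma> * \<sigma> = 1" "sheet_sign d k = (if even k then \<sigma> else - \<sigma>)" for k
    by (auto simp: \<sigma>_def sheet_sign_def power_add simp flip: power_mult_distrib)
  \<comment> \<open>\<open>A\<close> and \<open>B\<close> solve
    \<open>A - \<sigma> * B = - c 0\<close> and \<open>A + \<sigma> * B = - c 1\<close>, where
    \<open>\<sigma> * \<sigma> = 1\<close>.\<close>
  define A where "A = - (c 0 + c (Suc 0)) / 2"
  define B where "B = \<sigma> * (c 0 - c (Suc 0)) / 2"
  define \<delta> where "\<delta> k = c k - c (k mod 2)" for k
  have shift: "A - sheet_sign d k * B = - c (k mod 2)" for k
  proof -
    have "sheet_sign d k * B = (if even k then 1 else -1) * (\<sigma> * \<sigma>) * (c 0 - c (Suc 0)) / 2"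
      by (simp add: \<sigma>(2) B_def)
    then show ?thesis
      by (cases "even k") (auto simp: \<sigma>(1) A_def even_iff_mod_2_eq_zero odd_iff_mod_2_eq_one field_simps)
  qed
  show ?thesis
  proof (rule that[of "\<lambda>t. G t + A" "\<lambda>z. K z + B" \<delta>])
    show "((\<lambda>t. G t + A) has_field_derivative f\<^sub>i t) (at t)" if "t \<in> U" for t
      using G[OF that] by (auto intro!: derivative_eq_intros)
    show "((\<lambda>z. K z + B) has_field_derivative g z) (at z)" if "z \<in> V" for z
      using K[OF that] by (auto intro!: derivative_eq_intros)
    show "G (exp w) + A = sheet_sign d k * (res * w + (K (exp (- w)) + B)) + \<delta> k"
      if "k < 2*d" "w \<in> strip d e k" for k w
      using c[OF that] shift[of k] by (simp add: \<delta>_def algebra_simps)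
    show "\<delta> (k + 2) = \<delta> k + period d \<theta> \<rho> k f\<^sub>i f\<^sub>o" if "k + 2 < 2*d" for k
      using per[OF that] by (simp add: \<delta>_def)
  qed (auto simp: \<delta>_def)
qed

end

section \<open>Expansions at infinity and limits at branch points\<close>

definition reverse_poly :: "nat \<Rightarrow> complex poly \<Rightarrow> complex poly" where
  "reverse_poly m q = (\<Sum>j\<le>m. monom (coeff q j) (m - j))"

lemma poly_reverse_poly:
  assumes "degree q \<le> m" "t \<noteq> 0"
  shows "poly q t = t ^ m * poly (reverse_poly m q) (inverse t)"
proof -
  have "poly q t = (\<Sum>j\<le>m. coeff q j * t ^ j)"
    using assms(1) by (subst poly_altdef, intro sum.mono_neutral_left) (auto simp: coeff_eq_0)
  also have "\<dots> = (\<Sum>j\<le>m. t ^ m * (coeff q j * inverse t ^ (m - j)))"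
  proof (rule sum.cong)
    fix j assume "j \<in> {..m}"
    then have "t ^ m = t ^ j * t ^ (m - j)" by (simp flip: power_add)
    then show "coeff q j * t ^ j = t ^ m * (coeff q j * inverse t ^ (m - j))"
      using assms(2) by (simp add: field_simps power_inverse)
  qed simp
  finally show ?thesis by (simp add: reverse_poly_def poly_sum poly_monom sum_distrib_left)
qed

text \<open>The reversal uses the fixed bound \<open>m\<close> instead of the degree, so this value
  may vanish. For monic \<open>p\<close> and \<open>m = d - 1\<close> it is 1 and becomes the
  residue at infinity, up to sign.\<close>

lemma poly_reverse_poly_0: "poly (reverse_poly m q) 0 = coeff q m"
proof -
  have "poly (reverse_poly m q) 0 = (\<Sum>j\<le>m. if j = m then coeff q m else 0)"
    unfolding reverse_poly_def poly_sum by (intro sum.cong) (auto simp: poly_monom power_0_left)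
  then show ?thesis by simp
qed

lemma cut_sqrt_at_0: "cut_sqrt n a 0 = 1"
  by (simp add: cut_sqrt_def)

lemma infinite_cut_plane: "infinite (cut_plane n a)"
proof
  assume "finite (cut_plane n a)"
  then have "cut_plane n a = {}" using open_cut_plane by (rule finite_imp_not_open)
  then show False using zero_in_cut_plane[of n a] by simp
qed

lemma poly_eq_on_cut_plane:
  fixes P Q :: "complex poly"
  assumes "\<And>t. t \<in> cut_plane n a \<Longrightarrow> poly P t = poly Q t"
  shows "P = Q"
proof -
  have "cut_plane n a \<subseteq> {t. poly (P - Q) t = 0}" using assms by auto
  then have "infinite {t. poly (P - Q) t = 0}" using infinite_cut_plane finite_subset by blast
  then have "P - Q = 0" using poly_roots_finite by metis
  then show ?thesis by simp
qed

text \<open>Limits of square roots at their zeros are read off from the squares, so no branch has to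
  be followed.\<close>

lemma tendsto_0_of_power2:
  fixes f :: "'a \<Rightarrow> complex"
  assumes "((\<lambda>x. (f x)\<^sup>2) \<longlongrightarrow> 0) F"
  shows "(f \<longlongrightarrow> 0) F"
proof -
  have "((\<lambda>x. sqrt (cmod ((f x)\<^sup>2))) \<longlongrightarrow> sqrt (cmod 0)) F"
    by (intro tendsto_intros assms)
  then have "((\<lambda>x. cmod (f x)) \<longlongrightarrow> 0) F"
    by (simp only: norm_power real_sqrt_abs abs_norm_cancel norm_zero real_sqrt_zero)
  then show ?thesis by (rule tendsto_norm_zero_cancel)
qed

context distinct_directions
begin

lemma cut_sqrt_tendsto_0:
  assumes i: "i < n"
  shows "(cut_sqrt n a \<longlongrightarrow> 0) (at (a i) within S)"
proof -
  have "((\<lambda>t. (cut_sqrt n a t)\<^sup>2) \<longlongrightarrow> (\<Prod>j<n. 1 - a i / a j)) (at (a i) within S)"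
    unfolding cut_sqrt_power2 divide_inverse by (intro tendsto_intros)
  moreover have "(\<Prod>j<n. 1 - a i / a j) = 0" using i nonzero by (intro prod_zero) auto
  ultimately have "((\<lambda>t. (cut_sqrt n a t)\<^sup>2) \<longlongrightarrow> 0) (at (a i) within S)" by simp
  then show ?thesis by (rule tendsto_0_of_power2)
qed

text \<open>The square of the quotient is rational: one factor \<open>t - a i\<close> survives in
  the numerator, and the other factors are nonzero at \<open>a i\<close> because the directions are
  distinct.\<close>

lemma diff_over_cut_sqrt_tendsto_0:
  assumes i: "i < n"
  shows "((\<lambda>t. (t - a i) / cut_sqrt n a t) \<longlongrightarrow> 0) (at (a i) within cut_plane n a)"
proof -
  define Z where "Z t = (\<Prod>j\<in>{..<n}-{i}. 1 - t / a j)" for t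
  have ai: "a i \<noteq> 0" using nonzero i by blast
  have sq: "(cut_sqrt n a t)\<^sup>2 = (1 - t / a i) * Z t" for t
    unfolding cut_sqrt_power2 Z_def using i by (subst prod.remove[of _ i]) auto
  have "1 - a i / a j \<noteq> 0" if "j \<in> {..<n} - {i}" for j
    using distinct[of i j] i that nonzero by auto
  then have Z: "Z (a i) \<noteq> 0" by (simp add: Z_def)
  have "(Z \<longlongrightarrow> Z (a i)) (at (a i) within cut_plane n a)"
    unfolding Z_def divide_inverse by (intro tendsto_intros)
  then have "((\<lambda>t. - a i * (t - a i) / Z t) \<longlongrightarrow> - a i * (a i - a i) / Z (a i)) (at (a i) within cut_plane n a)"
    using Z by (intro tendsto_intros)
  then have "((\<lambda>t. - a i * (t - a i) / Z t) \<longlongrightarrow> 0) (at (a i) within cut_plane n a)" by simp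
  then have "((\<lambda>t. ((t - a i) / cut_sqrt n a t)\<^sup>2) \<longlongrightarrow> 0) (at (a i) within cut_plane n a)"
  proof (rule Lim_transform_within[where d = 1])
    fix t assume t: "t \<in> cut_plane n a"
    have "cut_sqrt n a t \<noteq> 0" using cut_sqrt_nonzero[OF t] .
    then have nz: "1 - t / a i \<noteq> 0" "Z t \<noteq> 0" using sq[of t] by auto
    have "t - a i = - a i * (1 - t / a i)" using ai by (simp add: field_simps)
    then have "((t - a i) / cut_sqrt n a t)\<^sup>2 = (t - a i) * (- a i * (1 - t / a i)) / ((1 - t / a i) * Z t)"
      unfolding power_divide sq by (simp add: power2_eq_square)
    also have "\<dots> = - a i * (t - a i) / Z t" using nz by (simp add: divide_simps)
    finally show "- a i * (t - a i) / Z t = ((t - a i) / cut_sqrt n a t)\<^sup>2" by simp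
  qed simp
  then show ?thesis by (rule tendsto_0_of_power2)
qed

end

context root_configuration
begin

lemma inner_sqrt_nonzero:
  assumes "t \<in> U"
  shows "inner_sqrt d e t \<noteq> 0"
  using cut_sqrt_nonzero[OF assms] prod_csqrt_nonzero unfolding inner_sqrt_eq by (rule no_zero_divisors[rotated])

lemma holomorphic_inner_sqrt: "inner_sqrt d e holomorphic_on U"
proof -
  have "inner_sqrt d e = (\<lambda>t. (\<Prod>i<2*d. csqrt (e i)) * cut_sqrt (2*d) e t)"
    by (rule ext) (rule inner_sqrt_eq)
  then show ?thesis
    using holomorphic_on_mult[OF holomorphic_on_const holomorphic_cut_sqrt] by metis
qed

end

section \<open>Differentials with imaginary periods\<close>

text \<open>With \<open>s\<close> the sign of \<open>Re (f \<xi>)\<close>, the modulus of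
  \<open>exp (s * f z)\<close> is largest at \<open>\<xi>\<close>. By the maximum modulus principle
  \<open>exp (s * f z)\<close> is constant.\<close>

lemma Re_max_imp_derivative_zero:
  assumes f: "\<And>z. z \<in> S \<Longrightarrow> (f has_field_derivative f' z) (at z)" and S: "open S" "connected S"
    and \<xi>: "\<xi> \<in> S" "\<And>z. z \<in> S \<Longrightarrow> \<bar>Re (f z)\<bar> \<le> \<bar>Re (f \<xi>)\<bar>" and z: "z \<in> S"
  shows "f' z = 0"
proof -
  define s :: complex where "s = (if Re (f \<xi>) \<ge> 0 then 1 else -1)"
  have s: "s \<noteq> 0" by (simp add: s_def)
  have df: "((\<lambda>z. exp (s * f z)) has_field_derivative exp (s * f z) * (s * f' z)) (at z)" if "z \<in> S" for z
    by (auto intro!: derivative_eq_intros f[OF that])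
  have "(\<lambda>z. exp (s * f z)) holomorphic_on S"
    using df by (meson field_differentiable_at_within field_differentiable_def holomorphic_on_def)
  moreover have "cmod (exp (s * f w)) \<le> cmod (exp (s * f \<xi>))" if "w \<in> S" for w
    using \<xi>(2)[OF that] by (auto simp: s_def)
  ultimately have "(\<lambda>z. exp (s * f z)) constant_on S"
    using maximum_modulus_principle[of "\<lambda>z. exp (s * f z)" S S \<xi>] S \<xi>(1) by blast
  then obtain c where c: "\<And>z. z \<in> S \<Longrightarrow> exp (s * f z) = c" by (auto simp: constant_on_def)
  have "((\<lambda>z. c) has_field_derivative exp (s * f z) * (s * f' z)) (at z)"
    by (rule has_field_derivative_transform_within_open[OF df[OF z] S(1) z]) (rule c)
  then have "exp (s * f z) * (s * f' z) = 0" using DERIV_unique DERIV_const by blast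
  then show ?thesis using s by simp
qed

context distinct_directions
begin

text \<open>The glued function, extended by 0 to the points \<open>a i\<close>, is continuous and
  attains its maximum on the closed unit disc, which is \<open>cmod z \<ge> 1\<close> in the outer
  coordinate. Two such discs cover the sphere, so the lemma is applied twice, the second time with
  the domains exchanged.\<close>

lemma glued_function_attains_sup:
  fixes h\<^sub>i h\<^sub>o :: "complex \<Rightarrow> real"
  defines "V \<equiv> cut_plane n (\<lambda>i. inverse (a i))"
  assumes cont: "continuous_on (cut_plane n a) h\<^sub>i" "continuous_on V h\<^sub>o"
    and agree: "\<And>t. \<lbrakk>t \<in> cut_plane n a; t \<noteq> 0; inverse t \<in> V\<rbrakk> \<Longrightarrow> h\<^sub>i t = h\<^sub>o (inverse t)"
    and lim: "\<And>i. i < n \<Longrightarrow> (h\<^sub>i \<longlongrightarrow> 0) (at (a i) within cut_plane n a)"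
      "\<And>i. i < n \<Longrightarrow> (h\<^sub>o \<longlongrightarrow> 0) (at (inverse (a i)) within V)"
  shows "\<exists>M. (\<forall>t\<in>cut_plane n a. cmod t \<le> 1 \<longrightarrow> h\<^sub>i t \<le> M) \<and> (\<forall>z\<in>V. cmod z \<ge> 1 \<longrightarrow> h\<^sub>o z \<le> M) \<and>
    (M = 0 \<or> (\<exists>t\<in>cut_plane n a. h\<^sub>i t = M) \<or> (\<exists>z\<in>V. h\<^sub>o z = M))"
proof -
  define U where "U = cut_plane n a"
  define E where "E = a ` {..<n}"
  define W where "W = {t. t \<noteq> 0 \<and> inverse t \<in> V}"
  have oU: "open U" and oV: "open V" by (auto simp: U_def V_def open_cut_plane)
  have oW: "open W"
  proof -
    have "open ((-{0}) \<inter> inverse -` V)"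
      by (rule continuous_open_preimage[OF _ _ oV]) (auto intro!: continuous_intros)
    moreover have "W = (-{0}) \<inter> inverse -` V" by (auto simp: W_def)
    ultimately show ?thesis by simp
  qed
  have EU: "t \<notin> U" "t \<notin> W" if t: "t \<in> E" for t
  proof -
    obtain i where "i < n" "t = a i" using t by (auto simp: E_def)
    then show "t \<notin> U" "t \<notin> W" using nonzero by (auto simp: U_def W_def V_def cut_plane_def)
  qed
  have cov: "t \<in> U \<or> t \<in> W" if "t \<notin> E" for t
    using cut_plane_cover[of t] that by (auto simp: U_def W_def V_def E_def)
  define h where "h t = (if t \<in> E then 0 else if t \<in> U then h\<^sub>i t else h\<^sub>o (inverse t))" for t
  have hU: "h t = h\<^sub>i t" if "t \<in> U" for t using that EU by (auto simp: h_def)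
  have hW: "h t = h\<^sub>o (inverse t)" if "t \<in> W" for t
    using that EU agree by (auto simp: h_def U_def W_def)
  have hE: "h t = 0" if "t \<in> E" for t using that by (simp add: h_def)
  have cU: "continuous_on U h" using cont(1) hU by (simp add: U_def cong: continuous_on_cong)
  have cW: "continuous_on W h"
  proof -
    have "continuous_on W (\<lambda>t. h\<^sub>o (inverse t))"
      by (rule continuous_on_compose2[OF cont(2)]) (auto simp: W_def intro!: continuous_intros)
    then show ?thesis using hW by (simp cong: continuous_on_cong)
  qed
  have "isCont h t" for t
  proof (cases "t \<in> E")
    case False
    then show ?thesis using cov cU cW oU oW continuous_on_eq_continuous_at by metis
  next
    case True
    then obtain i where i: "i < n" "t = a i" by (auto simp: E_def)
    have t0: "t \<noteq> 0" using i nonzero by auto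
    have 1: "(h \<longlongrightarrow> 0) (at t within U)"
      unfolding i(2) by (rule Lim_transform_within[OF lim(1)[OF i(1), folded U_def], where d = 1]) (auto simp: hU)
    have "filterlim inverse (at (inverse t) within V) (at t within W)"
      unfolding filterlim_at using t0
      by (auto simp: eventually_at_filter W_def intro!: always_eventually tendsto_intros)
    from filterlim_compose[OF lim(2)[OF i(1), folded i(2)] this]
    have "((\<lambda>s. h\<^sub>o (inverse s)) \<longlongrightarrow> 0) (at t within W)" .
    then have 2: "(h \<longlongrightarrow> 0) (at t within W)"
      by (rule Lim_transform_within[where d = 1]) (auto simp: hW)
    have "(h \<longlongrightarrow> 0) (at t within U \<union> W)"
      unfolding at_within_union using 1 2 by (rule filterlim_sup)
    moreover have "at t within U \<union> W = at t"
    proof -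
      have "open (- (E - {t}))" by (intro open_Compl finite_imp_closed) (simp add: E_def)
      then show ?thesis by (intro at_within_nhd[of t "- (E - {t})"]) (use cov EU True in auto)
    qed
    ultimately show ?thesis using hE[OF True] by (simp add: isCont_def)
  qed
  then have "continuous_on (cball 0 1) h" by (simp add: continuous_at_imp_continuous_on)
  moreover have "compact (cball 0 1 :: complex set)" "cball 0 1 \<noteq> ({} :: complex set)" by auto
  ultimately obtain t1 where t1: "t1 \<in> cball 0 1" "\<And>t. t \<in> cball 0 1 \<Longrightarrow> h t \<le> h t1"
    using continuous_attains_sup[of "cball 0 1" h] by blast
  show ?thesis
  proof (intro exI[of _ "h t1"] conjI ballI impI)
    show "h\<^sub>i t \<le> h t1" if "t \<in> cut_plane n a" "cmod t \<le> 1" for t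
      using t1(2)[of t] hU[of t] that by (simp add: U_def)
    show "h\<^sub>o z \<le> h t1" if "z \<in> V" "cmod z \<ge> 1" for z
    proof -
      have z0: "z \<noteq> 0" using that by auto
      have "inverse z \<in> cball 0 1" using that z0 by (simp add: norm_inverse norm_divide field_simps)
      then show ?thesis using t1(2)[of "inverse z"] hW[of "inverse z"] that z0 by (simp add: W_def)
    qed
    show "h t1 = 0 \<or> (\<exists>t\<in>cut_plane n a. h\<^sub>i t = h t1) \<or> (\<exists>z\<in>V. h\<^sub>o z = h t1)"
    proof (cases "t1 \<in> E")
      case False
      then show ?thesis
      proof (rule disjE[OF cov])
        assume "t1 \<in> U"
        then show ?thesis using hU[of t1] by (intro disjI2 disjI1 bexI[of _ t1]) (auto simp: U_def)
      next
        assume "t1 \<in> W"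
        then show ?thesis using hW[of t1] by (intro disjI2 bexI[of _ "inverse t1"]) (auto simp: W_def)
      qed
    qed (use hE in simp)
  qed
qed

end

context root_configuration
begin

interpretation inv: distinct_directions "2*d" "\<lambda>i. inverse (e i)" by (rule inverse_directions)

text \<open>The point \<open>e i\<close> is approached inside its two neighbouring sectors. Their
  signs are opposite, so the relations \<open>L = s * M + \<delta> k\<close> and
  \<open>L = - s * M + \<delta> l\<close> determine \<open>L\<close> and, up to sign,
  \<open>M\<close>.\<close>

lemma crossing_limits:
  assumes GK: "\<And>k w. \<lbrakk>k < 2*d; w \<in> strip d e k\<rbrakk> \<Longrightarrow> G (exp w) = sheet_sign d k * K (exp (- w)) + \<delta> k"
    and i: "i < 2*d"
    and L: "(G \<longlongrightarrow> L) (at (e i) within U)" and M: "(K \<longlongrightarrow> M) (at (inverse (e i)) within V)"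
  shows "\<exists>k l. k < 2*d \<and> l < 2*d \<and> L = (\<delta> k + \<delta> l) / 2 \<and> (M = (\<delta> k - \<delta> l) / 2 \<or> M = (\<delta> l - \<delta> k) / 2)"
proof -
  have eU: "e i \<notin> U" "inverse (e i) \<notin> V" using i root_nonzero[OF i] by (auto simp: cut_plane_def)
  have *: "L = sheet_sign d k * M + \<delta> k"
    if k: "k < 2*d" and w0: "exp w0 = e i" and w: "(w \<longlongrightarrow> w0) (at_right (0::real))"
      and ev: "\<forall>\<^sub>F \<epsilon> in at_right 0. w \<epsilon> \<in> strip d e k" for k w0 w
  proof -
    have fU: "filterlim (\<lambda>\<epsilon>. exp (w \<epsilon>)) (at (e i) within U) (at_right 0)"
      unfolding filterlim_at
    proof
      show "\<forall>\<^sub>F \<epsilon> in at_right 0. exp (w \<epsilon>) \<in> U \<and> exp (w \<epsilon>) \<noteq> e i"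
        using ev by eventually_elim (metis strip_subset(1) k eU(1))
      show "((\<lambda>\<epsilon>. exp (w \<epsilon>)) \<longlongrightarrow> e i) (at_right 0)" unfolding w0[symmetric] by (intro tendsto_intros w)
    qed
    have fV: "filterlim (\<lambda>\<epsilon>. exp (- w \<epsilon>)) (at (inverse (e i)) within V) (at_right 0)"
      unfolding filterlim_at
    proof
      show "\<forall>\<^sub>F \<epsilon> in at_right 0. exp (- w \<epsilon>) \<in> V \<and> exp (- w \<epsilon>) \<noteq> inverse (e i)"
        using ev by eventually_elim (metis strip_subset(2) k eU(2))
      have "inverse (e i) = exp (- w0)" by (simp add: exp_minus w0)
      then show "((\<lambda>\<epsilon>. exp (- w \<epsilon>)) \<longlongrightarrow> inverse (e i)) (at_right 0)" by (auto intro!: tendsto_intros w)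
    qed
    have 1: "((\<lambda>\<epsilon>. G (exp (w \<epsilon>))) \<longlongrightarrow> L) (at_right 0)" by (rule filterlim_compose[OF L fU])
    have "((\<lambda>\<epsilon>. sheet_sign d k * K (exp (- w \<epsilon>)) + \<delta> k) \<longlongrightarrow> sheet_sign d k * M + \<delta> k) (at_right 0)"
      by (intro tendsto_intros filterlim_compose[OF M fV])
    moreover have "\<forall>\<^sub>F \<epsilon> in at_right 0. sheet_sign d k * K (exp (- w \<epsilon>)) + \<delta> k = G (exp (w \<epsilon>))"
      using ev by eventually_elim (use GK[OF k] in auto)
    ultimately have 2: "((\<lambda>\<epsilon>. G (exp (w \<epsilon>))) \<longlongrightarrow> sheet_sign d k * M + \<delta> k) (at_right 0)"
      by (rule Lim_transform_eventually)
    show ?thesis using tendsto_unique[OF _ 1 2] by simp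
  qed
  have ei: "e i \<noteq> 0" using root_nonzero[OF i] .
  have ImLn: "Im (Ln (e i)) = Arg (e i)" using Arg_eq_Im_Ln[OF ei] by simp
  have small: "\<forall>\<^sub>F \<epsilon> in at_right 0. 0 < \<epsilon> \<and> \<epsilon> < c" if "c > 0" for c :: real
    using eventually_at_right_real[OF that] by eventually_elim auto
  have lo: "(if i = 0 then Arg (e (2*d-1)) - 2*pi else Arg (e (i-1))) < Arg (e i)"
  proof (cases "i = 0")
    case True
    have "Arg (e (2*d-1)) < pi" "- pi < Arg (e i)" using Arg_less_pi[of "2*d-1"] d_ge Arg_bounded[of "e i"] by auto
    then show ?thesis using True by simp
  next
    case False
    then show ?thesis using Arg_strict_mono[of "i-1" i] i by simp
  qed
  have 1: "L = sheet_sign d i * M + \<delta> i"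
  proof (rule *[OF i exp_Ln[OF ei], where w = "\<lambda>\<epsilon>. Ln (e i) - \<i> * of_real \<epsilon>"])
    have "((\<lambda>\<epsilon>. Ln (e i) - \<i> * of_real \<epsilon>) \<longlongrightarrow> Ln (e i) - \<i> * of_real 0) (at_right 0)"
      by (intro tendsto_intros)
    then show "((\<lambda>\<epsilon>. Ln (e i) - \<i> * of_real \<epsilon>) \<longlongrightarrow> Ln (e i)) (at_right 0)" by simp
    define c where "c = Arg (e i) - (if i = 0 then Arg (e (2*d-1)) - 2*pi else Arg (e (i-1)))"
    have "c > 0" using lo by (simp add: c_def)
    from small[OF this] show "\<forall>\<^sub>F \<epsilon> in at_right 0. Ln (e i) - \<i> * of_real \<epsilon> \<in> strip d e i"
      by eventually_elim (auto simp: strip_def c_def ImLn)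
  qed
  \<comment> \<open>The sector after the last root is sector 0. The sign alternates there as well,
    because the number of roots is even.\<close>
  define l where "l = (if i = 2*d-1 then 0 else i + 1)"
  have l: "l < 2*d" using i d_ge by (auto simp: l_def)
  have 2: "L = sheet_sign d l * M + \<delta> l"
  proof (cases "i = 2*d-1")
    case False
    have il: "Arg (e i) < Arg (e l)" "l = i + 1" using Arg_strict_mono[of i l] l False by (auto simp: l_def)
    show ?thesis
    proof (rule *[OF l exp_Ln[OF ei], where w = "\<lambda>\<epsilon>. Ln (e i) + \<i> * of_real \<epsilon>"])
      have "((\<lambda>\<epsilon>. Ln (e i) + \<i> * of_real \<epsilon>) \<longlongrightarrow> Ln (e i) + \<i> * of_real 0) (at_right 0)"
        by (intro tendsto_intros)
      then show "((\<lambda>\<epsilon>. Ln (e i) + \<i> * of_real \<epsilon>) \<longlongrightarrow> Ln (e i)) (at_right 0)" by simp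
      have "Arg (e l) - Arg (e i) > 0" using il by simp
      from small[OF this] show "\<forall>\<^sub>F \<epsilon> in at_right 0. Ln (e i) + \<i> * of_real \<epsilon> \<in> strip d e l"
        by eventually_elim (auto simp: strip_def il(2) ImLn)
    qed
  next
    case True
    have l0: "l = 0" using True by (simp add: l_def)
    have ar: "Arg (e i) < pi" "- pi < Arg (e 0)" using Arg_less_pi[OF i] Arg_bounded[of "e 0"] by auto
    have ex: "exp (Ln (e i) - 2 * of_real pi * \<i>) = e i" using ei by (simp add: exp_diff)
    show ?thesis
    proof (rule *[OF l ex, where w = "\<lambda>\<epsilon>. Ln (e i) - 2 * of_real pi * \<i> + \<i> * of_real \<epsilon>"])
      have "((\<lambda>\<epsilon>. Ln (e i) - 2 * of_real pi * \<i> + \<i> * of_real \<epsilon>) \<longlongrightarrow> Ln (e i) - 2 * of_real pi * \<i> + \<i> * of_real 0) (at_right 0)"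
        by (intro tendsto_intros)
      then show "((\<lambda>\<epsilon>. Ln (e i) - 2 * of_real pi * \<i> + \<i> * of_real \<epsilon>) \<longlongrightarrow> Ln (e i) - 2 * of_real pi * \<i>) (at_right 0)" by simp
      have pos: "Arg (e 0) - Arg (e i) + 2 * pi > 0" using ar by simp
      have last: "Arg (e (2 * d - Suc 0)) = Arg (e i)" using True by simp
      from small[OF pos] show "\<forall>\<^sub>F \<epsilon> in at_right 0. Ln (e i) - 2 * of_real pi * \<i> + \<i> * of_real \<epsilon> \<in> strip d e l"
        unfolding l0 by eventually_elim (auto simp: strip_def ImLn last)
    qed
  qed
  have sg: "sheet_sign d l = - sheet_sign d i"
  proof (cases "i = 2*d-1")
    case True
    then have "odd i" using d_ge by simp
    moreover have "l = 0" using True by (simp add: l_def)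
    ultimately show ?thesis unfolding sheet_sign_def power_add by simp
  next
    case False
    then show ?thesis by (simp add: l_def sheet_sign_def)
  qed
  have "L = (\<delta> i + \<delta> l) / 2" using 1 2 sg by (simp add: field_simps)
  moreover have sM: "sheet_sign d i * M = (\<delta> l - \<delta> i) / 2" using 1 2 sg by (simp add: field_simps)
  have "M = (\<delta> i - \<delta> l) / 2 \<or> M = (\<delta> l - \<delta> i) / 2"
    using sheet_sign_cases[of i]
  proof
    assume "sheet_sign d i = 1"
    then show ?thesis using sM by simp
  next
    assume "sheet_sign d i = -1"
    then have "M = - ((\<delta> l - \<delta> i) / 2)" using sM by (metis minus_minus mult_minus1)
    then show ?thesis by simp
  qed
  ultimately show ?thesis using i l by blast
qed

text \<open>The bound \<open>d - 2\<close> makes the differential holomorphic at infinity, so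
  \<open>res = 0\<close> and the two primitives are linked without a logarithm. Otherwise
  \<open>|Re G|\<close> would be unbounded on the sphere.\<close>

lemma imaginary_periods_imp_zero:
  assumes q: "degree q \<le> d - 2"
    and per: "\<And>k. k + 2 < 2*d \<Longrightarrow> Re (period d \<theta> \<rho> k (\<lambda>t. poly q t / inner_sqrt d e t) (\<lambda>t. poly q t / outer_sqrt d e t)) = 0"
  shows "q = 0"
proof -
  define S where "S = cut_sqrt (2*d) (\<lambda>i. inverse (e i))"
  have S_nz: "S z \<noteq> 0" if "z \<in> V" for z using that cut_sqrt_nonzero by (simp add: S_def)
  have S_hol: "S holomorphic_on V" by (simp add: S_def holomorphic_cut_sqrt)
  define q' where "q' = poly (reverse_poly (d-2) q)"
  define g where "g z = - q' z / S z" for z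
  have q'_hol: "q' holomorphic_on A" for A unfolding q'_def by (intro holomorphic_intros)
  have g_hol: "g holomorphic_on V" unfolding g_def
    by (intro holomorphic_intros q'_hol S_hol S_nz)
  have fi_hol: "(\<lambda>t. poly q t / inner_sqrt d e t) holomorphic_on U"
    by (intro holomorphic_intros holomorphic_inner_sqrt) (use inner_sqrt_nonzero in auto)
  have out: "poly q t / outer_sqrt d e t = 0 / t - g (inverse t) / t\<^sup>2" if t: "t \<noteq> 0" "inverse t \<in> V" for t
  proof -
    obtain m where m: "d = m + 2" using d_ge le_Suc_ex by (metis add.commute)
    have pw: "t ^ d = t ^ (d - 2) * t\<^sup>2"
      by (simp add: m power2_eq_square mult_ac)
    have "poly q t = t ^ (d - 2) * q' (inverse t)"
      unfolding q'_def using poly_reverse_poly[OF q t(1)] .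
    then show ?thesis unfolding outer_sqrt_eq S_def[symmetric] pw g_def using t by simp
  qed
  obtain G K \<delta> where G: "\<And>t. t \<in> U \<Longrightarrow> (G has_field_derivative poly q t / inner_sqrt d e t) (at t)"
    and K: "\<And>z. z \<in> V \<Longrightarrow> (K has_field_derivative g z) (at z)"
    and GK0: "\<And>k w. \<lbrakk>k < 2*d; w \<in> strip d e k\<rbrakk> \<Longrightarrow> G (exp w) = sheet_sign d k * (0 * w + K (exp (- w))) + \<delta> k"
    and \<delta>0: "\<delta> 0 = 0" "\<delta> (Suc 0) = 0"
    and \<delta>: "\<And>k. k + 2 < 2*d \<Longrightarrow> \<delta> (k + 2) = \<delta> k + period d \<theta> \<rho> k (\<lambda>t. poly q t / inner_sqrt d e t) (\<lambda>t. poly q t / outer_sqrt d e t)"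
    by (rule normalized_primitives[OF fi_hol g_hol out quotient_crosses_strip[of _ _ "poly q"]]) blast+
  have GK: "G (exp w) = sheet_sign d k * K (exp (- w)) + \<delta> k" if "k < 2*d" "w \<in> strip d e k" for k w
    using GK0[OF that] by simp
  have Re\<delta>: "Re (\<delta> k) = 0" if "k < 2*d" for k
    using that
  proof (induction k rule: less_induct)
    case (less k)
    show ?case
    proof (cases "k < 2")
      case True
      then have "k = 0 \<or> k = Suc 0" by auto
      then show ?thesis using \<delta>0 by auto
    next
      case False
      then have "k = (k - 2) + 2" by simp
      then show ?thesis using \<delta>[of "k-2"] per[of "k-2"] less.IH[of "k-2"] less.prems by simp
    qed
  qed
  have cG: "continuous_on U (\<lambda>t. \<bar>Re (G t)\<bar>)"
    using G DERIV_isCont by (intro continuous_intros continuous_at_imp_continuous_on) blast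
  have cK: "continuous_on V (\<lambda>t. \<bar>Re (K t)\<bar>)"
    using K DERIV_isCont by (intro continuous_intros continuous_at_imp_continuous_on) blast
  \<comment> \<open>The sign of the branch disappears in the absolute value, and the constants
    \<open>\<delta> k\<close> are imaginary, being sums of periods.\<close>
  have agree: "\<bar>Re (G t)\<bar> = \<bar>Re (K (inverse t))\<bar>" if t: "t \<in> U" "t \<noteq> 0" "inverse t \<in> V" for t
  proof -
    obtain k w where kw: "k < 2*d" "w \<in> strip d e k" "t = exp w" using strip_cover[OF t] by blast
    have "G t = sheet_sign d k * K (inverse t) + \<delta> k" using GK[OF kw(1,2)] by (simp add: kw(3) exp_minus)
    then show ?thesis using sheet_sign_cases[of k] Re\<delta>[OF kw(1)] by auto
  qed
  have lims: "((\<lambda>t. \<bar>Re (G t)\<bar>) \<longlongrightarrow> 0) (at (e i) within U) \<and> ((\<lambda>z. \<bar>Re (K z)\<bar>) \<longlongrightarrow> 0) (at (inverse (e i)) within V)"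
    if i: "i < 2*d" for i
  proof -
    have "\<exists>L. (G \<longlongrightarrow> L) (at (e i) within U)"
    proof (rule primitive_tendsto_branch_point[OF i])
      show "(0::real) < 1" by simp
      show "(\<lambda>t. poly q t / (\<Prod>i<2*d. csqrt (e i))) holomorphic_on ball (e i) 1"
        using prod_csqrt_nonzero by (intro holomorphic_intros) auto
      show "(\<lambda>t. 0) holomorphic_on ball (e i) 1" by simp
      fix t assume "t \<in> U \<inter> ball (e i) 1"
      then show "(G has_field_derivative poly q t / (\<Prod>i<2*d. csqrt (e i)) / cut_sqrt (2*d) e t + 0) (at t)"
        using G[of t] by (simp add: inner_sqrt_eq)
    qed
    then obtain L where L: "(G \<longlongrightarrow> L) (at (e i) within U)" by blast
    have "\<exists>L. (K \<longlongrightarrow> L) (at (inverse (e i)) within V)"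
    proof (rule inv.primitive_tendsto_branch_point[OF i])
      show "(0::real) < 1" by simp
      show "(\<lambda>z. - q' z) holomorphic_on ball (inverse (e i)) 1" by (intro holomorphic_intros q'_hol)
      show "(\<lambda>t. 0) holomorphic_on ball (inverse (e i)) 1" by simp
      fix z assume "z \<in> V \<inter> ball (inverse (e i)) 1"
      then show "(K has_field_derivative - q' z / cut_sqrt (2*d) (\<lambda>i. inverse (e i)) z + 0) (at z)"
        using K[of z] by (simp add: g_def S_def)
    qed
    then obtain M where M: "(K \<longlongrightarrow> M) (at (inverse (e i)) within V)" by blast
    from crossing_limits[OF GK i L M] obtain k l where kl: "k < 2*d" "l < 2*d" "L = (\<delta> k + \<delta> l) / 2"
      "M = (\<delta> k - \<delta> l) / 2 \<or> M = (\<delta> l - \<delta> k) / 2" by blast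
    have "Re ((\<delta> k + \<delta> l) / 2) = 0" "Re ((\<delta> k - \<delta> l) / 2) = 0" "Re ((\<delta> l - \<delta> k) / 2) = 0"
      using Re\<delta>[OF kl(1)] Re\<delta>[OF kl(2)] by simp_all
    then have "Re L = 0" "Re M = 0" using kl(3,4) by metis+
    then show ?thesis
      using tendsto_rabs[OF tendsto_Re[OF L]] tendsto_rabs[OF tendsto_Re[OF M]] by simp
  qed
  obtain M1 where M1: "\<And>t. \<lbrakk>t \<in> U; cmod t \<le> 1\<rbrakk> \<Longrightarrow> \<bar>Re (G t)\<bar> \<le> M1"
    "\<And>z. \<lbrakk>z \<in> V; cmod z \<ge> 1\<rbrakk> \<Longrightarrow> \<bar>Re (K z)\<bar> \<le> M1"
    "M1 = 0 \<or> (\<exists>t\<in>U. \<bar>Re (G t)\<bar> = M1) \<or> (\<exists>z\<in>V. \<bar>Re (K z)\<bar> = M1)"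
    using glued_function_attains_sup[OF cG cK agree] lims by blast
  have agree': "\<bar>Re (K z)\<bar> = \<bar>Re (G (inverse z))\<bar>" if "z \<in> V" "z \<noteq> 0" "inverse z \<in> U" for z
    using agree[of "inverse z"] that by simp
  \<comment> \<open>The other half of the sphere, with inner and outer domain exchanged.\<close>
  obtain M2 where M2: "\<And>z. \<lbrakk>z \<in> V; cmod z \<le> 1\<rbrakk> \<Longrightarrow> \<bar>Re (K z)\<bar> \<le> M2"
    "\<And>t. \<lbrakk>t \<in> U; cmod t \<ge> 1\<rbrakk> \<Longrightarrow> \<bar>Re (G t)\<bar> \<le> M2"
    "M2 = 0 \<or> (\<exists>z\<in>V. \<bar>Re (K z)\<bar> = M2) \<or> (\<exists>t\<in>U. \<bar>Re (G t)\<bar> = M2)"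
    using inv.glued_function_attains_sup[of "\<lambda>z. \<bar>Re (K z)\<bar>" "\<lambda>t. \<bar>Re (G t)\<bar>", unfolded inverse_inverse_eq, OF cK cG agree'] lims
    by blast
  define M where "M = max M1 M2"
  have bG: "\<bar>Re (G t)\<bar> \<le> M" if "t \<in> U" for t
    using M1(1)[OF that] M2(2)[OF that] by (cases "cmod t \<le> 1") (auto simp: M_def)
  have bK: "\<bar>Re (K z)\<bar> \<le> M" if "z \<in> V" for z
    using M2(1)[OF that] M1(2)[OF that] by (cases "cmod z \<le> 1") (auto simp: M_def)
  have G_case: "q = 0" if t: "t \<in> U" "\<bar>Re (G t)\<bar> = M" for t
  proof -
    have "poly q s / inner_sqrt d e s = 0" if s: "s \<in> U" for s
      by (rule Re_max_imp_derivative_zero[OF G open_cut_plane connected_cut_plane t(1) _ s]) (use bG t(2) in auto)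
    then have "poly q s = poly 0 s" if "s \<in> U" for s
      using inner_sqrt_nonzero[OF that] that by (metis divide_eq_0_iff poly_0)
    then show ?thesis by (rule poly_eq_on_cut_plane)
  qed
  have K_case: "q = 0" if z: "z \<in> V" "\<bar>Re (K z)\<bar> = M" for z
  proof -
    have "g s = 0" if s: "s \<in> V" for s
      by (rule Re_max_imp_derivative_zero[OF K open_cut_plane connected_cut_plane z(1) _ s]) (use bK z(2) in auto)
    then have "poly (reverse_poly (d-2) q) s = poly 0 s" if "s \<in> V" for s
      using S_nz[OF that] that unfolding g_def q'_def by (metis divide_eq_0_iff neg_equal_0_iff_equal poly_0)
    then have "reverse_poly (d-2) q = 0" by (rule poly_eq_on_cut_plane)
    then have "poly q t = 0" if "t \<noteq> 0" for t using poly_reverse_poly[OF q that] by simp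
    then have "- {0} \<subseteq> {t. poly q t = 0}" by auto
    moreover have "infinite (- {0 :: complex})"
      using infinite_UNIV_char_0[where 'a = complex] by (simp add: Compl_eq_Diff_UNIV)
    ultimately have "infinite {t. poly q t = 0}" using finite_subset by blast
    then show ?thesis using poly_roots_finite by metis
  qed
  consider "M = 0" | "\<exists>t\<in>U. \<bar>Re (G t)\<bar> = M" | "\<exists>z\<in>V. \<bar>Re (K z)\<bar> = M"
    using M1(3) M2(3) unfolding M_def by (cases "M1 \<le> M2") auto
  then show ?thesis
  proof cases
    case 1
    \<comment> \<open>The value 0 may have been found at a branch point, which lies in neither
      domain. Then \<open>Re G\<close> vanishes throughout \<open>U\<close> and the origin serves as
      the maximum point.\<close>
    then have "\<bar>Re (G 0)\<bar> = M" using bG[OF zero_in_cut_plane] by simp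
    then show ?thesis using G_case zero_in_cut_plane by metis
  qed (use G_case K_case in blast)+
qed

end

section \<open>Differentials with vanishing periods\<close>

context distinct_directions
begin

text \<open>The singular part of the primitive is \<open>- c / S\<close> with
  \<open>c = 2 * \<Phi> (a i)\<close>, where \<open>S\<close> is the square root. The derivative of
  \<open>G + c / S\<close> is again holomorphic over \<open>S\<close>, so this sum has a limit at
  \<open>a i\<close>, and \<open>G * S\<close> tends to \<open>- c\<close>.\<close>

lemma primitive_times_cut_sqrt_tendsto:
  assumes i: "i < n" and r: "r > 0" and \<Phi>: "\<Phi> holomorphic_on ball (a i) r"
    and G: "\<And>t. t \<in> cut_plane n a \<inter> ball (a i) r \<Longrightarrow>
      (G has_field_derivative \<Phi> t / (t - a i) / cut_sqrt n a t) (at t)"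
  shows "\<exists>L. ((\<lambda>t. G t * cut_sqrt n a t) \<longlongrightarrow> L) (at (a i) within cut_plane n a)"
proof -
  define S where "S = cut_sqrt n a"
  have ai: "a i \<noteq> 0" using nonzero i by blast
  define Q1 where "Q1 t = - (\<Prod>j\<in>{..<n}-{i}. 1 - t / a j) / a i" for t
  have S2: "(S t)\<^sup>2 = (t - a i) * Q1 t" for t
  proof -
    have "(S t)\<^sup>2 = (1 - t / a i) * (\<Prod>j\<in>{..<n}-{i}. 1 - t / a j)"
      unfolding S_def cut_sqrt_power2 using i by (subst prod.remove[of _ i]) auto
    then show ?thesis using ai by (simp add: Q1_def field_simps)
  qed
  have Q1_hol: "Q1 holomorphic_on A" for A unfolding Q1_def divide_inverse by (intro holomorphic_intros)
  have "1 - a i / a j \<noteq> 0" if "j \<in> {..<n} - {i}" for j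
    using distinct[of i j] i that nonzero by auto
  then have "Q1 (a i) \<noteq> 0" using ai by (simp add: Q1_def)
  moreover have "isCont Q1 (a i)"
    using Q1_hol[of UNIV] holomorphic_on_imp_continuous_on continuous_on_eq_continuous_at by blast
  ultimately obtain r1 where r1: "r1 > 0" "\<And>t. t \<in> ball (a i) r1 \<Longrightarrow> Q1 t \<noteq> 0"
    using continuous_at_avoid[of "a i" Q1 0] by (auto simp: dist_commute)
  define r2 where "r2 = min r r1"
  have r2: "r2 > 0" "ball (a i) r2 \<subseteq> ball (a i) r" "ball (a i) r2 \<subseteq> ball (a i) r1" using r r1 by (auto simp: r2_def)
  define v where "v t = (if t = a i then deriv \<Phi> (a i) else (\<Phi> t - \<Phi> (a i)) / (t - a i))" for t
  have v_hol: "v holomorphic_on ball (a i) r2"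
    unfolding v_def by (rule holomorphic_on_subset[OF pole_lemma[OF \<Phi>]]) (use r r2 in auto)
  define c where "c = 2 * \<Phi> (a i)"
  define F where "F t = v t - \<Phi> (a i) * (deriv Q1 t / Q1 t)" for t
  have F_hol: "F holomorphic_on ball (a i) r2" unfolding F_def
    by (intro holomorphic_intros v_hol Q1_hol holomorphic_on_subset[OF holomorphic_deriv[OF Q1_hol open_UNIV]])
      (use r1 r2 in auto)
  have "\<exists>L. ((\<lambda>t. G t + c / S t) \<longlongrightarrow> L) (at (a i) within cut_plane n a)"
  proof (rule primitive_tendsto_branch_point[OF i r2(1) F_hol])
    show "(\<lambda>t. 0) holomorphic_on ball (a i) r2" by simp
    fix t assume t: "t \<in> cut_plane n a \<inter> ball (a i) r2"
    have S0: "S t \<noteq> 0" using cut_sqrt_nonzero t by (auto simp: S_def)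
    then have nz: "t - a i \<noteq> 0" "Q1 t \<noteq> 0" using S2[of t] by auto
    have dS: "(S has_field_derivative deriv S t) (at t)"
      using holomorphic_cut_sqrt[of n a] t open_cut_plane unfolding S_def
      by (intro holomorphic_derivI[of _ "cut_plane n a"]) auto
    \<comment> \<open>Differentiating the identity \<open>S^2 = (t - a i) * Q1\<close> gives the
      logarithmic derivative of \<open>S\<close> without expanding the product of the
      \<open>csqrt\<close>.\<close>
    have "((\<lambda>t. (S t)\<^sup>2) has_field_derivative 2 * S t * deriv S t) (at t)"
      by (auto intro!: derivative_eq_intros dS)
    moreover have "((\<lambda>t. (t - a i) * Q1 t) has_field_derivative Q1 t + (t - a i) * deriv Q1 t) (at t)"
      using holomorphic_derivI[OF Q1_hol open_UNIV, of t] by (auto intro!: derivative_eq_intros)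
    ultimately have dd: "2 * S t * deriv S t = Q1 t + (t - a i) * deriv Q1 t"
      unfolding S2 by (rule DERIV_unique)
    have "deriv S t / S t = 2 * S t * deriv S t / (2 * (S t)\<^sup>2)" using S0 by (simp add: power2_eq_square)
    also have "\<dots> = (Q1 t + (t - a i) * deriv Q1 t) / (2 * ((t - a i) * Q1 t))" unfolding S2 dd ..
    also have "\<dots> = (1 / (t - a i) + deriv Q1 t / Q1 t) / 2" using nz by (simp add: field_simps)
    finally have q: "deriv S t / S t = (1 / (t - a i) + deriv Q1 t / Q1 t) / 2" .
    have "((\<lambda>t. G t + c / S t) has_field_derivative \<Phi> t / (t - a i) / S t - c * deriv S t / (S t)\<^sup>2) (at t)"
      using G[of t] t r2(2) S0 unfolding S_def[symmetric]
      by (auto intro!: derivative_eq_intros dS simp: power2_eq_square)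
    moreover have "\<Phi> t / (t - a i) / S t - c * deriv S t / (S t)\<^sup>2 = F t / S t + 0"
    proof -
      have "c * deriv S t / (S t)\<^sup>2 = c * (deriv S t / S t) / S t" by (simp add: power2_eq_square)
      also have "\<dots> = (\<Phi> (a i) * (1 / (t - a i)) + \<Phi> (a i) * (deriv Q1 t / Q1 t)) / S t"
      proof -
        have "2 * u * ((A + B) / 2) / s = (u * A + u * B) / s" for u A B s :: complex
          by (simp add: distrib_left)
        then show ?thesis unfolding q c_def .
      qed
      finally have "\<Phi> t / (t - a i) / S t - c * deriv S t / (S t)\<^sup>2
          = (\<Phi> t / (t - a i) - \<Phi> (a i) / (t - a i) - \<Phi> (a i) * (deriv Q1 t / Q1 t)) / S t"
        by (simp add: diff_divide_distrib add_divide_distrib)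
      moreover have "v t = \<Phi> t / (t - a i) - \<Phi> (a i) / (t - a i)" using nz by (simp add: v_def diff_divide_distrib)
      ultimately show ?thesis by (simp add: F_def)
    qed
    ultimately show "((\<lambda>t. G t + c / S t) has_field_derivative F t / cut_sqrt n a t + 0) (at t)"
      by (simp add: S_def)
  qed
  then obtain L where "((\<lambda>t. G t + c / S t) \<longlongrightarrow> L) (at (a i) within cut_plane n a)" by blast
  then have "((\<lambda>t. (G t + c / S t) * S t - c) \<longlongrightarrow> L * 0 - c) (at (a i) within cut_plane n a)"
    using cut_sqrt_tendsto_0[OF i] unfolding S_def by (intro tendsto_intros) auto
  then have "((\<lambda>t. G t * S t) \<longlongrightarrow> L * 0 - c) (at (a i) within cut_plane n a)"
  proof (rule Lim_transform_within[where d = 1])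
    fix t assume "t \<in> cut_plane n a"
    then have "S t \<noteq> 0" using cut_sqrt_nonzero by (auto simp: S_def)
    then show "(G t + c / S t) * S t - c = G t * S t" by (simp add: distrib_right)
  qed simp
  then show ?thesis unfolding S_def by blast
qed

end

context root_configuration
begin

interpretation inv: distinct_directions "2*d" "\<lambda>i. inverse (e i)" by (rule inverse_directions)

text \<open>The numerator \<open>r\<close> is a tangent vector: \<open>q\<close> comes from the
  lower coefficients of \<open>p\<close>, and \<open>p x i / (2 (t - e i))\<close> from moving the
  root \<open>e i\<close> with velocity \<open>x i\<close>. Both parts decay fast enough at infinity
  for \<open>res = 0\<close>.\<close>

lemma zero_periods_imp_zero_variation:
  assumes p: "degree p \<le> d - 1" and q: "degree q \<le> d - 2"
    and J: "J \<subseteq> {..<2*d}" "card J = d - 1" "\<And>i. i \<in> J \<Longrightarrow> poly p (e i) \<noteq> 0"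
    and r: "\<And>t. r t = poly q t + poly p t / 2 * (\<Sum>i\<in>J. x i / (t - e i))"
    and per: "\<And>k. k + 2 < 2*d \<Longrightarrow> period d \<theta> \<rho> k (\<lambda>t. r t / inner_sqrt d e t) (\<lambda>t. r t / outer_sqrt d e t) = 0"
  shows "q = 0 \<and> (\<forall>i\<in>J. x i = 0)"
proof -
  have finJ: "finite J" using J(1) finite_subset by blast
  have e_inj: "e i \<noteq> e j" if "i < 2*d" "j < 2*d" "i \<noteq> j" for i j
    using distinct[OF that] root_nonzero[of j] that by auto
  define \<kappa> where "\<kappa> = (\<Prod>i<2*d. csqrt (e i))"
  have \<kappa>: "\<kappa> \<noteq> 0" using prod_csqrt_nonzero by (simp add: \<kappa>_def)
  define S where "S = cut_sqrt (2*d) (\<lambda>i. inverse (e i))"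
  have S_nz: "S z \<noteq> 0" if "z \<in> V" for z using that cut_sqrt_nonzero by (simp add: S_def)
  have S_hol: "S holomorphic_on V" by (simp add: S_def holomorphic_cut_sqrt)
  define p' q' where "p' = poly (reverse_poly (d-1) p)" and "q' = poly (reverse_poly (d-2) q)"
  define N where "N z = q' z + p' z / 2 * (\<Sum>i\<in>J. x i / (1 - e i * z))" for z
  define g where "g z = - N z / S z" for z
  have Vnz: "1 - e i * z \<noteq> 0" if "z \<in> V" "i < 2*d" for z i
    using that by (force simp: cut_plane_def field_simps)
  have Unz: "t - e i \<noteq> 0" if "t \<in> U" "i < 2*d" for t i
    using that root_nonzero[of i] by (auto simp: cut_plane_def)
  have pq_hol: "p' holomorphic_on A" "q' holomorphic_on A" for A
    unfolding p'_def q'_def by (intro holomorphic_intros)+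
  have N_hol: "N holomorphic_on V" unfolding N_def
    by (intro holomorphic_intros pq_hol) (use Vnz J in auto)
  have g_hol: "g holomorphic_on V" unfolding g_def
    by (intro holomorphic_intros N_hol S_hol S_nz)
  have r_hol: "r holomorphic_on U"
  proof -
    have "(\<lambda>t. poly q t + poly p t / 2 * (\<Sum>i\<in>J. x i / (t - e i))) holomorphic_on U"
      by (intro holomorphic_intros) (use Unz J in auto)
    then show ?thesis using r by (simp cong: holomorphic_cong)
  qed
  have fi_hol: "(\<lambda>t. r t / inner_sqrt d e t) holomorphic_on U"
    by (intro holomorphic_intros r_hol holomorphic_inner_sqrt) (use inner_sqrt_nonzero in auto)
  have out: "r t / outer_sqrt d e t = 0 / t - g (inverse t) / t\<^sup>2" if t: "t \<noteq> 0" "inverse t \<in> V" for t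
  proof -
    obtain m where m: "d = m + 2" using d_ge le_Suc_ex by (metis add.commute)
    have pw: "t ^ (d - 1) = t ^ (d - 2) * t" "t ^ d = t ^ (d - 2) * t\<^sup>2"
      by (simp_all add: m power2_eq_square mult_ac)
    have "poly q t = t ^ (d - 2) * q' (inverse t)"
      unfolding q'_def using poly_reverse_poly[OF q t(1)] .
    moreover have "poly p t / 2 * (\<Sum>i\<in>J. x i / (t - e i)) =
        t ^ (d - 2) * (p' (inverse t) / 2 * (\<Sum>i\<in>J. x i / (1 - e i * inverse t)))"
    proof -
      have "x i / (t - e i) = x i / (1 - e i * inverse t) / t" if "i \<in> J" for i
      proof -
        have "t - e i = (1 - e i * inverse t) * t" using t by (simp add: field_simps)
        then show ?thesis by (metis divide_divide_eq_left)
      qed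
      then have "(\<Sum>i\<in>J. x i / (t - e i)) = (\<Sum>i\<in>J. x i / (1 - e i * inverse t)) / t"
        unfolding sum_divide_distrib by (intro sum.cong refl)
      moreover have "poly p t = t ^ (d - 2) * t * p' (inverse t)"
        unfolding p'_def pw(1)[symmetric] using poly_reverse_poly[OF p t(1)] .
      ultimately show ?thesis using t by simp
    qed
    ultimately have "r t = t ^ (d - 2) * N (inverse t)" unfolding r N_def by (simp add: distrib_left)
    then show ?thesis unfolding outer_sqrt_eq S_def[symmetric] pw(2) g_def using t by simp
  qed
  obtain G K \<delta> where G: "\<And>t. t \<in> U \<Longrightarrow> (G has_field_derivative r t / inner_sqrt d e t) (at t)"
    and K: "\<And>z. z \<in> V \<Longrightarrow> (K has_field_derivative g z) (at z)"
    and GK: "\<And>k w. \<lbrakk>k < 2*d; w \<in> strip d e k\<rbrakk> \<Longrightarrow> G (exp w) = sheet_sign d k * (0 * w + K (exp (- w))) + \<delta> k"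
    and \<delta>0: "\<delta> 0 = 0" "\<delta> (Suc 0) = 0"
    and \<delta>: "\<And>k. k + 2 < 2*d \<Longrightarrow> \<delta> (k + 2) = \<delta> k + period d \<theta> \<rho> k (\<lambda>t. r t / inner_sqrt d e t) (\<lambda>t. r t / outer_sqrt d e t)"
    by (rule normalized_primitives[OF fi_hol g_hol out quotient_crosses_strip[of _ _ r]]) blast+
  have \<delta>_0: "\<delta> k = 0" if "k < 2*d" for k
    using that
  proof (induction k rule: less_induct)
    case (less k)
    show ?case
    proof (cases "k < 2")
      case True
      then have "k = 0 \<or> k = Suc 0" by auto
      then show ?thesis using \<delta>0 by auto
    next
      case False
      then have "k = (k - 2) + 2" by simp
      then show ?thesis using \<delta>[of "k-2"] per[of "k-2"] less.IH[of "k-2"] less.prems by simp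
    qed
  qed
  have G_hol: "G holomorphic_on U"
    using G by (meson field_differentiable_at_within field_differentiable_def holomorphic_on_def)
  have K_hol: "K holomorphic_on V"
    using K by (meson field_differentiable_at_within field_differentiable_def holomorphic_on_def)
  \<comment> \<open>This is \<open>G * sqrt D\<close>. Both factors change sign together between
    sectors, so the two expressions agree. Near infinity \<open>K * S\<close> is bounded and
    \<open>1 / z ^ d\<close> bounds the degree by \<open>d\<close>.\<close>
  define Ai where "Ai t = G t * inner_sqrt d e t" for t
  define Ao where "Ao z = K z * S z / z ^ d" for z
  have Ai_lim: "\<exists>L. (Ai \<longlongrightarrow> L) (at (e i) within U)" if i: "i < 2*d" for i
  proof -
    obtain R where R: "R > 0" "\<And>j t. j \<in> J - {i} \<Longrightarrow> t \<in> ball (e i) R \<Longrightarrow> t - e j \<noteq> 0"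
    proof -
      have "finite (e ` (J - {i}))" using finJ by simp
      then obtain R where R: "R > 0" "\<And>y. y \<in> e ` (J - {i}) \<Longrightarrow> y \<noteq> e i \<Longrightarrow> R \<le> dist (e i) y"
        using finite_set_avoid by metis
      have "t - e j \<noteq> 0" if "j \<in> J - {i}" "t \<in> ball (e i) R" for j t
      proof
        assume "t - e j = 0"
        then have "t = e j" by simp
        moreover have "e j \<noteq> e i" using e_inj[of j i] that(1) i J(1) by auto
        ultimately have "R \<le> dist (e i) t" using R(2)[of t] that(1) by simp
        then show False using that(2) by simp
      qed
      then show ?thesis by (rule that[OF R(1)])
    qed
    define c where "c = (if i \<in> J then x i else 0)"
    \<comment> \<open>Multiplying by \<open>t - e i\<close> clears the only possible pole at
      \<open>e i\<close>; for \<open>i\<close> outside \<open>J\<close> the constant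
      \<open>c\<close> is 0.\<close>
    define \<Phi> where "\<Phi> t = ((t - e i) * (poly q t + poly p t / 2 * (\<Sum>j\<in>J-{i}. x j / (t - e j))) + poly p t / 2 * c) / \<kappa>" for t
    have "\<exists>L. ((\<lambda>t. G t * cut_sqrt (2*d) e t) \<longlongrightarrow> L) (at (e i) within U)"
    proof (rule primitive_times_cut_sqrt_tendsto[OF i R(1)])
      show "\<Phi> holomorphic_on ball (e i) R" unfolding \<Phi>_def
        by (intro holomorphic_intros) (use R(2) \<kappa> in auto)
      fix t assume t: "t \<in> U \<inter> ball (e i) R"
      then have nz: "t - e i \<noteq> 0" using Unz i by auto
      have sums: "(\<Sum>j\<in>J. x j / (t - e j)) = (\<Sum>j\<in>J-{i}. x j / (t - e j)) + c / (t - e i)"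
        by (cases "i \<in> J") (auto simp: c_def sum.remove[OF finJ])
      have alg: "((y * (Q + P / 2 * u) + P / 2 * c) / k) / y * k = Q + P / 2 * (u + c / y)"
        if "y \<noteq> 0" "k \<noteq> 0" for y k Q P u :: complex
      proof -
        have "((y * (Q + P / 2 * u) + P / 2 * c) / k) / y * k = (y * (Q + P / 2 * u) + P / 2 * c) / y"
          using that(2) by simp
        also have "\<dots> = (Q + P / 2 * u) + P / 2 * c / y"
          unfolding add_divide_distrib using that(1) by simp
        finally show ?thesis by (simp add: distrib_left)
      qed
      have "r t = \<Phi> t / (t - e i) * \<kappa>"
        unfolding r \<Phi>_def sums by (rule alg[OF nz \<kappa>, symmetric])
      then have "r t / inner_sqrt d e t = \<Phi> t / (t - e i) / cut_sqrt (2*d) e t"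
        unfolding inner_sqrt_eq \<kappa>_def[symmetric] using \<kappa> by simp
      then show "(G has_field_derivative \<Phi> t / (t - e i) / cut_sqrt (2*d) e t) (at t)"
        using G[of t] t by simp
    qed
    then obtain L where "((\<lambda>t. G t * cut_sqrt (2*d) e t) \<longlongrightarrow> L) (at (e i) within U)" by blast
    then have "((\<lambda>t. \<kappa> * (G t * cut_sqrt (2*d) e t)) \<longlongrightarrow> \<kappa> * L) (at (e i) within U)" by (intro tendsto_intros)
    moreover have "(\<lambda>t. \<kappa> * (G t * cut_sqrt (2*d) e t)) = Ai"
      by (simp add: Ai_def inner_sqrt_eq \<kappa>_def fun_eq_iff)
    ultimately show ?thesis by auto
  qed
  have Ao_lim: "\<exists>L. (Ao \<longlongrightarrow> L) (at (inverse (e i)) within V)" if i: "i < 2*d" for i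
  proof -
    have ei: "e i \<noteq> 0" using root_nonzero[OF i] .
    obtain R where R: "R > 0" "\<And>j z. j \<in> J - {i} \<Longrightarrow> z \<in> ball (inverse (e i)) R \<Longrightarrow> 1 - e j * z \<noteq> 0"
    proof -
      have "finite ((\<lambda>j. inverse (e j)) ` (J - {i}))" using finJ by simp
      then obtain R where R: "R > 0" "\<And>y. y \<in> (\<lambda>j. inverse (e j)) ` (J - {i}) \<Longrightarrow> y \<noteq> inverse (e i) \<Longrightarrow> R \<le> dist (inverse (e i)) y"
        using finite_set_avoid by metis
      have "1 - e j * z \<noteq> 0" if "j \<in> J - {i}" "z \<in> ball (inverse (e i)) R" for j z
      proof
        assume "1 - e j * z = 0"
        then have "z = inverse (e j)" by (simp add: inverse_unique)
        moreover have "inverse (e j) \<noteq> inverse (e i)" using e_inj[of j i] that(1) i J(1) by auto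
        ultimately have "R \<le> dist (inverse (e i)) z" using R(2)[of z] that(1) by simp
        then show False using that(2) by simp
      qed
      then show ?thesis by (rule that[OF R(1)])
    qed
    define c where "c = (if i \<in> J then x i else 0)"
    define \<Phi> where "\<Phi> z = - ((z - inverse (e i)) * (q' z + p' z / 2 * (\<Sum>j\<in>J-{i}. x j / (1 - e j * z))) - p' z / 2 * (c / e i))" for z
    have "\<exists>L. ((\<lambda>z. K z * cut_sqrt (2*d) (\<lambda>i. inverse (e i)) z) \<longlongrightarrow> L) (at (inverse (e i)) within V)"
    proof (rule inv.primitive_times_cut_sqrt_tendsto[OF i R(1)])
      show "\<Phi> holomorphic_on ball (inverse (e i)) R" unfolding \<Phi>_def
        by (intro holomorphic_intros pq_hol) (use R(2) ei in auto)
      fix z assume z: "z \<in> V \<inter> ball (inverse (e i)) R"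
      have zi: "1 - e i * z = - e i * (z - inverse (e i))" using ei by (simp add: field_simps)
      have nz: "z - inverse (e i) \<noteq> 0" using Vnz[of z i] z i zi by auto
      have "(\<Sum>j\<in>J. x j / (1 - e j * z)) = (\<Sum>j\<in>J-{i}. x j / (1 - e j * z)) + c / (1 - e i * z)"
        by (cases "i \<in> J") (auto simp: c_def sum.remove[OF finJ])
      also have "c / (1 - e i * z) = - (c / e i) / (z - inverse (e i))"
        unfolding zi by simp
      finally have sums: "(\<Sum>j\<in>J. x j / (1 - e j * z)) = (\<Sum>j\<in>J-{i}. x j / (1 - e j * z)) + - (c / e i) / (z - inverse (e i))" .
      have "- (Q + P / 2 * (u + - m / y)) = - (y * (Q + P / 2 * u) - P / 2 * m) / y"
        if "y \<noteq> 0" for y Q P u m :: complex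
      proof -
        have "- (y * (Q + P / 2 * u) - P / 2 * m) / y = - ((y * (Q + P / 2 * u)) / y - P / 2 * m / y)"
          by (simp only: minus_divide_left[symmetric] diff_divide_distrib)
        also have "\<dots> = - ((Q + P / 2 * u) - P / 2 * m / y)" using that by simp
        also have "(Q + P / 2 * u) - P / 2 * m / y = Q + P / 2 * (u + - m / y)"
          by (simp add: right_diff_distrib diff_divide_distrib)
        finally show ?thesis by (rule sym)
      qed
      then have "- N z = \<Phi> z / (z - inverse (e i))"
        unfolding N_def \<Phi>_def sums using nz by blast
      then have "g z = \<Phi> z / (z - inverse (e i)) / S z" unfolding g_def by simp
      then show "(K has_field_derivative \<Phi> z / (z - inverse (e i)) / cut_sqrt (2*d) (\<lambda>i. inverse (e i)) z) (at z)"
        using K[of z] z by (simp add: S_def)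
    qed
    then obtain L where "((\<lambda>z. K z * S z) \<longlongrightarrow> L) (at (inverse (e i)) within V)" unfolding S_def by blast
    then have "((\<lambda>z. K z * S z / z ^ d) \<longlongrightarrow> L / inverse (e i) ^ d) (at (inverse (e i)) within V)"
      using ei by (intro tendsto_intros) auto
    then show ?thesis unfolding Ao_def by blast
  qed
  obtain C R where C: "R > 0" "\<And>z. cmod z < R \<Longrightarrow> cmod (K z * S z) \<le> C"
  proof -
    obtain R where R: "R > 0" "cball 0 R \<subseteq> V" using open_cut_plane zero_in_cut_plane open_contains_cball by blast
    have "continuous_on (cball 0 R) (\<lambda>z. K z * S z)"
      using R(2) K_hol S_hol by (intro continuous_intros) (auto intro: continuous_on_subset holomorphic_on_imp_continuous_on)
    then have "bounded ((\<lambda>z. K z * S z) ` cball 0 R)" by (intro compact_imp_bounded compact_continuous_image) auto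
    then obtain C where C: "\<forall>y\<in>(\<lambda>z. K z * S z) ` cball 0 R. cmod y \<le> C" unfolding bounded_iff by metis
    show ?thesis
    proof (rule that[OF R(1)])
      fix z :: complex assume "cmod z < R"
      then show "cmod (K z * S z) \<le> C" using C by simp
    qed
  qed
  obtain P where P: "degree P \<le> d" "\<And>t. t \<in> U \<Longrightarrow> poly P t = Ai t"
    "\<And>i. i < 2*d \<Longrightarrow> (Ai \<longlongrightarrow> poly P (e i)) (at (e i) within U)"
  proof (rule polynomial_of_glued_function[where A\<^sub>i = Ai and A\<^sub>o = Ao and r = R and C = C and m = d])
    show "Ai holomorphic_on U" unfolding Ai_def by (intro holomorphic_intros G_hol holomorphic_inner_sqrt)
    show "Ao holomorphic_on V - {0}" unfolding Ao_def
      by (intro holomorphic_intros holomorphic_on_subset[OF K_hol] holomorphic_on_subset[OF S_hol]) auto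
    show "Ai t = Ao (inverse t)" if t: "t \<in> U" "t \<noteq> 0" "inverse t \<in> V" for t
    proof -
      obtain k w where kw: "k < 2*d" "w \<in> strip d e k" "t = exp w" using strip_cover[OF t] by blast
      have "Ai t = (sheet_sign d k * K (inverse t)) * (sheet_sign d k * outer_sqrt d e t)"
        unfolding Ai_def kw(3) using GK[OF kw(1,2)] \<delta>_0[OF kw(1)] inner_sqrt_strip[OF kw(2,1)] by (simp add: exp_minus)
      also have "\<dots> = K (inverse t) * outer_sqrt d e t" using sheet_sign_cases[of k] by auto
      finally show ?thesis unfolding outer_sqrt_eq Ao_def S_def by (simp add: field_simps power_inverse)
    qed
    show "((\<lambda>t. (t - e i) * Ai t) \<longlongrightarrow> 0) (at (e i) within U)" if i: "i < 2*d" for i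
    proof -
      obtain L where L: "(Ai \<longlongrightarrow> L) (at (e i) within U)" using Ai_lim[OF i] by blast
      have "((\<lambda>t. (t - e i) * Ai t) \<longlongrightarrow> (e i - e i) * L) (at (e i) within U)" by (intro tendsto_intros L)
      then show ?thesis by simp
    qed
    show "((\<lambda>z. (z - inverse (e i)) * Ao z) \<longlongrightarrow> 0) (at (inverse (e i)) within V)" if i: "i < 2*d" for i
    proof -
      obtain L where L: "(Ao \<longlongrightarrow> L) (at (inverse (e i)) within V)" using Ao_lim[OF i] by blast
      have "((\<lambda>z. (z - inverse (e i)) * Ao z) \<longlongrightarrow> (inverse (e i) - inverse (e i)) * L) (at (inverse (e i)) within V)"
        by (intro tendsto_intros L)
      then show ?thesis by simp
    qed
    show "cmod (Ao z) \<le> C / cmod z ^ d" if "z \<noteq> 0" "cmod z < R" for z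
      using C(2)[OF that(2)] by (simp add: Ao_def norm_divide norm_power divide_right_mono)
  qed (use C in auto)
  \<comment> \<open>At an unvaried root the differential has no pole besides the square root, so
    \<open>G\<close> has a finite limit there while \<open>sqrt D\<close> tends to 0.\<close>
  have P0: "poly P (e i) = 0" if i: "i \<in> {..<2*d} - J" for i
  proof -
    have i2: "i < 2*d" using i by simp
    obtain R where R: "R > 0" "\<And>j t. j \<in> J \<Longrightarrow> t \<in> ball (e i) R \<Longrightarrow> t - e j \<noteq> 0"
    proof -
      have "finite (e ` J)" using finJ by simp
      then obtain R where R: "R > 0" "\<And>y. y \<in> e ` J \<Longrightarrow> y \<noteq> e i \<Longrightarrow> R \<le> dist (e i) y"
        using finite_set_avoid by metis
      have "t - e j \<noteq> 0" if "j \<in> J" "t \<in> ball (e i) R" for j t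
      proof
        assume "t - e j = 0"
        then have "t = e j" by simp
        moreover have "e j \<noteq> e i" using e_inj[of j i] that(1) i J(1) by auto
        ultimately have "R \<le> dist (e i) t" using R(2)[of t] that(1) by simp
        then show False using that(2) by simp
      qed
      then show ?thesis by (rule that[OF R(1)])
    qed
    have "\<exists>L. (G \<longlongrightarrow> L) (at (e i) within U)"
    proof (rule primitive_tendsto_branch_point[OF i2 R(1)])
      have "(\<lambda>t. poly q t + poly p t / 2 * (\<Sum>i\<in>J. x i / (t - e i))) holomorphic_on ball (e i) R"
        by (intro holomorphic_intros) (use R(2) in auto)
      then have "r holomorphic_on ball (e i) R" using r by (simp cong: holomorphic_cong)
      then show "(\<lambda>t. r t / \<kappa>) holomorphic_on ball (e i) R" by (intro holomorphic_intros) (use \<kappa> in auto)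
      show "(\<lambda>t. 0) holomorphic_on ball (e i) R" by simp
      fix t assume "t \<in> U \<inter> ball (e i) R"
      then show "(G has_field_derivative r t / \<kappa> / cut_sqrt (2*d) e t + 0) (at t)"
        using G[of t] by (simp add: inner_sqrt_eq \<kappa>_def)
    qed
    then obtain L where L: "(G \<longlongrightarrow> L) (at (e i) within U)" by blast
    have "((\<lambda>t. G t * (\<kappa> * cut_sqrt (2*d) e t)) \<longlongrightarrow> L * (\<kappa> * 0)) (at (e i) within U)"
      by (intro tendsto_intros L cut_sqrt_tendsto_0 i2)
    moreover have "(\<lambda>t. G t * (\<kappa> * cut_sqrt (2*d) e t)) = Ai"
      by (simp add: Ai_def inner_sqrt_eq \<kappa>_def fun_eq_iff)
    ultimately have "(Ai \<longlongrightarrow> 0) (at (e i) within U)" by simp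
    \<comment> \<open>Uniqueness of the limit requires \<open>e i\<close> to be a limit point of
      \<open>U\<close>: the points \<open>s * e i\<close> with \<open>0 < s < 1\<close> lie in
      \<open>U\<close> and approach it.\<close>
    moreover have "at (e i) within U \<noteq> bot"
    proof -
      have "e i islimpt U"
        unfolding islimpt_approachable
      proof (intro allI impI)
        fix \<epsilon> :: real assume \<epsilon>: "\<epsilon> > 0"
        define s where "s = max (1/2) (1 - \<epsilon> / (2 * cmod (e i)))"
        have ei: "e i \<noteq> 0" using root_nonzero i2 by blast
        have s: "0 < s" "s < 1" "1 - s \<le> \<epsilon> / (2 * cmod (e i))" using \<epsilon> ei by (auto simp: s_def)
        have "of_real s * e i \<in> U"
          unfolding cut_plane_def
        proof (intro CollectI allI impI notI)
          fix j assume j: "j < 2*d" and np: "1 - of_real s * e i / e j \<in> \<real>\<^sub>\<le>\<^sub>0"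
          show False
          proof (cases "j = i")
            case True
            then have "1 - complex_of_real s \<in> \<real>\<^sub>\<le>\<^sub>0" using np ei by simp
            then show False using s by (auto simp: complex_nonpos_Reals_iff)
          next
            case False
            define y where "y = e i / e j"
            have "1 - of_real s * y \<in> \<real>\<^sub>\<le>\<^sub>0" using np by (simp add: y_def)
            then have sy: "s * Re y \<ge> 1" "s * Im y = 0" by (auto simp: complex_nonpos_Reals_iff)
            have "Re y \<ge> 0"
            proof (rule ccontr)
              assume "\<not> Re y \<ge> 0"
              then have "s * Re y < 0" using s by (simp add: mult_pos_neg)
              then show False using sy by simp
            qed
            moreover have "Im y = 0" using sy s by simp
            ultimately have "y \<in> \<real>\<^sub>\<ge>\<^sub>0" by (simp add: complex_nonneg_Reals_iff)
            then show False using distinct[of i j] False i2 j by (auto simp: y_def)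
          qed
        qed
        moreover have "of_real s * e i \<noteq> e i" using s ei by simp
        moreover have "dist (of_real s * e i) (e i) < \<epsilon>"
        proof -
          have "of_real s * e i - e i = of_real (s - 1) * e i" by (simp add: algebra_simps)
          then have "dist (of_real s * e i) (e i) = (1 - s) * cmod (e i)"
            unfolding dist_norm using s by (simp only: norm_mult norm_of_real) simp
          also have "\<dots> \<le> \<epsilon> / (2 * cmod (e i)) * cmod (e i)" using s(3) by (intro mult_right_mono) auto
          also have "\<dots> < \<epsilon>" using ei \<epsilon> by simp
          finally show ?thesis .
        qed
        ultimately show "\<exists>x'\<in>U. x' \<noteq> e i \<and> dist x' (e i) < \<epsilon>" by blast
      qed
      then show ?thesis by (simp add: trivial_limit_within)
    qed
    ultimately show ?thesis using P(3)[OF i2] tendsto_unique by blast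
  qed
  \<comment> \<open>There are \<open>2d - (d - 1) = d + 1\<close> zeros against a degree of at most
    \<open>d\<close>.\<close>
  have "P = 0"
  proof (rule ccontr)
    assume "P \<noteq> 0"
    then have fin: "finite {t. poly P t = 0}" and "card {t. poly P t = 0} \<le> degree P"
      using poly_roots_finite poly_roots_degree by auto
    moreover have "card (e ` ({..<2*d} - J)) \<le> card {t. poly P t = 0}"
      using P0 fin by (intro card_mono) auto
    moreover have "card (e ` ({..<2*d} - J)) = card ({..<2*d} - J)"
      using e_inj by (intro card_image inj_onI) (metis DiffD1 lessThan_iff)
    moreover have "card ({..<2*d} - J) = 2*d - (d - 1)" using J finJ by (simp add: card_Diff_subset)
    ultimately show False using P(1) d_ge by linarith
  qed
  then have G0: "G t = 0" if "t \<in> U" for t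
    using P(2)[OF that] inner_sqrt_nonzero[OF that] by (simp add: Ai_def)
  have r0: "r t = 0" if t: "t \<in> U" for t
  proof -
    have "((\<lambda>t. 0) has_field_derivative r t / inner_sqrt d e t) (at t)"
      by (rule has_field_derivative_transform_within_open[OF G[OF t] open_cut_plane t]) (use G0 in auto)
    then have "r t / inner_sqrt d e t = 0" using DERIV_unique DERIV_const by blast
    then show ?thesis using inner_sqrt_nonzero[OF t] by simp
  qed
  \<comment> \<open>Clearing denominators turns \<open>r = 0\<close> into a polynomial identity. At
    \<open>e i\<close> with \<open>i \<in> J\<close> only the \<open>i\<close>-th term survives, and
    \<open>poly p (e i) \<noteq> 0\<close> gives \<open>x i = 0\<close>.\<close>
  define W where "W = (\<Prod>i\<in>J. [:- e i, 1:])"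
  define Wi where "Wi i = (\<Prod>j\<in>J-{i}. [:- e j, 1:])" for i
  have W: "poly W t = (t - e i) * poly (Wi i) t" if "i \<in> J" for t i
    unfolding W_def Wi_def using that finJ by (simp add: prod.remove left_diff_distrib)
  have eq: "W * q + [:1/2:] * (p * (\<Sum>i\<in>J. [:x i:] * Wi i)) = 0"
  proof (rule poly_eq_on_cut_plane)
    fix t assume t: "t \<in> U"
    have "poly W t * (\<Sum>i\<in>J. x i / (t - e i)) = (\<Sum>i\<in>J. x i * poly (Wi i) t)"
      unfolding sum_distrib_left
    proof (rule sum.cong)
      fix i assume i: "i \<in> J"
      then have "t - e i \<noteq> 0" using Unz t J(1) by auto
      then show "poly W t * (x i / (t - e i)) = x i * poly (Wi i) t" unfolding W[OF i] by simp
    qed simp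
    then have "poly (W * q + [:1/2:] * (p * (\<Sum>i\<in>J. [:x i:] * Wi i))) t = poly W t * r t"
      unfolding r by (simp add: poly_sum algebra_simps)
    then show "poly (W * q + [:1/2:] * (p * (\<Sum>i\<in>J. [:x i:] * Wi i))) t = poly 0 t"
      using r0[OF t] by simp
  qed
  have x0: "x i = 0" if i: "i \<in> J" for i
  proof -
    have "poly (W * q + [:1/2:] * (p * (\<Sum>j\<in>J. [:x j:] * Wi j))) (e i) = 0" unfolding eq by simp
    moreover have "poly W (e i) = 0" using W[OF i] by simp
    ultimately have "poly p (e i) * (\<Sum>j\<in>J. x j * poly (Wi j) (e i)) = 0" by (simp add: poly_sum)
    then have "(\<Sum>j\<in>J. x j * poly (Wi j) (e i)) = 0" using J(3)[OF i] by simp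
    moreover have "(\<Sum>j\<in>J. x j * poly (Wi j) (e i)) = x i * poly (Wi i) (e i)"
    proof -
      have "poly (Wi j) (e i) = 0" if "j \<in> J - {i}" for j
        unfolding Wi_def poly_prod using that i finJ by (intro prod_zero) auto
      then show ?thesis using i finJ by (subst sum.remove[OF finJ i]) simp
    qed
    moreover have "poly (Wi i) (e i) \<noteq> 0"
      unfolding Wi_def poly_prod using e_inj i J(1) finJ by (auto simp: subset_iff)
    ultimately show ?thesis by simp
  qed
  then have "W * q = 0" using eq by simp
  moreover have "W \<noteq> 0" unfolding W_def using finJ by simp
  ultimately show ?thesis using x0 by simp
qed

end

section \<open>Commensurable periods and the Pell equation\<close>

context root_configuration
begin

interpretation inv: distinct_directions "2*d" "\<lambda>i. inverse (e i)" by (rule inverse_directions)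

text \<open>The outer primitive is \<open>log t + K (1 / t)\<close>. After multiplication by
  \<open>n\<close> and exponentiation, its multivaluedness and the constants
  \<open>\<delta> k\<close> disappear. What remains is the sign of the branch: cosh is even, and
  \<open>sinh / sqrt D\<close> is a quotient of two odd quantities.\<close>

lemma pellian_of_commensurable_periods:
  assumes p: "degree p = d - 1" "lead_coeff p = 1" and n: "n > 0"
    and per: "\<And>k. k + 2 < 2*d \<Longrightarrow> \<exists>m::int. of_nat n * period d \<theta> \<rho> k
      (\<lambda>t. poly p t / inner_sqrt d e t) (\<lambda>t. poly p t / outer_sqrt d e t) = 2 * of_real pi * \<i> * of_int m"
  shows "pellian (\<Prod>i<2*d. [:- e i, 1:])"
proof -
  define p' where "p' = poly (reverse_poly (d-1) p)"
  define S where "S = cut_sqrt (2*d) (\<lambda>i. inverse (e i))"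
  define f where "f z = - p' z / S z" for z
  \<comment> \<open>Subtracting the value \<open>f 0 = -1\<close> removes the simple pole at
    infinity, so that \<open>K\<close> is holomorphic at 0. The monic normalization of
    \<open>p\<close> enters through this value.\<close>
  define g where "g z = (if z = 0 then deriv f 0 else (f z - f 0) / (z - 0))" for z
  have S_nz: "S z \<noteq> 0" if "z \<in> V" for z using that cut_sqrt_nonzero by (simp add: S_def)
  have S_hol: "S holomorphic_on V" by (simp add: S_def holomorphic_cut_sqrt)
  have p'_hol: "p' holomorphic_on A" for A unfolding p'_def by (intro holomorphic_intros)
  have f_hol: "f holomorphic_on V" unfolding f_def
    by (intro holomorphic_intros S_hol p'_hol) (use S_nz in auto)
  have f0: "f 0 = -1"
    using p by (simp add: f_def p'_def S_def poly_reverse_poly_0 cut_sqrt_at_0)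
  have V0: "0 \<in> V" by (rule zero_in_cut_plane)
  have g_hol: "g holomorphic_on V"
    unfolding g_def using pole_lemma[OF f_hol, of 0] V0 open_cut_plane by (simp add: interior_open)
  have g_eq: "g z = (1 - p' z / S z) / z" if "z \<noteq> 0" for z
    using that f0 by (simp add: g_def f_def)
  define f\<^sub>i where "f\<^sub>i t = poly p t / inner_sqrt d e t" for t
  define f\<^sub>o where "f\<^sub>o t = poly p t / outer_sqrt d e t" for t
  have fi_hol: "f\<^sub>i holomorphic_on U" unfolding f\<^sub>i_def
    by (intro holomorphic_intros holomorphic_inner_sqrt) (use inner_sqrt_nonzero in auto)
  have out: "f\<^sub>o t = 1 / t - g (inverse t) / t\<^sup>2" if t: "t \<noteq> 0" "inverse t \<in> V" for t
  proof -
    have "t ^ d = t ^ (d - 1) * t" using d_ge by (metis power_minus_mult not_numeral_le_zero gr0I)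
    then have "f\<^sub>o t = p' (inverse t) / (t * S (inverse t))"
      unfolding f\<^sub>o_def outer_sqrt_eq S_def[symmetric] p'_def
      using poly_reverse_poly[of p "d-1" t] p t by simp
    moreover have "g (inverse t) / t\<^sup>2 = (1 - p' (inverse t) / S (inverse t)) / t"
      using t by (simp add: g_eq power2_eq_square)
    ultimately show ?thesis by (simp add: diff_divide_distrib mult.commute)
  qed
  have cross: "f\<^sub>i (exp w) = sheet_sign d k * f\<^sub>o (exp w)" if "k < 2*d" "w \<in> strip d e k" for k w
    unfolding f\<^sub>i_def f\<^sub>o_def using quotient_crosses_strip[OF that, of "poly p"] .
  obtain G K \<delta> where G: "\<And>t. t \<in> U \<Longrightarrow> (G has_field_derivative f\<^sub>i t) (at t)"
    and K: "\<And>z. z \<in> V \<Longrightarrow> (K has_field_derivative g z) (at z)"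
    and GK: "\<And>k w. \<lbrakk>k < 2*d; w \<in> strip d e k\<rbrakk> \<Longrightarrow> G (exp w) = sheet_sign d k * (1 * w + K (exp (- w))) + \<delta> k"
    and \<delta>0: "\<delta> 0 = 0" "\<delta> (Suc 0) = 0"
    and \<delta>: "\<And>k. k + 2 < 2*d \<Longrightarrow> \<delta> (k + 2) = \<delta> k + period d \<theta> \<rho> k f\<^sub>i f\<^sub>o"
    by (rule normalized_primitives[OF fi_hol g_hol out cross]) blast+
  have exp\<delta>: "exp (of_nat n * \<delta> k) = 1" if "k < 2*d" for k
    using that
  proof (induction k rule: less_induct)
    case (less k)
    show ?case
    proof (cases "k < 2")
      case True
      then have "k = 0 \<or> k = Suc 0" by auto
      then show ?thesis using \<delta>0 by auto
    next
      case False
      define k' where "k' = k - 2"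
      have k': "k = k' + 2" using False by (simp add: k'_def)
      obtain m :: int where "of_nat n * period d \<theta> \<rho> k' f\<^sub>i f\<^sub>o = 2 * of_real pi * \<i> * of_int m"
        using per[of k'] less.prems k' unfolding f\<^sub>i_def f\<^sub>o_def by auto
      then have "of_nat n * \<delta> k = of_nat n * \<delta> k' + 2 * of_real pi * \<i> * of_int m"
        using \<delta>[of k'] less.prems k' by (simp add: distrib_left)
      moreover have "exp (2 * of_real pi * \<i> * of_int m) = (1::complex)"
        using exp_integer_2pi[of "of_int m"] by (simp add: mult_ac)
      ultimately show ?thesis using less.IH[of k'] less.prems k' by (simp add: exp_add)
    qed
  qed
  define E where "E z = exp (of_nat n * K z)" for z
  define X where "X w = of_nat n * (w + K (exp (- w)))" for w
  have expG: "exp (of_nat n * G (exp w)) = exp (sheet_sign d k * X w)" if "k < 2*d" "w \<in> strip d e k" for k w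
  proof -
    have "of_nat n * G (exp w) = sheet_sign d k * X w + of_nat n * \<delta> k"
      using GK[OF that] by (simp add: X_def algebra_simps)
    then show ?thesis using exp\<delta>[OF that(1)] by (simp add: exp_add)
  qed
  \<comment> \<open>Here the integrality of \<open>n\<close> matters: \<open>exp (n w)\<close> is
    the power \<open>t ^ n\<close>, which depends on \<open>exp w\<close> only.\<close>
  have XE: "exp (X w) = E (exp (- w)) / exp (- w) ^ n" for w
    by (simp add: X_def E_def distrib_left exp_add exp_of_nat_mult exp_of_nat2_mult exp_minus field_simps power_inverse)
  have G_lim: "\<exists>L. (G \<longlongrightarrow> L) (at (e i) within U)" if i: "i < 2*d" for i
  proof (rule primitive_tendsto_branch_point[OF i])
    show "(0::real) < 1" by simp
    show "(\<lambda>t. poly p t / (\<Prod>i<2*d. csqrt (e i))) holomorphic_on ball (e i) 1"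
      using prod_csqrt_nonzero by (intro holomorphic_intros) auto
    show "(\<lambda>t. 0) holomorphic_on ball (e i) 1" by simp
    fix t assume "t \<in> U \<inter> ball (e i) 1"
    then show "(G has_field_derivative poly p t / (\<Prod>i<2*d. csqrt (e i)) / cut_sqrt (2*d) e t + 0) (at t)"
      using G[of t] by (simp add: f\<^sub>i_def inner_sqrt_eq)
  qed
  have K_lim: "\<exists>L. (K \<longlongrightarrow> L) (at (inverse (e i)) within V)" if i: "i < 2*d" for i
  proof (rule inv.primitive_tendsto_branch_point[OF i])
    have ei: "e i \<noteq> 0" using root_nonzero[OF i] .
    show "cmod (inverse (e i)) > 0" using ei by simp
    have nz: "z \<noteq> 0" if "z \<in> ball (inverse (e i)) (cmod (inverse (e i)))" for z
      using that by (auto simp: dist_norm)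
    show "(\<lambda>z. - p' z / z) holomorphic_on ball (inverse (e i)) (cmod (inverse (e i)))"
      by (intro holomorphic_intros p'_hol nz)
    \<comment> \<open>The subtracted pole is a summand without square root, which is why the limit
      lemma allows a second function \<open>F1\<close>. The radius of the disc keeps
      \<open>z = 0\<close> out.\<close>
    show "(\<lambda>z. 1 / z) holomorphic_on ball (inverse (e i)) (cmod (inverse (e i)))"
      by (intro holomorphic_intros nz)
    fix z assume z: "z \<in> V \<inter> ball (inverse (e i)) (cmod (inverse (e i)))"
    have "- p' z / z / S z + 1 / z = g z"
      using g_eq[of z] nz[of z] z S_nz[of z] by (simp add: field_simps)
    then show "(K has_field_derivative - p' z / z / cut_sqrt (2*d) (\<lambda>i. inverse (e i)) z + 1 / z) (at z)"
      using K[of z] z by (simp add: S_def)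
  qed
  have K_hol: "K holomorphic_on V"
    using K by (meson field_differentiable_at_within field_differentiable_def holomorphic_on_def)
  have G_hol: "G holomorphic_on U"
    using G by (meson field_differentiable_at_within field_differentiable_def holomorphic_on_def)
  have E_hol: "E holomorphic_on V" unfolding E_def by (intro holomorphic_intros K_hol)
  have E_nz: "E z \<noteq> 0" for z by (simp add: E_def)
  have E_lim: "\<exists>L. L \<noteq> 0 \<and> (E \<longlongrightarrow> L) (at (inverse (e i)) within V)" if i: "i < 2*d" for i
  proof -
    obtain L where "(K \<longlongrightarrow> L) (at (inverse (e i)) within V)" using K_lim[OF i] by blast
    then have "(E \<longlongrightarrow> exp (of_nat n * L)) (at (inverse (e i)) within V)"
      unfolding E_def by (intro tendsto_intros)
    then show ?thesis by (intro exI[of _ "exp (of_nat n * L)"]) auto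
  qed
  \<comment> \<open>In the outer coordinate \<open>exp (n G)\<close> becomes
    \<open>E z / z ^ n\<close> or its inverse, and \<open>z ^ d / S z\<close> is
    \<open>1 / sqrt D\<close>; so \<open>Ao\<close> and \<open>Bo\<close> are the same hyperbolic
    functions as \<open>Ai\<close> and \<open>Bi\<close>.\<close>
  define Ai where "Ai t = (exp (of_nat n * G t) + exp (- (of_nat n * G t))) / 2" for t
  define Ao where "Ao z = (E z / z ^ n + z ^ n / E z) / 2" for z
  define Bi where "Bi t = (exp (of_nat n * G t) - exp (- (of_nat n * G t))) / 2 / inner_sqrt d e t" for t
  define Bo where "Bo z = (E z / z ^ n - z ^ n / E z) / 2 * (z ^ d / S z)" for z
  \<comment> \<open>One bound for three functions near infinity, with \<open>r \<le> 1\<close> so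
    that positive powers of \<open>z\<close> have modulus at most 1.\<close>
  have "\<exists>r>0. \<exists>M>0. r \<le> 1 \<and> (\<forall>z. cmod z < r \<longrightarrow> cmod (E z) \<le> M \<and> cmod (1 / E z) \<le> M \<and> cmod (1 / S z) \<le> M)"
  proof -
    obtain r where r: "r > 0" "cball 0 r \<subseteq> V" using open_cut_plane V0 open_contains_cball by blast
    have bd: "\<exists>M>0. \<forall>z\<in>cball 0 r. cmod (h z) \<le> M" if "h holomorphic_on V" for h
    proof -
      have "continuous_on (cball 0 r) h"
        using that r(2) holomorphic_on_imp_continuous_on continuous_on_subset by blast
      then have "bounded (h ` cball 0 r)" by (intro compact_imp_bounded compact_continuous_image) auto
      then show ?thesis by (auto simp: bounded_pos)
    qed
    have h: "(\<lambda>z. 1 / E z) holomorphic_on V" "(\<lambda>z. 1 / S z) holomorphic_on V"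
      by (intro holomorphic_intros E_hol S_hol E_nz S_nz; assumption)+
    obtain M1 where M1: "M1 > 0" "\<And>z. z \<in> cball 0 r \<Longrightarrow> cmod (E z) \<le> M1" using bd[OF E_hol] by blast
    obtain M2 where M2: "M2 > 0" "\<And>z. z \<in> cball 0 r \<Longrightarrow> cmod (1 / E z) \<le> M2" using bd[OF h(1)] by blast
    obtain M3 where M3: "M3 > 0" "\<And>z. z \<in> cball 0 r \<Longrightarrow> cmod (1 / S z) \<le> M3" using bd[OF h(2)] by blast
    show ?thesis
    proof (rule exI[of _ "min r 1"], rule conjI, use r in simp, rule exI[of _ "M1 + M2 + M3"], intro conjI allI impI)
      fix z :: complex assume "cmod z < min r 1"
      then have z: "z \<in> cball 0 r" by simp
      show "cmod (E z) \<le> M1 + M2 + M3" using M1(2)[OF z] M2(1) M3(1) by linarith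
      show "cmod (1 / E z) \<le> M1 + M2 + M3" using M2(2)[OF z] M1(1) M3(1) by linarith
      show "cmod (1 / S z) \<le> M1 + M2 + M3" using M3(2)[OF z] M1(1) M2(1) by linarith
    qed (use M1 M2 M3 in auto)
  qed
  then obtain r M where r: "r > 0" "r \<le> 1" and M: "M > 0"
    and bd: "\<And>z. cmod z < r \<Longrightarrow> cmod (E z) \<le> M" "\<And>z. cmod z < r \<Longrightarrow> cmod (1 / E z) \<le> M"
      "\<And>z. cmod z < r \<Longrightarrow> cmod (1 / S z) \<le> M"
    by blast
  have half_growth: "cmod ((E z / z ^ n) / 2) \<le> M / 2 / cmod z ^ n" "cmod ((z ^ n / E z) / 2) \<le> M / 2 / cmod z ^ n"
    if z: "z \<noteq> 0" "cmod z < r" for z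
  proof -
    show "cmod ((E z / z ^ n) / 2) \<le> M / 2 / cmod z ^ n"
      using divide_right_mono[OF bd(1)[OF z(2)], of "2 * cmod z ^ n"] by (simp add: norm_divide norm_power mult.commute)
    have z1: "cmod z ^ n \<le> 1" using z r by (intro power_le_one) auto
    have "cmod ((z ^ n / E z) / 2) = cmod z ^ n * cmod (1 / E z) / 2" by (simp add: norm_divide norm_power)
    also have "\<dots> \<le> 1 * M / 2"
      using z1 bd(2)[OF z(2)] by (intro divide_right_mono mult_mono) auto
    also have "\<dots> \<le> M / 2 / cmod z ^ n"
      using z1 M z by (simp add: field_simps mult_le_cancel_left)
    finally show "cmod ((z ^ n / E z) / 2) \<le> M / 2 / cmod z ^ n" .
  qed
  obtain A where A: "\<And>t. t \<in> U \<Longrightarrow> poly A t = Ai t"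
  proof (rule polynomial_of_glued_function[where A\<^sub>i = Ai and A\<^sub>o = Ao and r = r and C = M and m = n])
    show "Ai holomorphic_on U" unfolding Ai_def by (intro holomorphic_intros G_hol) auto
    show "Ao holomorphic_on V - {0}" unfolding Ao_def
      by (intro holomorphic_intros holomorphic_on_subset[OF E_hol]) (use E_nz in auto)
    show "Ai t = Ao (inverse t)" if t: "t \<in> U" "t \<noteq> 0" "inverse t \<in> V" for t
    proof -
      obtain k w where kw: "k < 2*d" "w \<in> strip d e k" "t = exp w" using strip_cover[OF t] by blast
      have "Ao (inverse t) = (exp (X w) + exp (- X w)) / 2"
        unfolding kw(3) by (simp add: Ao_def XE exp_minus)
      moreover have "Ai t = (exp (sheet_sign d k * X w) + exp (- (sheet_sign d k * X w))) / 2"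
        unfolding Ai_def kw(3) exp_minus expG[OF kw(1,2)] ..
      moreover have "exp (sheet_sign d k * X w) + exp (- (sheet_sign d k * X w)) = exp (X w) + exp (- X w)"
        using sheet_sign_cases[of k] by (elim disjE) (simp_all add: add.commute)
      ultimately show ?thesis by (simp only:)
    qed
    show "((\<lambda>t. (t - e i) * Ai t) \<longlongrightarrow> 0) (at (e i) within U)" if i: "i < 2*d" for i
    proof -
      obtain L where L: "(G \<longlongrightarrow> L) (at (e i) within U)" using G_lim[OF i] by blast
      have "((\<lambda>t. (t - e i) * Ai t) \<longlongrightarrow> (e i - e i) * ((exp (of_nat n * L) + exp (- (of_nat n * L))) / 2)) (at (e i) within U)"
        unfolding Ai_def by (intro tendsto_intros L) auto
      then show ?thesis by simp
    qed
    show "((\<lambda>z. (z - inverse (e i)) * Ao z) \<longlongrightarrow> 0) (at (inverse (e i)) within V)" if i: "i < 2*d" for i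
    proof -
      obtain L where L: "L \<noteq> 0" "(E \<longlongrightarrow> L) (at (inverse (e i)) within V)" using E_lim[OF i] by blast
      have "((\<lambda>z. (z - inverse (e i)) * Ao z) \<longlongrightarrow> (inverse (e i) - inverse (e i)) *
          ((L / inverse (e i) ^ n + inverse (e i) ^ n / L) / 2)) (at (inverse (e i)) within V)"
        unfolding Ao_def using L(1) root_nonzero[OF i] by (intro tendsto_intros L(2)) auto
      then show ?thesis by simp
    qed
    show "cmod (Ao z) \<le> M / cmod z ^ n" if "z \<noteq> 0" "cmod z < r" for z
    proof -
      have "Ao z = (E z / z ^ n) / 2 + (z ^ n / E z) / 2" by (simp add: Ao_def add_divide_distrib)
      then have "cmod (Ao z) \<le> M / 2 / cmod z ^ n + M / 2 / cmod z ^ n"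
        using half_growth[OF that] norm_triangle_mono by metis
      then show ?thesis by (simp add: field_simps)
    qed
  qed (use r in auto)
  obtain B where B: "\<And>t. t \<in> U \<Longrightarrow> poly B t = Bi t"
  proof (rule polynomial_of_glued_function[where A\<^sub>i = Bi and A\<^sub>o = Bo and r = r and C = "M * M" and m = n])
    show "Bi holomorphic_on U" unfolding Bi_def
      by (intro holomorphic_intros G_hol holomorphic_inner_sqrt) (use inner_sqrt_nonzero in auto)
    show "Bo holomorphic_on V - {0}" unfolding Bo_def
      by (intro holomorphic_intros holomorphic_on_subset[OF E_hol] holomorphic_on_subset[OF S_hol])
        (use E_nz S_nz in auto)
    show "Bi t = Bo (inverse t)" if t: "t \<in> U" "t \<noteq> 0" "inverse t \<in> V" for t
    proof -
      obtain k w where kw: "k < 2*d" "w \<in> strip d e k" "t = exp w" using strip_cover[OF t] by blast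
      have "Bo (inverse t) = (exp (X w) - exp (- X w)) / 2 / outer_sqrt d e t"
        unfolding kw(3) outer_sqrt_eq S_def[symmetric]
        by (simp add: Bo_def XE exp_minus power_inverse field_simps)
      moreover have "Bi t = (exp (sheet_sign d k * X w) - exp (- (sheet_sign d k * X w))) / 2 /
          (sheet_sign d k * outer_sqrt d e t)"
        unfolding Bi_def kw(3) exp_minus expG[OF kw(1,2)] inner_sqrt_strip[OF kw(2,1)] ..
      moreover have "exp (sheet_sign d k * X w) - exp (- (sheet_sign d k * X w)) = sheet_sign d k * (exp (X w) - exp (- X w))"
        using sheet_sign_cases[of k] by (elim disjE) simp_all
      moreover have "sheet_sign d k \<noteq> 0" using sheet_sign_cases[of k] by (elim disjE) simp_all
      ultimately show ?thesis by simp
    qed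
    show "((\<lambda>t. (t - e i) * Bi t) \<longlongrightarrow> 0) (at (e i) within U)" if i: "i < 2*d" for i
    proof -
      obtain L where L: "(G \<longlongrightarrow> L) (at (e i) within U)" using G_lim[OF i] by blast
      \<comment> \<open>The factor \<open>sinh (n G)\<close> has a finite limit at
        \<open>e i\<close>, and \<open>(t - e i) / sqrt D\<close> tends to 0 there.\<close>
      have "((\<lambda>t. ((t - e i) / cut_sqrt (2*d) e t) / (\<Prod>i<2*d. csqrt (e i)) * ((exp (of_nat n * G t) - exp (- (of_nat n * G t))) / 2))
          \<longlongrightarrow> 0 / (\<Prod>i<2*d. csqrt (e i)) * ((exp (of_nat n * L) - exp (- (of_nat n * L))) / 2)) (at (e i) within U)"
        using prod_csqrt_nonzero by (intro tendsto_intros L diff_over_cut_sqrt_tendsto_0[OF i]) auto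
      moreover have "(\<lambda>t. ((t - e i) / cut_sqrt (2*d) e t) / (\<Prod>i<2*d. csqrt (e i)) * ((exp (of_nat n * G t) - exp (- (of_nat n * G t))) / 2))
          = (\<lambda>t. (t - e i) * Bi t)"
        by (simp add: Bi_def inner_sqrt_eq fun_eq_iff mult_ac)
      ultimately show ?thesis by simp
    qed
    show "((\<lambda>z. (z - inverse (e i)) * Bo z) \<longlongrightarrow> 0) (at (inverse (e i)) within V)" if i: "i < 2*d" for i
    proof -
      obtain L where L: "L \<noteq> 0" "(E \<longlongrightarrow> L) (at (inverse (e i)) within V)" using E_lim[OF i] by blast
      have "((\<lambda>z. (z - inverse (e i)) / S z * (z ^ d * ((E z / z ^ n - z ^ n / E z) / 2))) \<longlongrightarrow> 0 *
          (inverse (e i) ^ d * ((L / inverse (e i) ^ n - inverse (e i) ^ n / L) / 2))) (at (inverse (e i)) within V)"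
        unfolding S_def using L(1) root_nonzero[OF i]
        by (intro tendsto_intros L(2) inv.diff_over_cut_sqrt_tendsto_0[OF i]) auto
      moreover have "(\<lambda>z. (z - inverse (e i)) / S z * (z ^ d * ((E z / z ^ n - z ^ n / E z) / 2))) = (\<lambda>z. (z - inverse (e i)) * Bo z)"
        by (simp add: Bo_def fun_eq_iff mult_ac)
      ultimately show ?thesis by simp
    qed
    show "cmod (Bo z) \<le> M * M / cmod z ^ n" if z: "z \<noteq> 0" "cmod z < r" for z
    proof -
      define Y where "Y = (E z / z ^ n) / 2 - (z ^ n / E z) / 2"
      have "cmod Y \<le> M / 2 / cmod z ^ n + M / 2 / cmod z ^ n"
        unfolding Y_def using half_growth[OF z] norm_triangle_ineq4 add_mono order_trans by metis
      then have Y: "cmod Y \<le> M / cmod z ^ n" by (simp add: field_simps)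
      have "cmod (z ^ d) \<le> 1" unfolding norm_power using z r by (intro power_le_one) auto
      then have zS: "cmod (z ^ d) * cmod (1 / S z) \<le> 1 * M"
        using bd(3)[OF z(2)] by (intro mult_mono) auto
      have "Bo z = Y * (z ^ d * (1 / S z))" by (simp add: Bo_def Y_def diff_divide_distrib)
      then have "cmod (Bo z) = cmod Y * (cmod (z ^ d) * cmod (1 / S z))" by (simp only: norm_mult)
      also have "\<dots> \<le> (M / cmod z ^ n) * (1 * M)"
        by (rule mult_mono[OF Y zS]) (use M in auto)
      finally show ?thesis by simp
    qed
  qed (use r in auto)
  define D where "D = (\<Prod>i<2*d. [:- e i, 1:])"
  have D: "poly D t = (\<Prod>i<2*d. t - e i)" for t by (simp add: D_def poly_prod)
  have "A\<^sup>2 - D * B\<^sup>2 = 1"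
  proof (rule poly_eq_on_cut_plane)
    fix t assume t: "t \<in> U"
    define x y R where "x = exp (of_nat n * G t)" and "y = exp (- (of_nat n * G t))" and "R = inner_sqrt d e t"
    have xy: "x * y = 1" by (simp add: x_def y_def exp_minus)
    have R: "R \<noteq> 0" using inner_sqrt_nonzero[OF t] by (simp add: R_def)
    have "poly (A\<^sup>2 - D * B\<^sup>2) t = ((x + y) / 2)\<^sup>2 - R\<^sup>2 * ((x - y) / 2 / R)\<^sup>2"
      by (simp only: poly_diff poly_mult poly_power A[OF t] B[OF t] D inner_sqrt_power2[symmetric]
          Ai_def Bi_def x_def y_def R_def)
    also have "\<dots> = x * y" using R by (simp add: power2_eq_square field_simps)
    finally show "poly (A\<^sup>2 - D * B\<^sup>2) t = poly 1 t" using xy by simp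
  qed
  \<comment> \<open>If \<open>B = 0\<close>, then \<open>exp (2 n G) = 1\<close> throughout
    \<open>U\<close>, so \<open>G\<close> has derivative 0 and \<open>p = 0\<close>, which is not
    monic.\<close>
  moreover have "B \<noteq> 0"
  proof
    assume B0: "B = 0"
    have "poly p t = 0" if t: "t \<in> U" for t
    proof -
      have "exp (2 * of_nat n * G s) = 1" if s: "s \<in> U" for s
      proof -
        have "exp (of_nat n * G s) = exp (- (of_nat n * G s))"
          using B[OF s] B0 inner_sqrt_nonzero[OF s] by (simp add: Bi_def)
        then have "exp (of_nat n * G s) * exp (of_nat n * G s) = 1"
          by (metis exp_minus_inverse)
        then show ?thesis by (simp add: exp_add[symmetric] mult_ac)
      qed
      moreover have "((\<lambda>s. exp (2 * of_nat n * G s)) has_field_derivative exp (2 * of_nat n * G t) * (2 * of_nat n * f\<^sub>i t)) (at t)"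
        by (auto intro!: derivative_eq_intros G[OF t])
      ultimately have "((\<lambda>s. 1) has_field_derivative 2 * of_nat n * f\<^sub>i t) (at t)"
        using has_field_derivative_transform_within_open[OF _ open_cut_plane t, of "\<lambda>s. exp (2 * of_nat n * G s)" _ "\<lambda>s. 1"] t
        by simp
      then have "2 * of_nat n * f\<^sub>i t = 0" using DERIV_unique DERIV_const by blast
      then show ?thesis using n inner_sqrt_nonzero[OF t] by (simp add: f\<^sub>i_def)
    qed
    then have "p = 0" using poly_eq_on_cut_plane[of "2*d" e p 0] by simp
    then show False using p by simp
  qed
  ultimately show ?thesis unfolding pellian_def D_def by blast
qed

end

section \<open>Dependence of integrals on the roots and coefficients\<close>

text \<open>The parameter \<open>v j\<close> with \<open>j < m\<close> displaces the root with index
  \<open>\<iota> j\<close>. Written as a sum, the displacement is 0 for unmoved roots and needs no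
  inverse of \<open>\<iota>\<close>; for injective \<open>\<iota>\<close> at most one term is
  nonzero.\<close>

definition moved_root :: "nat \<Rightarrow> (nat \<Rightarrow> nat) \<Rightarrow> (nat \<Rightarrow> complex) \<Rightarrow> (nat \<Rightarrow> complex) \<Rightarrow> nat \<Rightarrow> complex" where
  "moved_root m \<iota> e v i = e i + (\<Sum>j<m. if \<iota> j = i then v j else 0)"

text \<open>The parameters from \<open>m\<close> to \<open>2 * m - 1\<close> change the coefficients
  below degree \<open>m\<close>. With \<open>m = d - 1\<close> the leading coefficient, and hence
  the residue at infinity, is preserved.\<close>

definition moved_poly :: "nat \<Rightarrow> complex poly \<Rightarrow> (nat \<Rightarrow> complex) \<Rightarrow> complex poly" where
  "moved_poly m p v = p + (\<Sum>j<m. monom (v (m + j)) j)"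

text \<open>The numerator of the derivative of \<open>p/\<surd>D\<close> with respect to the \<open>j\<close>-th parameter.\<close>

definition variation :: "nat \<Rightarrow> (nat \<Rightarrow> nat) \<Rightarrow> (nat \<Rightarrow> complex) \<Rightarrow> complex poly \<Rightarrow> nat \<Rightarrow> (nat \<Rightarrow> complex) \<Rightarrow> complex \<Rightarrow> complex" where
  "variation m \<iota> e p j v t =
     (if j < m then poly (moved_poly m p v) t / (2 * (t - moved_root m \<iota> e v (\<iota> j))) else t ^ (j - m))"

text \<open>A basic neighbourhood in the product topology restricts finitely many coordinates, so
  the minimum of their radii works. This links topological continuity with the coordinatewise bounds
  of the Newton iteration.\<close>

lemma open_fun_contains_ball:
  fixes A :: "(nat \<Rightarrow> complex) set"
  assumes "open A" "(\<lambda>_. 0) \<in> A"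
  shows "\<exists>\<delta>>0. \<forall>v. (\<forall>i. cmod (v i) < \<delta>) \<longrightarrow> v \<in> A"
proof -
  have "openin (product_topology (\<lambda>i. euclidean) UNIV) A" using assms(1) by (simp add: open_fun_def)
  from product_topology_open_contains_basis[OF this assms(2)]
  obtain X where X: "(\<lambda>_. 0) \<in> Pi\<^sub>E UNIV X" "\<And>i. openin euclidean (X i)"
    "finite {i. X i \<noteq> topspace euclidean}" "Pi\<^sub>E UNIV X \<subseteq> A"
    by metis
  have X2: "open (X i)" for i by (rule open_openin[THEN iffD2, OF X(2)])
  have X3: "finite {i. X i \<noteq> UNIV}" using X(3) unfolding topspace_euclidean .
  have "\<forall>i. \<exists>\<delta>>0. ball 0 \<delta> \<subseteq> X i"
    using X(1) X2 open_contains_ball by (metis PiE_mem UNIV_I)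
  then obtain D where D: "\<And>i. D i > 0" "\<And>i. ball 0 (D i) \<subseteq> X i" by metis
  define \<delta> where "\<delta> = Min (insert 1 (D ` {i. X i \<noteq> UNIV}))"
  have "\<delta> > 0" unfolding \<delta>_def using D(1) X3 by (subst Min_gr_iff) auto
  moreover have "v \<in> A" if v: "\<forall>i. cmod (v i) < \<delta>" for v
  proof -
    have "v i \<in> X i" for i
    proof (cases "X i = UNIV")
      case False
      then have "\<delta> \<le> D i" unfolding \<delta>_def using X3 by (intro Min_le) auto
      then have "v i \<in> ball 0 (D i)" using v by (auto intro: less_le_trans)
      then show ?thesis using D(2) by blast
    qed simp
    then show ?thesis using X(4) by auto
  qed
  ultimately show ?thesis by blast
qed

text \<open>A common frame for the two radial integrals and the arc integral of a period. The factor
  of the square root that belongs to the root \<open>c\<close> is \<open>\<beta> c t\<close>; in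
  either normalization its logarithmic derivative in \<open>c\<close> is
  \<open>1 / (2 (c - t))\<close>. The path is \<open>\<gamma>\<close>, and \<open>\<omega>\<close>
  collects its derivative and whatever does not depend on the parameters.\<close>

locale parametric_integral =
  fixes m n :: nat and \<iota> :: "nat \<Rightarrow> nat" and e :: "nat \<Rightarrow> complex" and p :: "complex poly" and r :: real
    and \<gamma> \<omega> :: "real \<Rightarrow> complex" and \<beta> :: "complex \<Rightarrow> complex \<Rightarrow> complex"
  assumes r_pos: "r > 0" and \<iota>: "inj_on \<iota> {..<m}" "\<iota> ` {..<m} \<subseteq> {..<n}"
    and \<gamma>: "continuous_on {0..1} \<gamma>" and \<omega>: "continuous_on {0..1} \<omega>"
    and \<beta>_nonzero: "\<lbrakk>i < n; c \<in> ball (e i) r; s \<in> {0..1}\<rbrakk> \<Longrightarrow> \<beta> c (\<gamma> s) \<noteq> 0 \<and> c \<noteq> \<gamma> s"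
    and \<beta>_deriv: "\<lbrakk>i < n; c \<in> ball (e i) r; s \<in> {0..1}\<rbrakk> \<Longrightarrow>
      ((\<lambda>c. \<beta> c (\<gamma> s)) has_field_derivative \<beta> c (\<gamma> s) / (2 * (c - \<gamma> s))) (at c)"
    and \<beta>_cont: "i < n \<Longrightarrow> continuous_on (ball (e i) r \<times> {0..1}) (\<lambda>(c, s). \<beta> c (\<gamma> s))"
begin

abbreviation "X \<equiv> {v :: nat \<Rightarrow> complex. \<forall>i. cmod (v i) < r}"
abbreviation "E \<equiv> moved_root m \<iota> e"
abbreviation "P \<equiv> moved_poly m p"

lemma moved_root_sum: "j < m \<Longrightarrow> E v (\<iota> j) = e (\<iota> j) + v j"
proof -
  assume j: "j < m"
  have "(\<Sum>l<m. if \<iota> l = \<iota> j then v l else 0) = (\<Sum>l<m. if l = j then v l else 0)"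
    using \<iota>(1) j by (intro sum.cong) (auto simp: inj_on_def)
  then show ?thesis using j by (simp add: moved_root_def)
qed

lemma moved_root_other: "i \<notin> \<iota> ` {..<m} \<Longrightarrow> E v i = e i"
  by (auto simp: moved_root_def intro!: sum.neutral)

lemma moved_root_in_ball: "v \<in> X \<Longrightarrow> E v i \<in> ball (e i) r"
  using moved_root_sum[of _ v] moved_root_other[of i v] r_pos
  by (cases "i \<in> \<iota> ` {..<m}") (auto simp: dist_norm)

lemma moved_root_upd_same: "j < m \<Longrightarrow> E (v(j := z)) (\<iota> j) = E v (\<iota> j) + (z - v j)"
  by (simp add: moved_root_sum)

lemma moved_root_upd_other: "i \<noteq> \<iota> j \<or> j \<ge> m \<Longrightarrow> E (v(j := z)) i = E v i"
  unfolding moved_root_def by (intro arg_cong2[where f = "(+)"] refl sum.cong) auto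

lemma moved_poly_upd: "j < m \<Longrightarrow> P (v(j := z)) = P v"
  unfolding moved_poly_def by (intro arg_cong2[where f = "(+)"] refl sum.cong) auto

lemma poly_moved_poly: "poly (P v) t = poly p t + (\<Sum>l<m. v (m + l) * t ^ l)"
  by (simp add: moved_poly_def poly_sum poly_monom)

lemma poly_moved_poly_upd:
  assumes "m \<le> j" "j < 2*m"
  shows "poly (P (v(j := z))) t = poly (P v) t + (z - v j) * t ^ (j - m)"
proof -
  have "(\<Sum>l<m. (v(j := z)) (m + l) * t ^ l) = (\<Sum>l<m. v (m + l) * t ^ l + (if l = j - m then (z - v j) * t ^ l else 0))"
    using assms by (intro sum.cong) (auto simp: algebra_simps)
  also have "\<dots> = (\<Sum>l<m. v (m + l) * t ^ l) + (z - v j) * t ^ (j - m)"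
    using assms less_diff_conv2[OF assms(1), of m] by (simp add: sum.distrib)
  finally show ?thesis by (simp add: poly_moved_poly)
qed

definition F where "F v s = poly (P v) (\<gamma> s) / (\<Prod>i<n. \<beta> (E v i) (\<gamma> s)) * \<omega> s"

definition DF where "DF j v s = variation m \<iota> e p j v (\<gamma> s) / (\<Prod>i<n. \<beta> (E v i) (\<gamma> s)) * \<omega> s"

text \<open>For a root parameter, \<open>1 / \<beta>\<close> contributes the factor
  \<open>- 1 / (2 (c - \<gamma> s))\<close>, which is the pole in \<open>variation\<close>; a
  coefficient parameter enters linearly.\<close>

lemma F_deriv:
  assumes v: "v \<in> X" and j: "j < 2*m" and s: "s \<in> {0..1}"
  shows "((\<lambda>z. F (v(j := z)) s) has_field_derivative DF j v s) (at (v j))"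
proof (cases "j < m")
  case True
  define i where "i = \<iota> j"
  have i: "i < n" using True \<iota>(2) by (auto simp: i_def)
  define c where "c = E v i"
  have c: "c \<in> ball (e i) r" using moved_root_in_ball[OF v] by (simp add: c_def)
  define B where "B = (\<Prod>l\<in>{..<n}-{i}. \<beta> (E v l) (\<gamma> s))"
  have prodB: "(\<Prod>l<n. \<beta> (E (v(j := z)) l) (\<gamma> s)) = \<beta> (c + (z - v j)) (\<gamma> s) * B" for z
  proof -
    have "(\<Prod>l<n. \<beta> (E (v(j := z)) l) (\<gamma> s)) = \<beta> (E (v(j := z)) i) (\<gamma> s) * (\<Prod>l\<in>{..<n}-{i}. \<beta> (E (v(j := z)) l) (\<gamma> s))"
      using i by (subst prod.remove[of _ i]) auto
    also have "(\<Prod>l\<in>{..<n}-{i}. \<beta> (E (v(j := z)) l) (\<gamma> s)) = B"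
      unfolding B_def by (intro prod.cong) (auto simp: moved_root_upd_other i_def)
    also have "E (v(j := z)) i = c + (z - v j)" using moved_root_upd_same[OF True] by (simp add: i_def c_def)
    finally show ?thesis .
  qed
  have prodB0: "(\<Prod>l<n. \<beta> (E v l) (\<gamma> s)) = \<beta> c (\<gamma> s) * B" using prodB[of "v j"] by simp
  have nz: "\<beta> c (\<gamma> s) \<noteq> 0" "c \<noteq> \<gamma> s" using \<beta>_nonzero[OF i c s] by auto
  have B: "B \<noteq> 0" unfolding B_def using \<beta>_nonzero[OF _ moved_root_in_ball[OF v] s] by auto
  define C where "C = poly (P v) (\<gamma> s) * \<omega> s / B"
  have "((\<lambda>z. \<beta> (c + (z - v j)) (\<gamma> s)) has_field_derivative \<beta> c (\<gamma> s) / (2 * (c - \<gamma> s)) * 1) (at (v j))"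
  proof (rule DERIV_chain2[where g = "\<lambda>z. c + (z - v j)"])
    show "((\<lambda>c. \<beta> c (\<gamma> s)) has_field_derivative \<beta> c (\<gamma> s) / (2 * (c - \<gamma> s))) (at (c + (v j - v j)))"
      using \<beta>_deriv[OF i c s] by simp
    show "((\<lambda>z. c + (z - v j)) has_field_derivative 1) (at (v j))" by (auto intro!: derivative_eq_intros)
  qed
  then have "((\<lambda>z. C / \<beta> (c + (z - v j)) (\<gamma> s)) has_field_derivative
      - (C * (\<beta> c (\<gamma> s) / (2 * (c - \<gamma> s)))) / (\<beta> c (\<gamma> s) * \<beta> c (\<gamma> s))) (at (v j))"
    using nz by (auto intro!: derivative_eq_intros)
  moreover have "- (C * (\<beta> c (\<gamma> s) / (2 * (c - \<gamma> s)))) / (\<beta> c (\<gamma> s) * \<beta> c (\<gamma> s)) = DF j v s"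
  proof -
    have alg: "- (C * (b / (2 * x))) / (b * b) = C / b / (2 * (- x))" if "b \<noteq> 0" for b x :: complex
      using that by (cases "x = 0") (simp_all add: field_simps)
    have "DF j v s = poly (P v) (\<gamma> s) / (2 * (\<gamma> s - c)) / (\<beta> c (\<gamma> s) * B) * \<omega> s"
      using True by (simp add: DF_def variation_def prodB0 c_def i_def)
    also have "\<dots> = C / \<beta> c (\<gamma> s) / (2 * (- (c - \<gamma> s)))"
      unfolding C_def by (simp add: mult_ac)
    finally show ?thesis by (simp only: alg[OF nz(1)])
  qed
  moreover have "(\<lambda>z. F (v(j := z)) s) = (\<lambda>z. C / \<beta> (c + (z - v j)) (\<gamma> s))"
    unfolding F_def moved_poly_upd[OF True] prodB C_def by (simp add: fun_eq_iff)
  ultimately show ?thesis by simp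
next
  case False
  then have jm: "m \<le> j" by simp
  have "(\<lambda>z. F (v(j := z)) s) = (\<lambda>z. (poly (P v) (\<gamma> s) + (z - v j) * \<gamma> s ^ (j - m)) * (\<omega> s / (\<Prod>i<n. \<beta> (E v i) (\<gamma> s))))"
    unfolding F_def poly_moved_poly_upd[OF jm j] using jm by (simp add: fun_eq_iff moved_root_upd_other)
  moreover have "((\<lambda>z. (poly (P v) (\<gamma> s) + (z - v j) * \<gamma> s ^ (j - m)) * (\<omega> s / (\<Prod>i<n. \<beta> (E v i) (\<gamma> s)))) has_field_derivative
      \<gamma> s ^ (j - m) * (\<omega> s / (\<Prod>i<n. \<beta> (E v i) (\<gamma> s)))) (at (v j))"
    by (rule derivative_eq_intros refl | simp)+
  ultimately show ?thesis using False by (simp add: DF_def variation_def)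
qed

lemma cont_coord: "continuous_on S (\<lambda>x. fst x i)" for S :: "((nat \<Rightarrow> complex) \<times> real) set"
  by (rule continuous_on_compose2[OF continuous_on_product_coordinates continuous_on_fst]) auto

lemma cont_path: "continuous_on (X \<times> {0..1}) (\<lambda>x. \<gamma> (snd x))" "continuous_on (X \<times> {0..1}) (\<lambda>x. \<omega> (snd x))"
  by (auto intro!: continuous_on_compose2[OF \<gamma>] continuous_on_compose2[OF \<omega>] continuous_intros)

lemma cont_root: "continuous_on S (\<lambda>x. E (fst x) i)" for S :: "((nat \<Rightarrow> complex) \<times> real) set"
proof -
  have "continuous_on S (\<lambda>x. if \<iota> j = i then fst x j else 0)" for j
    by (cases "\<iota> j = i") (auto intro: cont_coord)
  then show ?thesis unfolding moved_root_def by (intro continuous_intros)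
qed

lemma cont_prod: "continuous_on (X \<times> {0..1}) (\<lambda>x. \<Prod>i<n. \<beta> (E (fst x) i) (\<gamma> (snd x)))"
proof (rule continuous_on_prod)
  fix i assume "i \<in> {..<n}"
  then have i: "i < n" by simp
  have "continuous_on (X \<times> {0..1}) (\<lambda>x. (\<lambda>(c, s). \<beta> c (\<gamma> s)) (E (fst x) i, snd x))"
    by (rule continuous_on_compose2[OF \<beta>_cont[OF i]])
      (use moved_root_in_ball in \<open>auto intro!: continuous_on_Pair cont_root continuous_on_snd\<close>)
  then show "continuous_on (X \<times> {0..1}) (\<lambda>x. \<beta> (E (fst x) i) (\<gamma> (snd x)))" by simp
qed

lemma cont_poly: "continuous_on (X \<times> {0..1}) (\<lambda>x. poly (P (fst x)) (\<gamma> (snd x)))"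
  unfolding poly_moved_poly by (intro continuous_intros cont_path cont_coord)

lemma prod_nonzero: "x \<in> X \<times> {0..1} \<Longrightarrow> (\<Prod>i<n. \<beta> (E (fst x) i) (\<gamma> (snd x))) \<noteq> 0"
  using \<beta>_nonzero[OF _ moved_root_in_ball] by auto

lemma cont_F: "continuous_on (X \<times> {0..1}) (\<lambda>x. F (fst x) (snd x))"
  unfolding F_def by (intro continuous_on_mult continuous_on_divide cont_poly cont_path cont_prod ballI prod_nonzero)

lemma cont_DF:
  assumes "j < 2*m"
  shows "continuous_on (X \<times> {0..1}) (\<lambda>x. DF j (fst x) (snd x))"
proof -
  have "continuous_on (X \<times> {0..1}) (\<lambda>x. variation m \<iota> e p j (fst x) (\<gamma> (snd x)))"
  proof (cases "j < m")
    case True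
    then have i: "\<iota> j < n" using \<iota>(2) by auto
    have "2 * (\<gamma> (snd x) - E (fst x) (\<iota> j)) \<noteq> 0" if "x \<in> X \<times> {0..1}" for x
      using \<beta>_nonzero[OF i moved_root_in_ball[of "fst x"], of "snd x"] that by auto
    then have "continuous_on (X \<times> {0..1}) (\<lambda>x. poly (P (fst x)) (\<gamma> (snd x)) / (2 * (\<gamma> (snd x) - E (fst x) (\<iota> j))))"
      by (intro continuous_on_divide cont_poly continuous_intros cont_path cont_root ballI)
    then show ?thesis using True by (simp add: variation_def)
  next
    case False
    then show ?thesis by (auto simp: variation_def intro!: continuous_intros cont_path)
  qed
  then show ?thesis
    unfolding DF_def by (intro continuous_on_mult continuous_on_divide cont_path cont_prod ballI prod_nonzero)
qed

text \<open>Leibniz rule in the single coordinate \<open>j\<close>; letting it range over the disc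
  of radius \<open>r\<close> keeps the updated point in \<open>X\<close>.\<close>

lemma integral_F_deriv:
  assumes v: "v \<in> X" and j: "j < 2*m"
  shows "((\<lambda>z. integral {0..1} (F (v(j := z)))) has_field_derivative integral {0..1} (DF j v)) (at (v j))"
proof -
  have upd: "v(j := z) \<in> X" if "z \<in> ball 0 r" for z :: complex using v that by auto
  have vj: "v j \<in> ball 0 r" using v by auto
  have cupd: "continuous_on (ball 0 r \<times> {0..1}) (\<lambda>x. (v(j := fst x), snd x :: real))"
  proof (intro continuous_on_Pair continuous_on_coordinatewise_then_product continuous_on_snd continuous_on_id)
    fix i show "continuous_on (ball 0 r \<times> {0..1}) (\<lambda>x. (v(j := fst x)) i)"
      by (cases "i = j") (auto intro!: continuous_intros)
  qed
  have "((\<lambda>z. integral (cbox 0 1) (F (v(j := z)))) has_field_derivative integral (cbox 0 1) (DF j (v(j := v j)))) (at (v j) within ball 0 r)"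
  proof (rule leibniz_rule_field_derivative[where fx = "\<lambda>z. DF j (v(j := z))"])
    fix z :: complex and s :: real assume z: "z \<in> ball 0 r" and s: "s \<in> cbox 0 (1::real)"
    show "((\<lambda>x. F (v(j := x)) s) has_field_derivative DF j (v(j := z)) s) (at z within ball 0 r)"
      using F_deriv[OF upd[OF z] j, of s] s by (simp add: has_field_derivative_at_within)
  next
    fix z :: complex assume z: "z \<in> ball 0 r"
    have "continuous_on {0..1} (\<lambda>s. F (fst (v(j := z), s)) (snd (v(j := z), s)))"
      by (rule continuous_on_compose2[OF cont_F]) (use upd[OF z] in \<open>auto intro!: continuous_intros\<close>)
    then show "F (v(j := z)) integrable_on cbox 0 1"
      by (intro integrable_continuous) simp
  next
    have "continuous_on (ball 0 r \<times> {0..1}) (\<lambda>x. DF j (fst (v(j := fst x), snd x)) (snd (v(j := fst x), snd x)))"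
      by (rule continuous_on_compose2[OF cont_DF[OF j] cupd]) (use upd in auto)
    then show "continuous_on (ball 0 r \<times> cbox 0 1) (\<lambda>(z, s). DF j (v(j := z)) s)"
      by (simp add: case_prod_beta)
  qed (use vj in auto)
  then show ?thesis using at_within_open[OF vj open_ball] by simp
qed

text \<open>A parameter integral is continuous in the product topology, and
  \<open>open_fun_contains_ball\<close> converts this into the bound required by
  \<open>local_surjectivity\<close>.\<close>

lemma integral_DF_near_0:
  assumes j: "j < 2*m" and \<epsilon>: "\<epsilon> > 0"
  shows "\<exists>\<delta>>0. \<forall>v. (\<forall>i. cmod (v i) < \<delta>) \<longrightarrow>
    cmod (integral {0..1} (DF j v) - integral {0..1} (DF j (\<lambda>_. 0))) \<le> \<epsilon>"
proof -
  have "continuous_on (X \<times> cbox 0 1) (\<lambda>(v, s). DF j v s)"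
    using cont_DF[OF j] by (simp add: case_prod_beta)
  from integral_continuous_on_param[OF this]
  have "continuous_on X (\<lambda>v. integral {0..1} (DF j v))" by simp
  moreover have "(\<lambda>_. 0) \<in> X" using r_pos by simp
  moreover have "open (ball (integral {0..1} (DF j (\<lambda>_. 0))) \<epsilon>)" by simp
  ultimately have "\<exists>A. open A \<and> (\<lambda>_. 0) \<in> A \<and> (\<forall>v\<in>X. v \<in> A \<longrightarrow>
      integral {0..1} (DF j v) \<in> ball (integral {0..1} (DF j (\<lambda>_. 0))) \<epsilon>)"
    unfolding continuous_on_topological using \<epsilon> by (auto simp del: mem_ball)
  then obtain A where A: "open A" "(\<lambda>_. 0) \<in> A"
    "\<forall>v\<in>X. v \<in> A \<longrightarrow> integral {0..1} (DF j v) \<in> ball (integral {0..1} (DF j (\<lambda>_. 0))) \<epsilon>" by blast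
  obtain \<delta> where \<delta>: "\<delta> > 0" "\<And>v. (\<forall>i. cmod (v i) < \<delta>) \<Longrightarrow> v \<in> A"
    using open_fun_contains_ball[OF A(1,2)] by metis
  show ?thesis
  proof (intro exI[of _ "min \<delta> r"] conjI allI impI)
    fix v :: "nat \<Rightarrow> complex" assume v: "\<forall>i. cmod (v i) < min \<delta> r"
    then have "v \<in> X" "v \<in> A" using \<delta>(2)[of v] by auto
    then show "cmod (integral {0..1} (DF j v) - integral {0..1} (DF j (\<lambda>_. 0))) \<le> \<epsilon>"
      using bspec[OF A(3), of v] by (simp add: dist_norm norm_minus_commute)
  qed (use \<delta> r_pos in auto)
qed

end

section \<open>Pellian polynomials near a given one\<close>

lemma finite_uniform_radius:
  fixes e :: "nat \<Rightarrow> 'a::metric_space"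
  assumes "\<And>i. i < n \<Longrightarrow> \<exists>r>0. \<forall>c. dist c (e i) < r \<longrightarrow> Q i c"
  shows "\<exists>r>0. \<forall>i<n. \<forall>c. dist c (e i) < r \<longrightarrow> Q i c"
  using assms
proof (induction n)
  case 0
  then show ?case by (intro exI[of _ 1]) simp
next
  case (Suc n)
  then obtain r1 where r1: "r1 > 0" "\<forall>i<n. \<forall>c. dist c (e i) < r1 \<longrightarrow> Q i c" by (meson less_SucI)
  obtain r2 where r2: "r2 > 0" "\<forall>c. dist c (e n) < r2 \<longrightarrow> Q n c" using Suc.prems[of n] by auto
  show ?case
  proof (intro exI[of _ "min r1 r2"] conjI allI impI)
    fix i c assume "i < Suc n" "dist c (e i) < min r1 r2"
    then show "Q i c" using r1 r2 by (cases "i = n") auto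
  qed (use r1 r2 in auto)
qed

lemma sum_lessThan_add:
  fixes f :: "nat \<Rightarrow> 'a::comm_monoid_add"
  shows "(\<Sum>j<m + m'. f j) = (\<Sum>j<m. f j) + (\<Sum>j<m'. f (m + j))"
  by (induction m') (auto simp: add.assoc)

text \<open>The product is a square root of \<open>c - t\<close>. With \<open>X^2 = c\<close> and
  \<open>Y^2 = 1 - t / c\<close> one has \<open>c - t = X^2 Y^2\<close>, and the claim becomes an
  identity of rational functions in \<open>X\<close> and \<open>Y\<close>.\<close>

lemma csqrt_inner_deriv:
  assumes "c \<notin> \<real>\<^sub>\<le>\<^sub>0" "1 - t / c \<notin> \<real>\<^sub>\<le>\<^sub>0"
  shows "((\<lambda>c. csqrt c * csqrt (1 - t / c)) has_field_derivative csqrt c * csqrt (1 - t / c) / (2 * (c - t))) (at c)"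
proof -
  define X Y where "X = csqrt c" and "Y = csqrt (1 - t / c)"
  have c0: "c \<noteq> 0" using assms(1) by auto
  have Y2: "1 - t / c = Y\<^sup>2" and X2: "c = X\<^sup>2" by (simp_all add: X_def Y_def)
  have "Y\<^sup>2 \<noteq> 0" using assms(2) unfolding Y2 by auto
  then have nz: "X \<noteq> 0" "Y \<noteq> 0" using c0 X2 by auto
  have t: "t = X\<^sup>2 * (1 - Y\<^sup>2)" unfolding Y2[symmetric] X2[symmetric] using c0 by (simp add: field_simps)
  have "((\<lambda>c. csqrt c * csqrt (1 - t / c)) has_field_derivative
      csqrt c * ((t / c\<^sup>2) / (2 * csqrt (1 - t / c))) + 1 / (2 * csqrt c) * csqrt (1 - t / c)) (at c)"
    by (rule derivative_eq_intros refl | use assms c0 in \<open>simp add: power2_eq_square\<close>)+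
  moreover have "X * ((t / c\<^sup>2) / (2 * Y)) + 1 / (2 * X) * Y = X * Y / (2 * (c - t))"
  proof -
    have ct: "c - t = X\<^sup>2 * Y\<^sup>2" unfolding t X2 by (simp add: algebra_simps)
    have "X * ((t / c\<^sup>2) / (2 * Y)) = (1 - Y\<^sup>2) / (2 * X * Y)"
      unfolding t X2 using nz by (simp add: power2_eq_square)
    moreover have "1 / (2 * X) * Y = Y\<^sup>2 / (2 * X * Y)" using nz by (simp add: power2_eq_square)
    ultimately have "X * ((t / c\<^sup>2) / (2 * Y)) + 1 / (2 * X) * Y = 1 / (2 * X * Y)"
      by (simp add: add_divide_distrib[symmetric])
    also have "\<dots> = X * Y / (2 * (c - t))" unfolding ct using nz by (simp add: power2_eq_square)
    finally show ?thesis .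
  qed
  ultimately show ?thesis by (simp add: X_def Y_def)
qed

lemma csqrt_outer_deriv:
  assumes "t \<noteq> 0" "1 - c / t \<notin> \<real>\<^sub>\<le>\<^sub>0"
  shows "((\<lambda>c. csqrt (1 - c / t)) has_field_derivative csqrt (1 - c / t) / (2 * (c - t))) (at c)"
proof -
  define Y where "Y = csqrt (1 - c / t)"
  have Y2: "1 - c / t = Y\<^sup>2" by (simp add: Y_def)
  have nz: "Y \<noteq> 0" using assms(2) unfolding Y2 by auto
  have ct: "c - t = - t * Y\<^sup>2" unfolding Y2[symmetric] using assms(1) by (simp add: field_simps)
  have "((\<lambda>c. csqrt (1 - c / t)) has_field_derivative (- 1 / t) / (2 * csqrt (1 - c / t))) (at c)"
    by (rule derivative_eq_intros refl | use assms in simp)+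
  moreover have "(- 1 / t) / (2 * Y) = Y / (2 * (c - t))"
    unfolding ct using nz assms(1) by (simp add: power2_eq_square)
  ultimately show ?thesis by (simp add: Y_def)
qed

lemma continuous_on_csqrt_compose:
  "continuous_on S f \<Longrightarrow> (\<And>x. x \<in> S \<Longrightarrow> f x \<notin> \<real>\<^sub>\<le>\<^sub>0) \<Longrightarrow> continuous_on S (\<lambda>x. csqrt (f x))"
  by (rule continuous_on_compose2[OF holomorphic_on_imp_continuous_on[OF holomorphic_on_csqrt]]) auto

context root_configuration
begin

lemma root_notin_nonpos_Reals:
  assumes i: "i < 2*d"
  shows "e i \<notin> \<real>\<^sub>\<le>\<^sub>0"
proof
  assume "e i \<in> \<real>\<^sub>\<le>\<^sub>0"
  then obtain x where x: "e i = of_real x" "x \<le> 0" by (auto elim: nonpos_Reals_cases)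
  then have "x < 0" using root_nonzero[OF i] by (cases "x = 0") auto
  then have "Arg (e i) = pi" using x by (simp add: Arg_of_real)
  then show False using Arg_less_pi[OF i] by simp
qed

text \<open>Finitely many strict inequalities in the roots, with \<open>\<theta>\<close> and
  \<open>\<rho>\<close> fixed; \<open>Arg\<close> is continuous at the roots since none of them lies
  on the negative real axis.\<close>

lemma stable_configuration:
  "\<exists>r>0. \<forall>e'. (\<forall>i<2*d. cmod (e' i - e i) < r) \<longrightarrow> root_configuration d e' \<theta> \<rho>"
proof -
  define Q where "Q i c \<longleftrightarrow> c \<noteq> 0 \<and> \<theta> i < Arg c \<and> (Suc i < 2*d \<longrightarrow> Arg c < \<theta> (Suc i)) \<and> Arg c < pi \<and> cmod c < \<rho>"
    for i c
  have "\<exists>r>0. \<forall>c. dist c (e i) < r \<longrightarrow> Q i c" if i: "i < 2*d" for i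
  proof -
    have A: "(Arg \<longlongrightarrow> Arg (e i)) (nhds (e i))"
      using continuous_at_Arg[OF root_notin_nonpos_Reals[OF i]]
      by (simp add: isCont_def tendsto_at_iff_tendsto_nhds)
    have N: "(cmod \<longlongrightarrow> cmod (e i)) (nhds (e i))" by (intro tendsto_norm filterlim_ident)
    have "\<forall>\<^sub>F c in nhds (e i). c \<noteq> 0"
      using tendsto_imp_eventually_ne[OF filterlim_ident root_nonzero[OF i]] .
    moreover have "\<forall>\<^sub>F c in nhds (e i). \<theta> i < Arg c" by (rule order_tendstoD(1)[OF A theta_less[OF i]])
    moreover have "\<forall>\<^sub>F c in nhds (e i). Suc i < 2*d \<longrightarrow> Arg c < \<theta> (Suc i)"
    proof (cases "Suc i < 2*d")
      case True
      have "\<forall>\<^sub>F c in nhds (e i). Arg c < \<theta> (Suc i)" by (rule order_tendstoD(2)[OF A less_theta[OF True]])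
      then show ?thesis by eventually_elim simp
    qed simp
    moreover have "\<forall>\<^sub>F c in nhds (e i). Arg c < pi" by (rule order_tendstoD(2)[OF A Arg_less_pi[OF i]])
    moreover have "\<forall>\<^sub>F c in nhds (e i). cmod c < \<rho>" by (rule order_tendstoD(2)[OF N norm_root[OF i]])
    ultimately have "\<forall>\<^sub>F c in nhds (e i). Q i c" unfolding Q_def by eventually_elim simp
    then show ?thesis by (simp add: eventually_nhds_metric)
  qed
  from finite_uniform_radius[of "2*d" e Q, OF this]
  obtain r where r: "r > 0" "\<forall>i<2*d. \<forall>c. dist c (e i) < r \<longrightarrow> Q i c" by blast
  have "root_configuration d e' \<theta> \<rho>" if e': "\<forall>i<2*d. cmod (e' i - e i) < r" for e'
  proof -
    have Q: "Q i (e' i)" if "i < 2*d" for i using r e' that by (simp add: dist_norm)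
    show ?thesis by unfold_locales (use Q d_ge theta_0 in \<open>auto simp: Q_def\<close>)
  qed
  then show ?thesis using r(1) by blast
qed

lemma radial_in_cut_plane: "k < 2*d \<Longrightarrow> s \<in> {0..1} \<Longrightarrow> of_real s * exp (b k) \<in> U"
  using cut_plane_scale[OF strip_subset(1)[OF base_in_strip]] by auto

lemma period_sum:
  assumes A: "finite A" and k: "k + 2 < 2*d"
    and g: "\<And>j. j \<in> A \<Longrightarrow> continuous_on U (g j)"
    and h: "\<And>j. j \<in> A \<Longrightarrow> continuous_on {t. t \<noteq> 0 \<and> inverse t \<in> V} (h j)"
  shows "period d \<theta> \<rho> k (\<lambda>t. \<Sum>j\<in>A. c j * g j t) (\<lambda>t. \<Sum>j\<in>A. c j * h j t) = (\<Sum>j\<in>A. c j * period d \<theta> \<rho> k (g j) (h j))"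
proof -
  have rad: "radial_integral \<theta> \<rho> l (\<lambda>t. \<Sum>j\<in>A. c j * g j t) = (\<Sum>j\<in>A. c j * radial_integral \<theta> \<rho> l (g j))"
    if l: "l < 2*d" for l
  proof -
    define f where "f j s = g j (of_real s * exp (b l)) * exp (b l)" for j s
    have "continuous_on {0..1} (f j)" if "j \<in> A" for j
      unfolding f_def using radial_in_cut_plane[OF l]
      by (intro continuous_intros continuous_on_compose2[OF g[OF that]]) auto
    then have int: "(\<lambda>s. c j * f j s) integrable_on {0..1}" if "j \<in> A" for j
      using that by (intro integrable_continuous_interval continuous_intros)
    have "radial_integral \<theta> \<rho> l (\<lambda>t. \<Sum>j\<in>A. c j * g j t) = integral {0..1} (\<lambda>s. \<Sum>j\<in>A. c j * f j s)"
      unfolding radial_integral_def f_def sum_distrib_right mult.assoc ..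
    also have "\<dots> = (\<Sum>j\<in>A. integral {0..1} (\<lambda>s. c j * f j s))" using A int by (rule integral_sum)
    also have "\<dots> = (\<Sum>j\<in>A. c j * integral {0..1} (f j))" by simp
    finally show ?thesis unfolding radial_integral_def f_def .
  qed
  have arc: "arc_integral \<theta> \<rho> k (\<lambda>t. \<Sum>j\<in>A. c j * h j t) = (\<Sum>j\<in>A. c j * arc_integral \<theta> \<rho> k (h j))"
  proof -
    define f where "f j s = h j (sector_arc \<theta> \<rho> k s) * (sector_arc \<theta> \<rho> k s * (b (k+2) - b k))" for j s
    have ca: "continuous_on {0..1} (sector_arc \<theta> \<rho> k)" unfolding sector_arc_def by (intro continuous_intros)
    have "continuous_on {0..1} (f j)" if "j \<in> A" for j
      unfolding f_def using arc_in_outer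
      by (intro continuous_intros ca continuous_on_compose2[OF h[OF that] ca]) auto
    then have int: "(\<lambda>s. c j * f j s) integrable_on {0..1}" if "j \<in> A" for j
      using that by (intro integrable_continuous_interval continuous_intros)
    have "arc_integral \<theta> \<rho> k (\<lambda>t. \<Sum>j\<in>A. c j * h j t) = integral {0..1} (\<lambda>s. \<Sum>j\<in>A. c j * f j s)"
      unfolding arc_integral_def f_def sum_distrib_right mult.assoc ..
    also have "\<dots> = (\<Sum>j\<in>A. integral {0..1} (\<lambda>s. c j * f j s))" using A int by (rule integral_sum)
    also have "\<dots> = (\<Sum>j\<in>A. c j * integral {0..1} (f j))" by simp
    finally show ?thesis unfolding arc_integral_def f_def .
  qed
  have kk: "k < 2*d" "k + 2 < 2*d" using k by auto
  show ?thesis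
    unfolding period_def rad[OF kk(1)] rad[OF kk(2)] arc sum_subtractf[symmetric] sum_distrib_left
    by (intro sum.cong) (auto simp: algebra_simps)
qed

lemma continuous_over_sqrt:
  assumes "continuous_on U N" "continuous_on {t. t \<noteq> 0 \<and> inverse t \<in> V} N"
  shows "continuous_on U (\<lambda>t. N t / inner_sqrt d e t)"
    and "continuous_on {t. t \<noteq> 0 \<and> inverse t \<in> V} (\<lambda>t. N t / outer_sqrt d e t)"
proof -
  show "continuous_on U (\<lambda>t. N t / inner_sqrt d e t)"
    by (intro continuous_on_divide assms(1) holomorphic_on_imp_continuous_on[OF holomorphic_inner_sqrt])
      (use inner_sqrt_nonzero in auto)
  have "continuous_on {t. t \<noteq> 0 \<and> inverse t \<in> V} (\<lambda>t. cut_sqrt (2*d) (\<lambda>i. inverse (e i)) (inverse t))"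
    by (rule continuous_on_compose2[OF holomorphic_on_imp_continuous_on[OF holomorphic_cut_sqrt]])
      (auto intro!: continuous_intros)
  then have "continuous_on {t. t \<noteq> 0 \<and> inverse t \<in> V} (\<lambda>t. t ^ d * cut_sqrt (2*d) (\<lambda>i. inverse (e i)) (inverse t))"
    by (intro continuous_intros)
  then have "continuous_on {t. t \<noteq> 0 \<and> inverse t \<in> V} (\<lambda>t. outer_sqrt d e t)"
    unfolding outer_sqrt_eq .
  then show "continuous_on {t. t \<noteq> 0 \<and> inverse t \<in> V} (\<lambda>t. N t / outer_sqrt d e t)"
    by (intro continuous_on_divide assms(2)) (auto simp: outer_sqrt_eq cut_sqrt_nonzero)
qed

lemma period_over_sqrt_sum:
  assumes A: "finite A" and k: "k + 2 < 2*d"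
    and N: "\<And>j. j \<in> A \<Longrightarrow> continuous_on U (N j)" "\<And>j. j \<in> A \<Longrightarrow> continuous_on {t. t \<noteq> 0 \<and> inverse t \<in> V} (N j)"
  shows "period d \<theta> \<rho> k (\<lambda>t. (\<Sum>j\<in>A. c j * N j t) / inner_sqrt d e t) (\<lambda>t. (\<Sum>j\<in>A. c j * N j t) / outer_sqrt d e t)
    = (\<Sum>j\<in>A. c j * period d \<theta> \<rho> k (\<lambda>t. N j t / inner_sqrt d e t) (\<lambda>t. N j t / outer_sqrt d e t))"
proof -
  have "(\<lambda>t. (\<Sum>j\<in>A. c j * N j t) / R t) = (\<lambda>t. \<Sum>j\<in>A. c j * (N j t / R t))" for R
    by (simp add: sum_divide_distrib)
  then show ?thesis
    using period_sum[OF A k, of "\<lambda>j t. N j t / inner_sqrt d e t" "\<lambda>j t. N j t / outer_sqrt d e t" c]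
      continuous_over_sqrt[OF N] by simp
qed

text \<open>The \<open>2d - 2\<close> real parts are real-affine in the \<open>2d - 2\<close> real
  and imaginary parts of the lower coefficients. The homogeneous system is injective by
  \<open>imaginary_periods_imp_zero\<close>, so the inhomogeneous one is solvable.\<close>

lemma imaginary_period_polynomial:
  obtains p where "degree p = d - 1" "lead_coeff p = 1"
    "\<And>k. k + 2 < 2*d \<Longrightarrow> Re (period d \<theta> \<rho> k (\<lambda>t. poly p t / inner_sqrt d e t) (\<lambda>t. poly p t / outer_sqrt d e t)) = 0"
proof -
  define m where "m = d - 1"
  have m: "d = Suc m" "m \<ge> 1" using d_ge by (auto simp: m_def)
  define pr where "pr q k = period d \<theta> \<rho> k (\<lambda>t. poly q t / inner_sqrt d e t) (\<lambda>t. poly q t / outer_sqrt d e t)" for q k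
  define z where "z l k = pr (monom 1 l) k" for l k
  have pr_sum: "pr (\<Sum>l\<in>A. monom (c l) l) k = (\<Sum>l\<in>A. c l * z l k)" if "finite A" "k + 2 < 2*d" for A c k
  proof -
    have "(\<Sum>l\<in>A. c l * z l k) = period d \<theta> \<rho> k (\<lambda>t. (\<Sum>l\<in>A. c l * poly (monom 1 l) t) / inner_sqrt d e t)
        (\<lambda>t. (\<Sum>l\<in>A. c l * poly (monom 1 l) t) / outer_sqrt d e t)"
      unfolding z_def pr_def
      by (rule period_over_sqrt_sum[symmetric, OF that]) (auto intro!: continuous_intros)
    moreover have "(\<Sum>l\<in>A. c l * poly (monom 1 l) t) = poly (\<Sum>l\<in>A. monom (c l) l) t" for t
      by (simp add: poly_sum poly_monom)
    ultimately show ?thesis by (simp add: pr_def)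
  qed
  \<comment> \<open>The first \<open>m\<close> real unknowns are the real parts of the coefficients,
    the next \<open>m\<close> their imaginary parts; \<open>M\<close> then follows from the real
    part of a product.\<close>
  define C where "C x l = Complex (x l) (x (m + l))" for x :: "nat \<Rightarrow> real" and l
  define M where "M k j = (if j < m then Re (z j k) else - Im (z (j - m) k))" for k j
  have MC: "(\<Sum>j<m+m. M k j * x j) = Re (\<Sum>l<m. C x l * z l k)" for k x
    unfolding sum_lessThan_add by (simp add: M_def C_def sum.distrib[symmetric] algebra_simps)
  have inj: "\<forall>j<m+m. x j = 0" if x: "\<forall>k<m+m. (\<Sum>j<m+m. M k j * x j) = 0" for x
  proof -
    define q where "q = (\<Sum>l<m. monom (C x l) l)"
    have "degree q \<le> d - 2" unfolding q_def
      using m by (intro degree_sum_le) (auto intro: order_trans[OF degree_monom_le])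
    moreover have "Re (pr q k) = 0" if "k + 2 < 2*d" for k
    proof -
      have "k < m + m" using that m by simp
      then show ?thesis using x MC[of k x] unfolding q_def pr_sum[OF finite_lessThan that] by metis
    qed
    ultimately have q0: "q = 0" unfolding pr_def by (rule imaginary_periods_imp_zero)
    have C0: "C x l = 0" if "l < m" for l
    proof -
      have "coeff q l = (\<Sum>i<m. if i = l then C x i else 0)"
        unfolding q_def coeff_sum by (intro sum.cong) auto
      then show ?thesis using that q0 by simp
    qed
    show ?thesis
    proof (intro allI impI)
      fix j assume j: "j < m + m"
      show "x j = 0"
      proof (cases "j < m")
        case True
        then show ?thesis using C0[of j] by (simp add: C_def complex_eq_iff)
      next
        case False
        then show ?thesis using C0[of "j - m"] j by (simp add: C_def complex_eq_iff)
      qed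
    qed
  qed
  have "\<exists>N. \<forall>k<m+m. \<forall>l<m+m. (\<Sum>j<m+m. M k j * N j l) = (if k = l then 1 else 0)"
  proof (rule square_system_inverse[of "m+m" M, OF inj])
    fix N assume "\<And>k l. k < m+m \<Longrightarrow> l < m+m \<Longrightarrow> (\<Sum>j<m+m. M k j * N j l) = (if k = l then 1 else 0)"
    then show "\<exists>N. \<forall>k<m+m. \<forall>l<m+m. (\<Sum>j<m+m. M k j * N j l) = (if k = l then 1 else 0)"
      by (intro exI[of _ N]) simp
  qed
  then obtain N where N: "\<forall>k<m+m. \<forall>l<m+m. (\<Sum>j<m+m. M k j * N j l) = (if k = l then 1 else 0)" ..
  \<comment> \<open>The right-hand side compensates the periods \<open>z m k\<close> of the fixed
    leading term \<open>t ^ m\<close>.\<close>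
  define x where "x j = - (\<Sum>l<m+m. N j l * Re (z m l))" for j
  have sol: "(\<Sum>j<m+m. M k j * x j) = - Re (z m k)" if "k < m+m" for k
  proof -
    have "(\<Sum>j<m+m. M k j * x j) = - (\<Sum>j<m+m. \<Sum>l<m+m. M k j * N j l * Re (z m l))"
      by (simp add: x_def sum_distrib_left sum_negf mult.assoc)
    also have "\<dots> = - (\<Sum>l<m+m. (\<Sum>j<m+m. M k j * N j l) * Re (z m l))"
      by (subst sum.swap) (simp add: sum_distrib_right)
    also have "\<dots> = - (\<Sum>l<m+m. if k = l then Re (z m l) else 0)"
      using N that by (intro arg_cong[where f = uminus] sum.cong) auto
    also have "\<dots> = - Re (z m k)" using that by simp
    finally show ?thesis .
  qed
  define c where "c l = (if l = m then 1 else C x l)" for l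
  define p where "p = (\<Sum>l<Suc m. monom (c l) l)"
  have p_coeff: "coeff p i = (if i < Suc m then c i else 0)" for i
  proof -
    have "coeff p i = (\<Sum>l<Suc m. if l = i then c l else 0)"
      unfolding p_def coeff_sum by (intro sum.cong) auto
    then show ?thesis by (simp only: sum.delta finite_lessThan lessThan_iff)
  qed
  have "degree p \<le> m" unfolding p_def by (intro degree_sum_le) (auto intro: order_trans[OF degree_monom_le])
  moreover have "coeff p m = 1" by (simp add: p_coeff c_def)
  ultimately have deg: "degree p = m" using le_degree[of p m] by simp
  show ?thesis
  proof (rule that[of p])
    show "degree p = d - 1" using deg m by simp
    show "lead_coeff p = 1" using deg \<open>coeff p m = 1\<close> by simp
    fix k assume k: "k + 2 < 2*d"
    have "pr p k = (\<Sum>l<Suc m. c l * z l k)" unfolding p_def by (rule pr_sum[OF finite_lessThan k])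
    also have "\<dots> = (\<Sum>l<m. C x l * z l k) + z m k" by (simp add: c_def)
    finally have "Re (pr p k) = Re (\<Sum>l<m. C x l * z l k) + Re (z m k)" by simp
    then show "Re (period d \<theta> \<rho> k (\<lambda>t. poly p t / inner_sqrt d e t) (\<lambda>t. poly p t / outer_sqrt d e t)) = 0"
      using MC[of k x] sol[of k] k m unfolding pr_def by simp
  qed
qed

text \<open>Replacing only the root \<open>e i\<close> by a nearby \<open>c\<close> gives, by
  stability, another configuration with the same \<open>\<theta>\<close> and \<open>\<rho>\<close>.
  So the unchanged path lies in the new cut plane, which is the condition on \<open>csqrt\<close>
  needed for \<open>c\<close>.\<close>

lemma radial_parametric:
  assumes r: "r > 0" and st: "\<And>e'. (\<And>i. i < 2*d \<Longrightarrow> cmod (e' i - e i) < r) \<Longrightarrow> root_configuration d e' \<theta> \<rho>"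
    and \<iota>: "inj_on \<iota> {..<m}" "\<iota> ` {..<m} \<subseteq> {..<2*d}" and k: "k < 2*d"
  shows "parametric_integral m (2*d) \<iota> e r (\<lambda>s. of_real s * exp (b k)) (\<lambda>s. exp (b k)) (\<lambda>c t. csqrt c * csqrt (1 - t / c))"
proof -
  have c: "c \<notin> \<real>\<^sub>\<le>\<^sub>0 \<and> c \<noteq> 0 \<and> (\<forall>s\<in>{0..1}. 1 - of_real s * exp (b k) / c \<notin> \<real>\<^sub>\<le>\<^sub>0)" if i: "i < 2*d" and "c \<in> ball (e i) r" for i c
  proof -
    interpret c: root_configuration d "e(i := c)" \<theta> \<rho>
      using that r by (intro st) (auto simp: dist_norm norm_minus_commute)
    have "1 - of_real s * exp (b k) / c \<notin> \<real>\<^sub>\<le>\<^sub>0" if "s \<in> {0..1}" for s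
      using c.radial_in_cut_plane[OF k that] i by (auto simp: cut_plane_def split: if_splits)
    then show ?thesis using c.root_notin_nonpos_Reals[OF i] c.root_nonzero[OF i] by auto
  qed
  show ?thesis
  proof
    fix i c s assume i: "i < 2*d" and cb: "c \<in> ball (e i) r" and s: "s \<in> {0..1::real}"
    have np: "c \<notin> \<real>\<^sub>\<le>\<^sub>0" "c \<noteq> 0" "1 - of_real s * exp (b k) / c \<notin> \<real>\<^sub>\<le>\<^sub>0" using c[OF i cb] s by auto
    then have "1 - of_real s * exp (b k) / c \<noteq> 0" by (metis nonpos_Reals_zero_I)
    then show "csqrt c * csqrt (1 - of_real s * exp (b k) / c) \<noteq> 0 \<and> c \<noteq> of_real s * exp (b k)"
      using np(2) by auto
    show "((\<lambda>c. csqrt c * csqrt (1 - of_real s * exp (b k) / c)) has_field_derivative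
        csqrt c * csqrt (1 - of_real s * exp (b k) / c) / (2 * (c - of_real s * exp (b k)))) (at c)"
      by (rule csqrt_inner_deriv[OF np(1,3)])
  next
    fix i assume i: "i < 2*d"
    show "continuous_on (ball (e i) r \<times> {0..1}) (\<lambda>(c, s). csqrt c * csqrt (1 - of_real s * exp (b k) / c))"
      unfolding case_prod_beta
      by (intro continuous_on_mult continuous_on_csqrt_compose continuous_intros) (use c[OF i] in auto)
  qed (use r \<iota> in \<open>auto intro!: continuous_intros\<close>)
qed

text \<open>The factor \<open>t ^ d\<close> of the outer branch does not depend on the roots and is
  moved into the weight of the integral.\<close>

lemma arc_parametric:
  assumes r: "r > 0" and st: "\<And>e'. (\<And>i. i < 2*d \<Longrightarrow> cmod (e' i - e i) < r) \<Longrightarrow> root_configuration d e' \<theta> \<rho>"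
    and \<iota>: "inj_on \<iota> {..<m}" "\<iota> ` {..<m} \<subseteq> {..<2*d}"
  shows "parametric_integral m (2*d) \<iota> e r (sector_arc \<theta> \<rho> k)
    (\<lambda>s. sector_arc \<theta> \<rho> k s * (b (k+2) - b k) / sector_arc \<theta> \<rho> k s ^ d) (\<lambda>c t. csqrt (1 - c / t))"
proof -
  have nz: "sector_arc \<theta> \<rho> k s \<noteq> 0" for s by (rule arc_in_outer)
  have c: "1 - c / sector_arc \<theta> \<rho> k s \<notin> \<real>\<^sub>\<le>\<^sub>0" if i: "i < 2*d" and "c \<in> ball (e i) r" for i c s
  proof -
    interpret c: root_configuration d "e(i := c)" \<theta> \<rho>
      using that r by (intro st) (auto simp: dist_norm norm_minus_commute)
    show ?thesis using c.arc_in_outer(2)[of k s] i by (auto simp: cut_plane_def field_simps split: if_splits)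
  qed
  have ca: "continuous_on S (sector_arc \<theta> \<rho> k)" for S unfolding sector_arc_def by (intro continuous_intros)
  show ?thesis
  proof
    fix i c s assume i: "i < 2*d" and cb: "c \<in> ball (e i) r" and s: "s \<in> {0..1::real}"
    have "1 - c / sector_arc \<theta> \<rho> k s \<noteq> 0" using c[OF i cb] by (metis nonpos_Reals_zero_I)
    then show "csqrt (1 - c / sector_arc \<theta> \<rho> k s) \<noteq> 0 \<and> c \<noteq> sector_arc \<theta> \<rho> k s"
      using nz[of s] by auto
    show "((\<lambda>c. csqrt (1 - c / sector_arc \<theta> \<rho> k s)) has_field_derivative
        csqrt (1 - c / sector_arc \<theta> \<rho> k s) / (2 * (c - sector_arc \<theta> \<rho> k s))) (at c)"
      by (rule csqrt_outer_deriv[OF nz c[OF i cb]])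
  next
    fix i assume i: "i < 2*d"
    show "continuous_on (ball (e i) r \<times> {0..1}) (\<lambda>(c, s). csqrt (1 - c / sector_arc \<theta> \<rho> k s))"
      unfolding case_prod_beta
      by (intro continuous_on_csqrt_compose continuous_intros continuous_on_compose2[OF ca[of UNIV]])
        (use c[OF i] nz in auto)
  next
    show "continuous_on {0..1} (\<lambda>s. sector_arc \<theta> \<rho> k s * (b (k+2) - b k) / sector_arc \<theta> \<rho> k s ^ d)"
      by (intro continuous_intros ca) (use nz in auto)
  qed (use r \<iota> ca in auto)
qed

lemma pellian_near:
  assumes "\<epsilon> > 0"
  obtains e' where "\<And>i. i < 2*d \<Longrightarrow> cmod (e' i - e i) < \<epsilon>" "root_configuration d e' \<theta> \<rho>"
    "pellian (\<Prod>i<2*d. [:- e' i, 1:])"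
proof -
  define m where "m = d - 1"
  have m: "d = Suc m" "m \<ge> 1" using d_ge by (auto simp: m_def)
  obtain p where p: "degree p = d - 1" "lead_coeff p = 1"
    and im: "\<And>k. k + 2 < 2*d \<Longrightarrow> Re (period d \<theta> \<rho> k (\<lambda>t. poly p t / inner_sqrt d e t) (\<lambda>t. poly p t / outer_sqrt d e t)) = 0"
    using imaginary_period_polynomial by metis
  have e_inj: "inj_on e {..<2*d}"
    using distinct root_nonzero by (intro inj_onI) (metis divide_self lessThan_iff nonneg_Reals_one_I)
  define I where "I = {i \<in> {..<2*d}. poly p (e i) \<noteq> 0}"
  \<comment> \<open>At most \<open>d - 1\<close> of the \<open>2d\<close> roots are zeros of
    \<open>p\<close>, so at least \<open>d + 1\<close> qualify, more than the \<open>d - 1\<close>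
    that are to be moved.\<close>
  have "card {i \<in> {..<2*d}. poly p (e i) = 0} \<le> m"
  proof -
    have "p \<noteq> 0" using p(2) by auto
    then have "card {t. poly p t = 0} \<le> m" "finite {t. poly p t = 0}"
      using poly_roots_degree[of p] poly_roots_finite[of p] p(1) m by auto
    moreover have "card {i \<in> {..<2*d}. poly p (e i) = 0} \<le> card {t. poly p t = 0}"
      by (rule card_inj_on_le[of e]) (use e_inj calculation in \<open>auto simp: inj_on_def\<close>)
    ultimately show ?thesis by simp
  qed
  moreover have "I = {..<2*d} - {i \<in> {..<2*d}. poly p (e i) = 0}" by (auto simp: I_def)
  then have "card I = 2*d - card {i \<in> {..<2*d}. poly p (e i) = 0}" 
    by (simp only:) (subst card_Diff_subset, auto)
  ultimately have "m \<le> card I" using m by linarith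
  then obtain J where J: "J \<subseteq> I" "card J = m" "finite J" by (meson obtain_subset_with_card_n)
  then obtain \<iota> where \<iota>: "bij_betw \<iota> {..<m} J"
    using ex_bij_betw_nat_finite[OF J(3)] by (auto simp: lessThan_atLeast0)
  have \<iota>i: "inj_on \<iota> {..<m}" "\<iota> ` {..<m} = J" using \<iota> by (auto simp: bij_betw_def)
  have J2: "J \<subseteq> {..<2*d}" using J(1) by (auto simp: I_def)
  then have \<iota>s: "\<iota> ` {..<m} \<subseteq> {..<2*d}" using \<iota>i(2) by simp
  obtain r where r: "r > 0" and st0: "\<forall>e'. (\<forall>i<2*d. cmod (e' i - e i) < r) \<longrightarrow> root_configuration d e' \<theta> \<rho>"
    using stable_configuration by blast
  have st: "root_configuration d e' \<theta> \<rho>" if "\<And>i. i < 2*d \<Longrightarrow> cmod (e' i - e i) < r" for e'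
    using st0 that by blast
  define E where "E = moved_root m \<iota> e"
  define P where "P = moved_poly m p"
  define N where "N = variation m \<iota> e p"
  define \<Phi> where "\<Phi> k v = period d \<theta> \<rho> k (\<lambda>t. poly (P v) t / inner_sqrt d (E v) t) (\<lambda>t. poly (P v) t / outer_sqrt d (E v) t)" for k v
  define \<Psi> where "\<Psi> k j v = period d \<theta> \<rho> k (\<lambda>t. N j v t / inner_sqrt d (E v) t) (\<lambda>t. N j v t / outer_sqrt d (E v) t)" for k j v
  have rad: "radial_integral \<theta> \<rho> k (\<lambda>t. f t / inner_sqrt d e' t) =
      integral {0..1} (\<lambda>s. f (of_real s * exp (b k)) / (\<Prod>i<2*d. csqrt (e' i) * csqrt (1 - of_real s * exp (b k) / e' i)) * exp (b k))" for k f e'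
    unfolding radial_integral_def inner_sqrt_def ..
  have arc: "arc_integral \<theta> \<rho> k (\<lambda>t. f t / outer_sqrt d e' t) =
      integral {0..1} (\<lambda>s. f (sector_arc \<theta> \<rho> k s) / (\<Prod>i<2*d. csqrt (1 - e' i / sector_arc \<theta> \<rho> k s)) *
        (sector_arc \<theta> \<rho> k s * (b (k+2) - b k) / sector_arc \<theta> \<rho> k s ^ d))" for k f e'
  proof -
    have "a / (c * q) * x = a / q * (x / c)" for a c q x :: complex by simp
    then show ?thesis unfolding arc_integral_def outer_sqrt_def by presburger
  qed
  \<comment> \<open>Each period is a signed sum of three parametric integrals, hence three
    interpretations and the tolerance \<open>\<epsilon> / 3\<close>.\<close>
  have deriv: "((\<lambda>z. \<Phi> k (v(j := z))) has_field_derivative \<Psi> k j v) (at (v j))"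
    and near: "\<epsilon> > 0 \<Longrightarrow> \<exists>\<delta>>0. \<forall>v. (\<forall>i. cmod (v i) < \<delta>) \<longrightarrow> cmod (\<Psi> k j v - \<Psi> k j (\<lambda>_. 0)) \<le> \<epsilon>"
    if k: "k < 2*m" and j: "j < 2*m" and v: "\<And>i. cmod (v i) < r" for k j v and \<epsilon> :: real
  proof -
    have kk: "k < 2*d" "k + 2 < 2*d" using k m by auto
    interpret R1: parametric_integral m "2*d" \<iota> e p r "\<lambda>s. of_real s * exp (b k)" "\<lambda>s. exp (b k)" "\<lambda>c t. csqrt c * csqrt (1 - t / c)"
      by (rule radial_parametric[OF r st \<iota>i(1) \<iota>s kk(1)])
    interpret R2: parametric_integral m "2*d" \<iota> e p r "\<lambda>s. of_real s * exp (b (k+2))" "\<lambda>s. exp (b (k+2))" "\<lambda>c t. csqrt c * csqrt (1 - t / c)"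
      by (rule radial_parametric[OF r st \<iota>i(1) \<iota>s kk(2)])
    interpret A: parametric_integral m "2*d" \<iota> e p r "sector_arc \<theta> \<rho> k"
      "\<lambda>s. sector_arc \<theta> \<rho> k s * (b (k+2) - b k) / sector_arc \<theta> \<rho> k s ^ d" "\<lambda>c t. csqrt (1 - c / t)"
      by (rule arc_parametric[OF r st \<iota>i(1) \<iota>s])
    have \<Phi>: "\<Phi> k v = integral {0..1} (R2.F v) - integral {0..1} (R1.F v) - sheet_sign d k * integral {0..1} (A.F v)" for v
      unfolding \<Phi>_def period_def rad arc P_def E_def R1.F_def R2.F_def A.F_def ..
    have \<Psi>: "\<Psi> k j v = integral {0..1} (R2.DF j v) - integral {0..1} (R1.DF j v) - sheet_sign d k * integral {0..1} (A.DF j v)" for v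
      unfolding \<Psi>_def period_def rad arc N_def E_def R1.DF_def R2.DF_def A.DF_def ..
    have vX: "v \<in> {v. \<forall>i. cmod (v i) < r}" using v by simp
    show "((\<lambda>z. \<Phi> k (v(j := z))) has_field_derivative \<Psi> k j v) (at (v j))"
      unfolding \<Phi> \<Psi>
      by (intro DERIV_diff DERIV_cmult R1.integral_F_deriv[OF vX j] R2.integral_F_deriv[OF vX j] A.integral_F_deriv[OF vX j])
    assume \<epsilon>: "\<epsilon> > 0"
    then have \<epsilon>3: "\<epsilon> / 3 > 0" by simp
    obtain d1 where d1: "d1 > 0" "\<And>v. (\<forall>i. cmod (v i) < d1) \<Longrightarrow> cmod (integral {0..1} (R1.DF j v) - integral {0..1} (R1.DF j (\<lambda>_. 0))) \<le> \<epsilon> / 3"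
      using R1.integral_DF_near_0[OF j \<epsilon>3] by blast
    obtain d2 where d2: "d2 > 0" "\<And>v. (\<forall>i. cmod (v i) < d2) \<Longrightarrow> cmod (integral {0..1} (R2.DF j v) - integral {0..1} (R2.DF j (\<lambda>_. 0))) \<le> \<epsilon> / 3"
      using R2.integral_DF_near_0[OF j \<epsilon>3] by blast
    obtain d3 where d3: "d3 > 0" "\<And>v. (\<forall>i. cmod (v i) < d3) \<Longrightarrow> cmod (integral {0..1} (A.DF j v) - integral {0..1} (A.DF j (\<lambda>_. 0))) \<le> \<epsilon> / 3"
      using A.integral_DF_near_0[OF j \<epsilon>3] by blast
    have tri: "cmod ((a2 - a1 - s * a3) - (b2 - b1 - s * b3)) \<le> \<epsilon>"
      if "cmod (a1 - b1) \<le> \<epsilon> / 3" "cmod (a2 - b2) \<le> \<epsilon> / 3" "cmod (a3 - b3) \<le> \<epsilon> / 3" "s = 1 \<or> s = -1" for a1 a2 a3 b1 b2 b3 s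
    proof -
      have "(a2 - a1 - s * a3) - (b2 - b1 - s * b3) = (a2 - b2) - (a1 - b1) - s * (a3 - b3)" by (simp add: algebra_simps)
      also have "cmod \<dots> \<le> cmod (a2 - b2) + cmod (a1 - b1) + cmod (s * (a3 - b3))"
        by (meson norm_triangle_ineq4 order_trans add_right_mono)
      also have "cmod (s * (a3 - b3)) = cmod (a3 - b3)" using that(4) by (auto simp: norm_minus_commute)
      finally show ?thesis using that by linarith
    qed
    show "\<exists>\<delta>>0. \<forall>v. (\<forall>i. cmod (v i) < \<delta>) \<longrightarrow> cmod (\<Psi> k j v - \<Psi> k j (\<lambda>_. 0)) \<le> \<epsilon>"
    proof (intro exI[of _ "min d1 (min d2 d3)"] conjI allI impI)
      fix v :: "nat \<Rightarrow> complex" assume "\<forall>i. cmod (v i) < min d1 (min d2 d3)"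
      then show "cmod (\<Psi> k j v - \<Psi> k j (\<lambda>_. 0)) \<le> \<epsilon>"
        unfolding \<Psi> by (intro tri d1 d2 d3 sheet_sign_cases) auto
    qed (use d1 d2 d3 in auto)
  qed
  have E0: "E (\<lambda>_. 0) = e" and P0: "P (\<lambda>_. 0) = p"
    by (auto simp: E_def P_def moved_root_def moved_poly_def fun_eq_iff)
  \<comment> \<open>By linearity of the periods, a kernel vector of the Jacobian is a variation with
    vanishing periods: \<open>q\<close> collects the coefficient directions, and \<open>x\<close>
    the root directions, indexed by roots instead of parameters.\<close>
  have inj: "\<forall>j<2*m. v j = 0" if v: "\<forall>k<2*m. (\<Sum>j<2*m. \<Psi> k j (\<lambda>_. 0) * v j) = 0" for v
  proof -
    define q where "q = (\<Sum>l<m. monom (v (m + l)) l)"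
    define x where "x i = v (inv_into {..<m} \<iota> i)" for i
    have x\<iota>: "x (\<iota> j) = v j" if "j < m" for j using that \<iota>i(1) by (simp add: x_def)
    define rr where "rr t = poly q t + poly p t / 2 * (\<Sum>i\<in>J. x i / (t - e i))" for t
    have rr: "rr t = (\<Sum>j<2*m. v j * N j (\<lambda>_. 0) t)" for t
    proof -
      have "(\<Sum>i\<in>J. x i / (t - e i)) = (\<Sum>j<m. v j / (t - e (\<iota> j)))"
        unfolding \<iota>i(2)[symmetric] by (subst sum.reindex[OF \<iota>i(1)]) (simp add: x\<iota>)
      then have "poly p t / 2 * (\<Sum>i\<in>J. x i / (t - e i)) = (\<Sum>j<m. v j * (poly p t / (2 * (t - e (\<iota> j)))))"
        by (simp add: sum_distrib_left mult_ac)
      moreover have "poly q t = (\<Sum>l<m. v (m + l) * t ^ l)" by (simp add: q_def poly_sum poly_monom)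
      ultimately have "rr t = (\<Sum>j<m. v j * N j (\<lambda>_. 0) t) + (\<Sum>l<m. v (m + l) * N (m + l) (\<lambda>_. 0) t)"
        unfolding rr_def N_def variation_def using E0 P0 by (simp add: E_def P_def)
      then show ?thesis using sum_lessThan_add[of "\<lambda>j. v j * N j (\<lambda>_. 0) t" m m] by (simp add: mult_2)
    qed
    have "q = 0 \<and> (\<forall>i\<in>J. x i = 0)"
    proof (rule zero_periods_imp_zero_variation[of p q J rr x])
      show "degree p \<le> d - 1" using p by simp
      show "degree q \<le> d - 2" unfolding q_def
        using m by (intro degree_sum_le) (auto intro: order_trans[OF degree_monom_le])
      show "J \<subseteq> {..<2*d}" by (rule J2)
      show "card J = d - 1" using J m by simp
      show "poly p (e i) \<noteq> 0" if "i \<in> J" for i using that J(1) by (auto simp: I_def)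
      show "rr t = poly q t + poly p t / 2 * (\<Sum>i\<in>J. x i / (t - e i))" for t by (rule rr_def)
      fix k assume k: "k + 2 < 2*d"
      have NU: "continuous_on U (N j (\<lambda>_. 0))" "continuous_on {t. t \<noteq> 0 \<and> inverse t \<in> V} (N j (\<lambda>_. 0))" if "j < 2*m" for j
      proof -
        have "continuous_on S (N j (\<lambda>_. 0))" if S: "\<And>i. i < 2*d \<Longrightarrow> e i \<notin> S" for S
        proof (cases "j < m")
          case True
          then have i: "\<iota> j < 2*d" using \<iota>s by auto
          have "2 * (t - e (\<iota> j)) \<noteq> 0" if "t \<in> S" for t using that S[OF i] by auto
          then have "continuous_on S (\<lambda>t. poly p t / (2 * (t - e (\<iota> j))))"
            by (intro continuous_intros) auto
          then show ?thesis using True E0 P0 by (simp add: N_def variation_def E_def P_def)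
        next
          case False
          then show ?thesis by (simp add: N_def variation_def continuous_intros)
        qed
        moreover have "e i \<notin> U" "e i \<notin> {t. t \<noteq> 0 \<and> inverse t \<in> V}" if "i < 2*d" for i
          using root_nonzero[OF that] that by (auto simp: cut_plane_def)
        ultimately show "continuous_on U (N j (\<lambda>_. 0))" "continuous_on {t. t \<noteq> 0 \<and> inverse t \<in> V} (N j (\<lambda>_. 0))" by metis+
      qed
      have "period d \<theta> \<rho> k (\<lambda>t. rr t / inner_sqrt d e t) (\<lambda>t. rr t / outer_sqrt d e t) = (\<Sum>j<2*m. v j * \<Psi> k j (\<lambda>_. 0))"
        unfolding rr \<Psi>_def E0 by (rule period_over_sqrt_sum[OF finite_lessThan k]) (use NU in auto)
      also have "\<dots> = 0" using v k m by (simp add: mult.commute)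
      finally show "period d \<theta> \<rho> k (\<lambda>t. rr t / inner_sqrt d e t) (\<lambda>t. rr t / outer_sqrt d e t) = 0" .
    qed
    then have q0: "q = 0" and x0: "\<forall>i\<in>J. x i = 0" by auto
    have "v j = 0" if j: "j < 2*m" for j
    proof (cases "j < m")
      case True
      then show ?thesis using x0 x\<iota>[OF True] \<iota>i(2) by auto
    next
      case False
      have "coeff q (j - m) = (\<Sum>l<m. if l = j - m then v (m + l) else 0)"
        unfolding q_def coeff_sum by (intro sum.cong) auto
      also have "\<dots> = v j" using False j by (simp add: less_diff_conv2)
      finally show ?thesis using q0 by simp
    qed
    then show ?thesis by blast
  qed
  \<comment> \<open>The bound \<open>\<epsilon>\<close> is the required closeness; the bound
    \<open>r\<close> keeps the fixed paths valid for the moved roots.\<close>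
  define \<epsilon>' where "\<epsilon>' = min \<epsilon> r"
  have \<epsilon>': "\<epsilon>' > 0" using assms r by (simp add: \<epsilon>'_def)
  have r0: "\<And>i. cmod ((\<lambda>_::nat. 0) i) < r" using r by simp
  have "\<exists>\<eta>>0. \<forall>y. (\<forall>k<2*m. cmod (y k - \<Phi> k (\<lambda>_. 0)) < \<eta>) \<longrightarrow>
           (\<exists>x. (\<forall>i. cmod (x i) < \<epsilon>') \<and> (\<forall>k<2*m. \<Phi> k x = y k))"
    by (rule local_surjectivity[where \<Psi> = \<Psi>, OF r deriv _ inj \<epsilon>']) (use near[OF _ _ r0] in auto)
  then obtain \<eta> where \<eta>: "\<eta> > 0" "\<And>y. (\<forall>k<2*m. cmod (y k - \<Phi> k (\<lambda>_. 0)) < \<eta>) \<Longrightarrow>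
           (\<exists>x. (\<forall>i. cmod (x i) < \<epsilon>') \<and> (\<forall>k<2*m. \<Phi> k x = y k))" by blast
  \<comment> \<open>The multiples of \<open>2 pi / n\<close> are spaced by less than
    \<open>\<eta>\<close>, so rounding down every imaginary period stays within the range of local
    surjectivity.\<close>
  obtain n where n: "n > 0" "2 * pi / \<eta> < real n"
    using reals_Archimedean2[of "2 * pi / \<eta>"] by (metis \<eta>(1) divide_pos_pos gr0I mult_pos_pos of_nat_0 order_less_asym pi_gt_zero zero_less_numeral)
  define a where "a k = \<lfloor>real n * Im (\<Phi> k (\<lambda>_. 0)) / (2 * pi)\<rfloor>" for k
  define y where "y k = 2 * of_real pi * \<i> * of_int (a k) / of_nat n" for k
  have "cmod (y k - \<Phi> k (\<lambda>_. 0)) < \<eta>" if k: "k < 2*m" for k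
  proof -
    define h where "h = Im (\<Phi> k (\<lambda>_. 0))"
    have re: "Re (\<Phi> k (\<lambda>_. 0)) = 0" unfolding \<Phi>_def E0 P0 using im[of k] k m by simp
    have y: "y k = \<i> * of_real (2 * pi * of_int (a k) / real n)" by (simp add: y_def)
    have "y k - \<Phi> k (\<lambda>_. 0) = \<i> * of_real (2 * pi * of_int (a k) / real n - h)"
      unfolding y using re by (simp add: complex_eq_iff h_def)
    then have "cmod (y k - \<Phi> k (\<lambda>_. 0)) = \<bar>2 * pi * of_int (a k) / real n - h\<bar>"
      by (simp only: norm_mult norm_ii norm_of_real mult_1)
    also have "2 * pi * of_int (a k) / real n - h = (2 * pi / real n) * (of_int (a k) - real n * h / (2 * pi))"
      using n(1) by (simp add: field_simps)
    also have "\<bar>\<dots>\<bar> = (2 * pi / real n) * \<bar>of_int (a k) - real n * h / (2 * pi)\<bar>"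
      by (simp add: abs_mult)
    also have "\<dots> \<le> (2 * pi / real n) * 1"
    proof (rule mult_left_mono)
      show "\<bar>of_int (a k) - real n * h / (2 * pi)\<bar> \<le> 1" unfolding a_def h_def[symmetric] by linarith
    qed simp
    also have "\<dots> < \<eta>" using n \<eta>(1) by (simp add: field_simps)
    finally show ?thesis .
  qed
  then obtain v where v: "\<And>i. cmod (v i) < \<epsilon>'" "\<And>k. k < 2*m \<Longrightarrow> \<Phi> k v = y k" using \<eta>(2)[of y] by auto
  interpret R1: parametric_integral m "2*d" \<iota> e p \<epsilon>' "\<lambda>s. of_real s * exp (b 0)" "\<lambda>s. exp (b 0)" "\<lambda>c t. csqrt c * csqrt (1 - t / c)"
    by (rule radial_parametric[OF \<epsilon>' st \<iota>i(1) \<iota>s]) (use d_ge in \<open>auto simp: \<epsilon>'_def\<close>)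
  have Ev: "cmod (E v i - e i) < \<epsilon>'" for i
    using R1.moved_root_in_ball[of v i] v(1) by (simp add: E_def dist_norm norm_minus_commute)
  have conf: "root_configuration d (E v) \<theta> \<rho>" using Ev by (intro st) (simp add: \<epsilon>'_def)
  interpret v: root_configuration d "E v" \<theta> \<rho> by (rule conf)
  \<comment> \<open>The correction stays below degree \<open>d - 1\<close>, so the moved polynomial
    is monic and the residue normalization persists.\<close>
  have "degree (\<Sum>j<m. monom (v (m + j)) j) < degree p"
  proof -
    have "degree (\<Sum>j<m. monom (v (m + j)) j) \<le> m - 1"
      by (intro degree_sum_le) (auto intro: order_trans[OF degree_monom_le])
    then show ?thesis using p(1) m by simp
  qed
  then have Pv: "degree (P v) = d - 1" "lead_coeff (P v) = 1"
    unfolding P_def moved_poly_def using p by (simp_all add: degree_add_eq_left coeff_eq_0)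
  show ?thesis
  proof (rule that[of "E v"])
    show "pellian (\<Prod>i<2*d. [:- E v i, 1:])"
    proof (rule v.pellian_of_commensurable_periods[OF Pv n(1)])
      fix k assume "k + 2 < 2*d"
      then have "k < 2*m" using m by simp
      then have "of_nat n * \<Phi> k v = 2 * of_real pi * \<i> * of_int (a k)" using v(2) n(1) by (simp add: y_def)
      then show "\<exists>l::int. of_nat n * period d \<theta> \<rho> k (\<lambda>t. poly (P v) t / inner_sqrt d (E v) t)
          (\<lambda>t. poly (P v) t / outer_sqrt d (E v) t) = 2 * of_real pi * \<i> * of_int l"
        unfolding \<Phi>_def by blast
    qed
  qed (use Ev conf in \<open>auto simp: \<epsilon>'_def\<close>)
qed

end

section \<open>Coefficients, roots and arguments\<close>

lemma coeff_D_poly: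
  assumes "k < length s"
  shows "coeff (D_poly s) k = s ! (length s - 1 - k)"
proof -
  have "coeff (D_poly s) k = (\<Sum>i<length s. if i = length s - 1 - k then s ! i else 0)"
  proof -
    have "coeff (monom 1 (length s)) k = (0 :: complex)" using assms by simp
    then show ?thesis unfolding D_poly_def coeff_add coeff_sum
      by (simp only: add_0) (intro sum.cong refl, use assms in auto)
  qed
  then show ?thesis using assms by simp
qed

lemma D_poly_monic: "degree (D_poly s) = length s" "coeff (D_poly s) (length s) = 1"
proof -
  have "coeff (\<Sum>i<length s. monom (s ! i) (length s - 1 - i)) (length s) = 0"
    unfolding coeff_sum by (intro sum.neutral) auto
  then show one: "coeff (D_poly s) (length s) = 1" by (simp add: D_poly_def)
  have "degree (D_poly s) \<le> length s" unfolding D_poly_def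
    by (intro degree_add_le degree_sum_le) (auto intro: order_trans[OF degree_monom_le])
  then show "degree (D_poly s) = length s" using le_degree[of "D_poly s" "length s"] one by simp
qed

lemma D_poly_of_coeffs:
  assumes "degree D = n" "coeff D n = 1"
  shows "D_poly (map (\<lambda>i. coeff D (n - 1 - i)) [0..<n]) = D" (is "D_poly ?s = D")
proof (rule poly_eqI)
  fix k
  consider "k < n" | "k = n" | "k > n" by linarith
  then show "coeff (D_poly ?s) k = coeff D k"
  proof cases
    case 1
    then show ?thesis using coeff_D_poly[of k ?s] by simp
  next
    case 2
    then show ?thesis using D_poly_monic(2)[of ?s] assms by simp
  next
    case 3
    then show ?thesis using D_poly_monic(1)[of ?s] assms by (simp add: coeff_eq_0)
  qed
qed

lemma monic_splits:
  fixes D :: "complex poly"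
  assumes "degree D = n" "coeff D n = 1"
  obtains a where "length a = n" "D = (\<Prod>i<n. [:- (a ! i), 1:])"
proof -
  obtain A where A: "size A = degree D" "D = Polynomial.smult (lead_coeff D) (\<Prod>x\<in>#A. [:-x, 1:])"
    using alg_closed_imp_factorization[of D] assms by force
  obtain a where a: "mset a = A" using ex_mset by blast
  have "(\<Prod>x\<in>#A. [:-x, 1:]) = prod_list (map (\<lambda>x. [:-x, 1:]) a)"
    unfolding a[symmetric] by (simp add: prod_mset_prod_list[symmetric])
  also have "\<dots> = (\<Prod>i<length a. [:- (a ! i), 1:])"
    by (simp add: prod.list_conv_set_nth lessThan_atLeast0)
  finally show ?thesis using that[of a] A a assms by (metis size_mset smult_1_left)
qed

text \<open>Along the segment \<open>y * (1 + i \<tau>)\<close> the argument takes every value at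
  most once, hence infinitely many values, and a finite set can be avoided. A point
  \<open>c = 0\<close> is first replaced by a nonzero \<open>y\<close>.\<close>

lemma perturb_argument:
  assumes "\<delta> > 0" "finite F"
  shows "\<exists>c'. cmod (c' - c) < \<delta> \<and> c' \<noteq> 0 \<and> Arg c' \<notin> F"
proof -
  define y where "y = (if c = 0 then of_real (\<delta> / 2) else c)"
  have y0: "y \<noteq> 0" and yc: "cmod (y - c) \<le> \<delta> / 2" using assms by (auto simp: y_def)
  define z where "z \<tau> = y * Complex 1 \<tau>" for \<tau> :: real
  define T where "T = \<delta> / (2 * cmod y)"
  have T: "T > 0" using assms y0 by (simp add: T_def)
  have z0: "z \<tau> \<noteq> 0" for \<tau>
  proof -
    have "Complex 1 \<tau> \<noteq> 0" by (simp add: complex_eq_iff)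
    then show ?thesis using y0 by (simp add: z_def)
  qed
  have "inj_on (\<lambda>\<tau>. Arg (z \<tau>)) {0<..<T}"
  proof (rule inj_onI)
    fix s t assume eq: "Arg (z s) = Arg (z t)"
    define p q where "p = cmod (z s)" and "q = cmod (z t)"
    have zs: "z s = of_real p * cis (Arg (z t))" using rcis_cmod_Arg[of "z s"] eq by (simp add: rcis_def p_def)
    have zt: "z t = of_real q * cis (Arg (z t))" using rcis_cmod_Arg[of "z t"] by (simp add: rcis_def q_def)
    have "z s * of_real q = of_real p * (of_real q * cis (Arg (z t)))" by (subst zs) (simp only: mult_ac)
    also have "\<dots> = z t * of_real p" by (simp only: zt[symmetric] mult.commute)
    finally have "y * (Complex 1 s * of_real q) = y * (Complex 1 t * of_real p)"
      unfolding z_def by (simp only: mult.assoc)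
    then have "Complex 1 s * of_real q = Complex 1 t * of_real p" using y0 by simp
    then have "q = p" "s * q = t * p" by (auto simp: complex_eq_iff)
    moreover have "p \<noteq> 0" using z0[of s] by (simp add: p_def)
    ultimately show "s = t" by simp
  qed
  then have "infinite ((\<lambda>\<tau>. Arg (z \<tau>)) ` {0<..<T})"
    using T infinite_Ioo[of 0 T] finite_imageD by metis
  then have "\<not> (\<lambda>\<tau>. Arg (z \<tau>)) ` {0<..<T} \<subseteq> F"
    using assms(2) by (metis finite_subset)
  then obtain \<tau> where \<tau>: "\<tau> \<in> {0<..<T}" "Arg (z \<tau>) \<notin> F" by blast
  have "z \<tau> - y = y * (\<i> * of_real \<tau>)" by (simp add: z_def complex_eq_iff)
  then have "cmod (z \<tau> - y) = cmod y * \<tau>" using \<tau>(1) by (simp add: norm_mult)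
  also have "\<dots> < cmod y * T" using \<tau>(1) y0 by simp
  also have "\<dots> = \<delta> / 2" using y0 by (simp add: T_def)
  finally have "cmod (z \<tau> - c) < \<delta>"
    using yc norm_triangle_ineq[of "z \<tau> - y" "y - c"] by simp
  then show ?thesis using \<tau>(2) z0 by blast
qed

lemma perturb_arguments:
  assumes "\<delta> > 0"
  shows "\<exists>b. length b = length a \<and> (\<forall>i<length a. cmod (b ! i - a ! i) < \<delta>) \<and> distinct (map Arg b) \<and>
    (\<forall>x\<in>set b. x \<noteq> 0 \<and> Arg x \<noteq> pi)"
proof (induction a)
  case (Cons c a)
  then obtain b where b: "length b = length a" "\<forall>i<length a. cmod (b ! i - a ! i) < \<delta>" "distinct (map Arg b)"
    "\<forall>x\<in>set b. x \<noteq> 0 \<and> Arg x \<noteq> pi" by blast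
  \<comment> \<open>Avoiding \<open>pi\<close> as well keeps the roots off the cut of
    \<open>Arg\<close> and \<open>csqrt\<close>.\<close>
  obtain c' where c': "cmod (c' - c) < \<delta>" "c' \<noteq> 0" "Arg c' \<notin> insert pi (Arg ` set b)"
    using perturb_argument[OF assms, of "insert pi (Arg ` set b)" c] by auto
  have "cmod ((c' # b) ! i - (c # a) ! i) < \<delta>" if "i < length (c # a)" for i
    using that b(2) c'(1) by (cases i) auto
  then show ?case using b c' by (intro exI[of _ "c' # b"]) auto
qed simp

text \<open>Stated for displacements \<open>v\<close> of the roots, so that the point of interest is
  the zero function, where \<open>open_fun_contains_ball\<close> applies.\<close>

lemma continuous_coeff_prod:
  "continuous_on UNIV (\<lambda>v :: nat \<Rightarrow> complex. coeff (\<Prod>i<n. [:- (x i + v i), 1:]) k)"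
proof (induction n arbitrary: k)
  case (Suc n)
  have "coeff (p * [:c, 1:]) k = c * coeff p k + (if k = 0 then 0 else coeff p (k - 1))" for c and p :: "complex poly"
    by (cases k) (simp_all add: mult_pCons_right)
  moreover have "continuous_on UNIV (\<lambda>v :: nat \<Rightarrow> complex. - (x n + v n) * coeff (\<Prod>i<n. [:- (x i + v i), 1:]) k
      + (if k = 0 then 0 else coeff (\<Prod>i<n. [:- (x i + v i), 1:]) (k - 1)))"
  proof (rule continuous_on_add)
    show "continuous_on UNIV (\<lambda>v :: nat \<Rightarrow> complex. - (x n + v n) * coeff (\<Prod>i<n. [:- (x i + v i), 1:]) k)"
      by (intro continuous_on_mult Suc continuous_on_minus continuous_on_add continuous_on_const
          continuous_on_product_coordinates)
    show "continuous_on UNIV (\<lambda>v :: nat \<Rightarrow> complex. if k = 0 then 0 else coeff (\<Prod>i<n. [:- (x i + v i), 1:]) (k - 1))"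
      by (cases "k = 0") (simp_all only: if_True if_False simp_thms Suc continuous_on_const)
  qed
  ultimately show ?case by (simp only: prod.lessThan_Suc)
qed simp

lemma coeff_prod_close:
  fixes x :: "nat \<Rightarrow> complex"
  assumes "\<epsilon> > 0"
  obtains \<delta> where "\<delta> > 0"
    "\<And>y k. \<lbrakk>\<And>i. i < n \<Longrightarrow> cmod (y i - x i) < \<delta>; k \<le> n\<rbrakk> \<Longrightarrow>
      cmod (coeff (\<Prod>i<n. [:- y i, 1:]) k - coeff (\<Prod>i<n. [:- x i, 1:]) k) < \<epsilon>"
proof -
  define f where "f k v = coeff (\<Prod>i<n. [:- (x i + v i), 1:]) k" for k and v :: "nat \<Rightarrow> complex"
  define A where "A = (\<Inter>k\<in>{..n}. f k -` ball (f k (\<lambda>_. 0)) \<epsilon>)"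
  have "open (f k -` ball (f k (\<lambda>_. 0)) \<epsilon>)" for k
    unfolding f_def by (intro open_vimage continuous_coeff_prod) simp
  then have "open A" unfolding A_def by blast
  moreover have "(\<lambda>_. 0) \<in> A" using assms by (simp add: A_def)
  ultimately obtain \<delta> where \<delta>: "\<delta> > 0" "\<And>v. (\<forall>i. cmod (v i) < \<delta>) \<Longrightarrow> v \<in> A"
    using open_fun_contains_ball[of A] by metis
  show ?thesis
  proof (rule that[OF \<delta>(1)])
    fix y k assume y: "\<And>i. i < n \<Longrightarrow> cmod (y i - x i) < \<delta>" and k: "k \<le> n"
    define v where "v i = (if i < n then y i - x i else 0)" for i
    have "v \<in> A" using y \<delta> by (intro \<delta>(2)) (auto simp: v_def)
    then have "dist (f k (\<lambda>_. 0)) (f k v) < \<epsilon>" using k by (auto simp: A_def)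
    moreover have "f k v = coeff (\<Prod>i<n. [:- y i, 1:]) k"
      unfolding f_def by (intro arg_cong2[where f = coeff] prod.cong refl) (simp add: v_def)
    ultimately show "cmod (coeff (\<Prod>i<n. [:- y i, 1:]) k - coeff (\<Prod>i<n. [:- x i, 1:]) k) < \<epsilon>"
      by (simp add: dist_norm norm_minus_commute f_def)
  qed
qed

text \<open>At a root, the derivative of the product equals the product of the other linear factors,
  which is nonzero for distinct roots; so the product and its derivative have no common
  root.\<close>

lemma discriminant_nonzero:
  fixes e :: "nat \<Rightarrow> complex"
  assumes "inj_on e {..<n}"
  shows "discriminant (\<Prod>i<n. [:- e i, 1:]) \<noteq> 0"
proof -
  define D where "D = (\<Prod>i<n. [:- e i, 1:])"
  have D0: "D \<noteq> 0" by (simp add: D_def)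
  have "poly (pderiv D) t \<noteq> 0" if t: "poly D t = 0" for t
  proof -
    obtain i where i: "i < n" "t = e i" using t by (auto simp: D_def poly_prod)
    define R where "R = (\<Prod>j\<in>{..<n}-{i}. [:- e j, 1:])"
    have D_eq: "D = [:- e i, 1:] * R" unfolding D_def R_def using i by (subst prod.remove[of _ i]) auto
    have "poly (pderiv D) t = poly R t"
      unfolding D_eq pderiv_mult poly_add poly_mult by (simp add: pderiv_pCons i)
    moreover have "poly R t \<noteq> 0" using assms i by (auto simp: R_def poly_prod inj_on_def)
    ultimately show ?thesis by simp
  qed
  then have "resultant D (pderiv D) \<noteq> 0" by (rule resultant_nonzero_of_no_common_root[OF D0])
  then show ?thesis using D0 by (simp add: discriminant_def D_def)
qed

lemma root_configuration_of_sorted: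
  assumes d: "d \<ge> 2" and e: "\<And>i. i < 2*d \<Longrightarrow> e i \<noteq> 0 \<and> Arg (e i) \<noteq> pi"
    and mono: "\<And>i. Suc i < 2*d \<Longrightarrow> Arg (e i) < Arg (e (Suc i))"
  obtains \<theta> \<rho> where "root_configuration d e \<theta> \<rho>"
proof
  define \<theta> where "\<theta> i = (if i = 0 then - pi else (Arg (e (i - 1)) + Arg (e i)) / 2)" for i
  define \<rho> where "\<rho> = 1 + (\<Sum>i<2*d. cmod (e i))"
  show "root_configuration d e \<theta> \<rho>"
  proof
    show "\<theta> 0 = - pi" by (simp add: \<theta>_def)
    show "\<theta> i < Arg (e i)" if "i < 2*d" for i
      using Arg_bounded[of "e i"] mono[of "i - 1"] that by (cases i) (auto simp: \<theta>_def)
    show "Arg (e i) < \<theta> (Suc i)" if "Suc i < 2*d" for i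
      using mono[OF that] by (simp add: \<theta>_def)
    show "Arg (e i) < pi" if "i < 2*d" for i
      using Arg_bounded[of "e i"] e[OF that] by linarith
    show "cmod (e i) < \<rho>" if "i < 2*d" for i
      using member_le_sum[of i "{..<2*d}" "\<lambda>i. cmod (e i)"] that by (simp add: \<rho>_def)
  qed (use d e in auto)
qed

text \<open>Two perturbations of the roots, each changing the coefficients by less than
  \<open>\<epsilon> / 2\<close>: the first separates the arguments, the second makes the periods
  commensurable.\<close>

theorem theorem1p2:
  fixes d :: nat
  assumes "d \<ge> 2"
  shows "\<forall>s \<in> B_set d. \<forall>\<epsilon> > 0. \<exists>s' \<in> P_set d.
           (\<forall>i < 2 * d. cmod (s' ! i - s ! i) < \<epsilon>)"
proof (intro ballI allI impI)
  fix s and \<epsilon> :: real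
  assume s: "s \<in> B_set d" and \<epsilon>: "\<epsilon> > 0"
  define n where "n = 2 * d"
  have len: "length s = n" using s by (simp add: B_set_def n_def)
  obtain a where a: "length a = n" "D_poly s = (\<Prod>i<n. [:- (a ! i), 1:])"
    using monic_splits D_poly_monic[of s] len by metis
  have \<epsilon>2: "\<epsilon> / 2 > 0" using \<epsilon> by simp
  obtain \<delta>1 where \<delta>1: "\<delta>1 > 0" "\<And>y k. \<lbrakk>\<And>i. i < n \<Longrightarrow> cmod (y i - a ! i) < \<delta>1; k \<le> n\<rbrakk> \<Longrightarrow>
      cmod (coeff (\<Prod>i<n. [:- y i, 1:]) k - coeff (\<Prod>i<n. [:- (a ! i), 1:]) k) < \<epsilon> / 2"
    by (rule coeff_prod_close[OF \<epsilon>2, of n "\<lambda>i. a ! i"]) blast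
  obtain b where b: "length b = n" "\<forall>i<n. cmod (b ! i - a ! i) < \<delta>1" "distinct (map Arg b)"
    "\<forall>x\<in>set b. x \<noteq> 0 \<and> Arg x \<noteq> pi"
    using perturb_arguments[OF \<delta>1(1), of a] a(1) by auto
  \<comment> \<open>The configuration needs increasing arguments, whereas the perturbed roots follow
    the order of the factorization; sorting does not change the product.\<close>
  define L where "L = sort_key Arg b"
  have L: "length L = n" "mset L = mset b" using b(1) by (simp_all add: L_def)
  define e where "e i = L ! i" for i
  have prod_e: "(\<Prod>i<n. [:- e i, 1:]) = (\<Prod>i<n. [:- (b ! i), 1:])"
  proof -
    have "(\<Prod>i<length xs. [:- (xs ! i), 1:]) = (\<Prod>x\<in>#mset xs. [:-x, 1:])" for xs :: "complex list"
    proof -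
      have "(\<Prod>i<length xs. [:- (xs ! i), 1:]) = prod_list (map (\<lambda>x. [:-x, 1:]) xs)"
        by (simp add: prod.list_conv_set_nth lessThan_atLeast0)
      then show ?thesis by (simp add: prod_mset_prod_list[symmetric])
    qed
    from this[of L] this[of b] show ?thesis using L b(1) by (simp add: e_def)
  qed
  have "sorted (map Arg L)" by (simp add: L_def)
  moreover have "distinct (map Arg L)"
    using b(3) L(2) by (metis distinct_map mset_eq_imp_distinct_iff mset_eq_setD)
  ultimately have "sorted_wrt (<) (map Arg L)" by (simp add: strict_sorted_iff)
  then have mono: "Arg (e i) < Arg (e (Suc i))" if "Suc i < 2*d" for i
    using that L(1) sorted_wrt_nth_less[of "(<)" "map Arg L" i "Suc i"] by (simp add: e_def n_def)
  have e_ok: "e i \<noteq> 0 \<and> Arg (e i) \<noteq> pi" if "i < 2*d" for i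
  proof -
    have "e i \<in> set b" using that L by (metis e_def mset_eq_setD n_def nth_mem)
    then show ?thesis using b(4) by blast
  qed
  obtain \<theta> \<rho> where "root_configuration d e \<theta> \<rho>"
    using root_configuration_of_sorted[of d e] assms e_ok mono by metis
  then interpret e: root_configuration d e \<theta> \<rho> .
  obtain \<delta>2 where \<delta>2: "\<delta>2 > 0" "\<And>y k. \<lbrakk>\<And>i. i < n \<Longrightarrow> cmod (y i - e i) < \<delta>2; k \<le> n\<rbrakk> \<Longrightarrow>
      cmod (coeff (\<Prod>i<n. [:- y i, 1:]) k - coeff (\<Prod>i<n. [:- e i, 1:]) k) < \<epsilon> / 2"
    by (rule coeff_prod_close[OF \<epsilon>2, of n e]) blast
  obtain e' where e': "\<And>i. i < 2*d \<Longrightarrow> cmod (e' i - e i) < \<delta>2" "root_configuration d e' \<theta> \<rho>"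
    "pellian (\<Prod>i<2*d. [:- e' i, 1:])"
    using e.pellian_near[OF \<delta>2(1)] by blast
  interpret e': root_configuration d e' \<theta> \<rho> by (rule e'(2))
  define D where "D = (\<Prod>i<n. [:- e' i, 1:])"
  have D: "degree D = n" "coeff D n = 1"
  proof -
    show deg: "degree D = n" unfolding D_def by (subst degree_prod_eq_sum_degree) auto
    have "lead_coeff D = 1" unfolding D_def by (subst lead_coeff_prod) auto
    then show "coeff D n = 1" using deg by simp
  qed
  define s' where "s' = map (\<lambda>i. coeff D (n - 1 - i)) [0..<n]"
  have Ds': "D_poly s' = D" unfolding s'_def by (rule D_poly_of_coeffs[OF D])
  \<comment> \<open>Distinct directions make the new roots distinct, which keeps the new polynomial
    in \<open>B_set\<close>.\<close>
  have "inj_on e' {..<n}"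
    using e'.distinct e'.root_nonzero unfolding n_def
    by (intro inj_onI) (metis divide_self lessThan_iff nonneg_Reals_one_I)
  then have "discriminant D \<noteq> 0" unfolding D_def by (rule discriminant_nonzero)
  then have "s' \<in> P_set d"
    using e'(3) Ds' by (simp add: P_set_def B_set_def s'_def D_def n_def)
  moreover have "cmod (s' ! i - s ! i) < \<epsilon>" if i: "i < 2 * d" for i
  proof -
    define k where "k = n - 1 - i"
    have k: "k \<le> n" "k < n" "n - 1 - k = i" using i by (auto simp: k_def n_def)
    have "s' ! i = coeff D k" using i by (simp add: s'_def k_def n_def)
    moreover have "s ! i = coeff (D_poly s) k" using coeff_D_poly[of k s] k len by simp
    \<comment> \<open>The products over \<open>e\<close> and over \<open>b\<close> coincide, so the
      error splits into the contributions of the two perturbations.\<close>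
    ultimately have eq: "s' ! i - s ! i = (coeff D k - coeff (\<Prod>i<n. [:- e i, 1:]) k)
        + (coeff (\<Prod>i<n. [:- (b ! i), 1:]) k - coeff (\<Prod>i<n. [:- (a ! i), 1:]) k)"
      using prod_e a(2) by simp
    have "cmod (coeff D k - coeff (\<Prod>i<n. [:- e i, 1:]) k) < \<epsilon> / 2"
      unfolding D_def using e'(1) k(1) by (intro \<delta>2(2)) (auto simp: n_def)
    moreover have "cmod (coeff (\<Prod>i<n. [:- (b ! i), 1:]) k - coeff (\<Prod>i<n. [:- (a ! i), 1:]) k) < \<epsilon> / 2"
      using b(2) k(1) by (intro \<delta>1(2)) auto
    ultimately show ?thesis unfolding eq by (intro norm_triangle_lt) linarith
  qed
  ultimately show "\<exists>s'\<in>P_set d. \<forall>i<2 * d. cmod (s' ! i - s ! i) < \<epsilon>" by blast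
qed

end
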